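(* Let $F=\alpha^2/\beta$ be a Kropina metric on an $n$-dimensional manifold $M$. Then the scalar curvature of $F$ is given by $$\begin{aligned} R={}&-\frac{24(n-2)\beta}{b^6F^5}r_{00}^2\\ &+\frac{1}{F^4}\Big\{-\frac{(n-1)(n-8)}{b^4}r_{00}^2+\frac{40(n-2)\beta}{b^6}r_{00}r_0-\frac{8(n-2)\beta}{b^6}r_{00}s_0-\frac{4(n-2)\beta}{b^4}r_{00|0}\Big\}\\ &+\frac{1}{F^3}\Big\{\frac{2(n-1)}{b^2}r_{00|0}+\frac{4(n-1)}{b^4}r_{00}(s_0-2r_0)+\frac{2(n-2)\beta}{b^4}r_{0|0}-\frac{2(n-2)\beta}{b^4}s_{0|0}+\frac{2(n-2)\beta}{b^4}b^mr_{00|m}\\ &\quad+\frac{2(n-1)\beta}{b^4}r^k_{\;0}r_{k0}-\frac{4(n-2)\beta}{b^4}r_{k0}s^k_{\;0}-\frac{14(n-2)\beta}{b^6}r_0^2+\frac{2(n-2)\beta}{b^6}s_0^2+\frac{2(n-3)(b^2r^m_{\;m}-r)\beta}{b^6}r_{00}\\ &\quad+\frac{12(n-2)\beta}{b^6}r_0s_0-\frac{2(3n-5)\beta}{b^6}r_{00}r-\frac{2\beta}{b^2}\,{}^\alpha Ric\Big\}\\ &+\frac{1}{F^2}\Big\{-\frac{n^2+4n-7}{b^4}s_0r_0+\frac{n^2+2n-1}{b^2}r_{0m}s^m_{\;0}-\frac{(n-5)(b^2r^m_{\;m}-r)\beta}{b^6}r_0+\frac{3(n-1)\beta}{b^6}rr_0\\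 &\quad+\frac{(n-1)(b^2r^m_{\;m}-r)}{b^6}\beta s_0-\frac{(2n-3)\beta}{b^4}r^m_{\;0}s_m-\frac{(3n-7)\beta}{b^6}rs_0-\frac{n-2}{b^4}s_0^2+\frac{r_0^2}{b^4}-\frac{\beta}{b^2}r^m_{\;m|0}\\ &\quad+\frac{n-1}{b^2}\beta r^m_{\;0|m}-\frac{(2n-1)\beta}{b^4}r_{m0}r^m+\frac{(n-2)\beta}{b^4}b^ms_{0|m}-\frac{(n-2)\beta}{b^4}s_ms^m_{\;0}+\frac{n-2}{b^2}s_{0|0}\\ &\quad+\frac{b^2r^m_{\;m}-r}{b^4}r_{00}-\frac{(n-2)\beta}{b^4}b^mr_{0|m}+\frac{b^mr_{00|m}}{b^2}-\frac{r_{0|0}}{b^2}+\frac{(n-2)\beta}{b^4}r_ms^m_{\;0}+{}^\alpha Ric+\frac{\beta}{b^2}(b^ky^l+b^ly^k)\,{}^\alpha Ric_{kl}\Big\}\\ &+\frac1F\Big\{\frac{n^2-1}{2b^2}s_ms^m_{\;0}+\frac{(n+1)(b^2r^m_{\;m}-r)}{2b^4}s_0+\frac{(n+1)s_{0|m}b^m}{2b^2}-\frac{n+1}{2b^2}r_ms^m_{\;0}-\frac{n+1}{2b^2}r_{0m}s^m-\frac{n+1}{2}s^m_{\;0|m}\\ &\quad-\frac{(n-2)\beta}{b^4}s_ms^m+\frac{\beta r^mr_m}{b^4}-\frac{(n-3)\beta}{2b^4}r^ks_k+\frac{(n-2)\beta}{2b^2}s^m_{\;|m}+\frac{r^m_{\;m}r^t_{\;t}}{2b^2}\beta-\frac{rr^m_{\;m}\beta}{b^4}+\frac{\beta}{2b^2}b^mr^k_{\;k|m}\\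 &\quad-\frac{\beta}{2b^2}r^m_{\;|m}+\frac{(n-1)\beta}{2b^2}r^k_{\;m}s^m_{\;k}+\frac{\beta}{2b^2}\left(b^2\,{}^\alpha R-b^kb^l\,{}^\alpha Ric_{kl}\right)\Big\}-\frac{n}{2b^2}s_ms^m-\frac n4s^t_{\;m}s^m_{\;t}, \end{aligned}$$ where ${}^\alpha R$ denotes the scalar curvature of $\alpha$.
   Context: Kropina metric: $F=\alpha^2/\beta$, where $\alpha=\sqrt{a_{ij}(x)y^iy^j}$ is a Riemannian metric and $\beta=b_i(x)y^i$ is a nowhere vanishing $1$-form on $M$; $F$ and its curvatures are considered at those $(x,y)\in TM$ with $\beta(x,y)>0$. Summation convention is used. $(a^{ij})=(a_{ij})^{-1}$; indices of $b_i,r_{ij},s_{ij},r_i,s_i$ are raised with $a^{ij}$; $b^i=a^{ij}b_j$, $b^2=a^{ij}b_ib_j$, $b^4=(b^2)^2$, $b^6=(b^2)^3$. Finsler curvatures of $F$: $g_{ij}=\frac12(F^2)_{y^iy^j}$, $(g^{ij})=(g_{ij})^{-1}$; spray coefficients $G^i=\frac14g^{ik}[(F^2)_{x^jy^k}y^j-(F^2)_{x^k}]$; Riemann curvature $$R^i_{\;k}=2\frac{\partial G^i}{\partial x^k}-y^j\frac{\partial^2G^i}{\partial x^j\partial y^k}+2G^j\frac{\partial^2G^i}{\partial y^j\partial y^k}-\frac{\partial G^i}{\partial y^j}\frac{\partial G^j}{\partial y^k};$$ Riemann curvature tensor $R_{j\;kl}^{\;\,i}=\frac13\left\{\frac{\partial^2R^i_{\;k}}{\partial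 y^l\partial y^j}-\frac{\partial^2R^i_{\;l}}{\partial y^k\partial y^j}\right\}$; $\overline{Ric}_{ij}=R_{i\;mj}^{\;\,m}$; Ricci curvature tensor $Ric_{ij}=\frac12(\overline{Ric}_{ij}+\overline{Ric}_{ji})$; scalar curvature $R=g^{ij}Ric_{ij}$. ${}^\alpha Ric_{ij}$ is the Ricci tensor of the Riemannian metric $\alpha$, ${}^\alpha Ric={}^\alpha Ric_{ij}y^iy^j$ its Ricci curvature, and ${}^\alpha R=a^{ij}\,{}^\alpha Ric_{ij}$ its scalar curvature. A bar $|$ denotes covariant derivative with respect to the Levi-Civita connection of $\alpha$, and a subscript $0$ denotes contraction with $y$ (e.g. $r_{k0}=r_{kj}y^j$, $r_{00|0}=r_{ij|k}y^iy^jy^k$, $r_{00|m}=r_{ij|m}y^iy^j$, $r_{0|0}=r_{i|j}y^iy^j$, $s_{0|0}=s_{i|j}y^iy^j$, $s_{0|m}=s_{j|m}y^j$, $r_{0|m}=r_{j|m}y^j$, $r^m_{\;0|m}=r^m_{\;j|m}y^j$, $s^m_{\;0|m}=s^m_{\;j|m}y^j$, $r^m_{\;m|0}=r^m_{\;m|j}y^j$). $r_{ij}=\frac12(b_{i|j}+b_{j|i})$, $s_{ij}=\frac12(b_{i|j}-b_{j|i})$, $r_{00}=r_{ij}y^iy^j$, $r_i=b^jr_{ij}$, $r_0=r_iy^i$, $r^i=a^{ij}r_j$, $r=b^ir_i$, $r^i_{\;j}=a^{ik}r_{kj}$, $s^i_{\;j}=a^{ik}s_{kj}$, $s^i_{\;0}=a^{ij}s_{jk}y^k$,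 $s_i=b^js_{ji}$, $s_0=s_iy^i$, $s^i=a^{ij}s_j$. *)

theory Defs
  imports "HOL-Analysis.Analysis"
begin

section \<open>Partial derivatives and smooth functions of \<open>n\<close> real variables\<close>

definition partial_deriv :: "'n::finite \<Rightarrow> (real^'n \<Rightarrow> real) \<Rightarrow> real^'n \<Rightarrow> real" where
  "partial_deriv i f x = deriv (\<lambda>t. f (x + t *\<^sub>R axis i 1)) 0"

text \<open>The next two notions are only used on open sets.\<close>

primrec Ck_on :: "nat \<Rightarrow> (real^'n::finite \<Rightarrow> real) \<Rightarrow> (real^'n) set \<Rightarrow> bool" where
  "Ck_on 0 f S \<longleftrightarrow> continuous_on S f"
| "Ck_on (Suc k) f S \<longleftrightarrow> f differentiable_on S \<and> (\<forall>i. Ck_on k (partial_deriv i f) S)"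

definition smooth_on :: "(real^'n::finite \<Rightarrow> real) \<Rightarrow> (real^'n) set \<Rightarrow> bool" where
  "smooth_on f S \<longleftrightarrow> (\<forall>k. Ck_on k f S)"


section \<open>Smooth manifolds, Riemannian metrics and 1-forms\<close>

text \<open>A chart is a pair of a coordinate domain \<open>U\<close> and a coordinate map, of which only the
  values on \<open>U\<close> matter.\<close>

type_synonym ('m, 'n) chart = "'m set \<times> ('m \<Rightarrow> real^'n)"

definition transition :: "('m, 'n::finite) chart \<Rightarrow> ('m, 'n) chart \<Rightarrow> real^'n \<Rightarrow> real^'n" where
  "transition c d x = snd d (inv_into (fst c) (snd c) x)"

definition smooth_manifold :: "'m topology \<Rightarrow> ('m, 'n::finite) chart set \<Rightarrow> bool" where
  "smooth_manifold M A \<longleftrightarrow>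
     Hausdorff_space M \<and> second_countable M \<and> (\<Union>c\<in>A. fst c) = topspace M \<and>
     (\<forall>(U, \<phi>)\<in>A. openin M U \<and> open (\<phi> ` U) \<and>
        homeomorphic_map (subtopology M U) (top_of_set (\<phi> ` U)) \<phi>) \<and>
     (\<forall>c\<in>A. \<forall>d\<in>A. \<forall>k. smooth_on (\<lambda>x. transition c d x $ k) (snd c ` (fst c \<inter> fst d)))"

text \<open>\<open>\<partial>x'\<^sup>k/\<partial>x\<^sup>i\<close> at \<open>p\<close>, where \<open>x\<close> and \<open>x'\<close> are the coordinates of \<open>c\<close> and \<open>d\<close>.\<close>

definition jacobian :: "('m, 'n::finite) chart \<Rightarrow> ('m, 'n) chart \<Rightarrow> 'm \<Rightarrow> 'n \<Rightarrow> 'n \<Rightarrow> real" where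
  "jacobian c d p k i = partial_deriv i (\<lambda>x. transition c d x $ k) (snd c p)"

text \<open>Tensor fields are given by their components in each chart of the atlas, which are functions
  of the coordinates and obey the tensorial transformation law on overlaps.\<close>

definition riemannian_metric ::
  "('m, 'n::finite) chart set \<Rightarrow> (('m, 'n) chart \<Rightarrow> real^'n \<Rightarrow> real^'n^'n) \<Rightarrow> bool" where
  "riemannian_metric A a \<longleftrightarrow>
     (\<forall>c\<in>A. (\<forall>i j. smooth_on (\<lambda>x. a c x $ i $ j) (snd c ` fst c)) \<and>
        (\<forall>x\<in>snd c ` fst c. transpose (a c x) = a c x \<and>
           (\<forall>v. v \<noteq> 0 \<longrightarrow> v \<bullet> (a c x *v v) > 0))) \<and>
     (\<forall>c\<in>A. \<forall>d\<in>A. \<forall>p\<in>fst c \<inter> fst d. \<forall>i j.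
        a c (snd c p) $ i $ j =
          (\<Sum>k\<in>UNIV. \<Sum>l\<in>UNIV. jacobian c d p k i * jacobian c d p l j * a d (snd d p) $ k $ l))"

definition one_form ::
  "('m, 'n::finite) chart set \<Rightarrow> (('m, 'n) chart \<Rightarrow> real^'n \<Rightarrow> real^'n) \<Rightarrow> bool" where
  "one_form A b \<longleftrightarrow>
     (\<forall>c\<in>A. \<forall>i. smooth_on (\<lambda>x. b c x $ i) (snd c ` fst c)) \<and>
     (\<forall>c\<in>A. \<forall>d\<in>A. \<forall>p\<in>fst c \<inter> fst d. \<forall>i.
        b c (snd c p) $ i = (\<Sum>k\<in>UNIV. jacobian c d p k i * b d (snd d p) $ k))"

definition nowhere_vanishing ::
  "('m, 'n::finite) chart set \<Rightarrow> (('m, 'n) chart \<Rightarrow> real^'n \<Rightarrow> real^'n) \<Rightarrow> bool" where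
  "nowhere_vanishing A b \<longleftrightarrow> (\<forall>c\<in>A. \<forall>p\<in>fst c. b c (snd c p) \<noteq> 0)"

text \<open>From here on \<open>a\<close> and \<open>b\<close> are the components of a metric and of a 1-form in one chart, \<open>x\<close> is a
  point of the coordinate range, and \<open>y\<close> are the components of a tangent vector.\<close>


section \<open>Riemannian tensor calculus in coordinates\<close>

definition inv_metric :: "(real^'n::finite \<Rightarrow> real^'n^'n) \<Rightarrow> real^'n \<Rightarrow> 'n \<Rightarrow> 'n \<Rightarrow> real" where
  "inv_metric a x i j = matrix_inv (a x) $ i $ j"

text \<open>\<open>christoffel a x i j k\<close> is \<open>\<Gamma>\<^sup>i\<^sub>j\<^sub>k\<close>.\<close>

definition christoffel :: "(real^'n::finite \<Rightarrow> real^'n^'n) \<Rightarrow> real^'n \<Rightarrow> 'n \<Rightarrow> 'n \<Rightarrow> 'n \<Rightarrow> real" where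
  "christoffel a x i j k = 1/2 * (\<Sum>l\<in>UNIV. inv_metric a x i l *
      (partial_deriv j (\<lambda>z. a z $ l $ k) x + partial_deriv k (\<lambda>z. a z $ l $ j) x
        - partial_deriv l (\<lambda>z. a z $ j $ k) x))"

text \<open>Covariant derivatives; the suffix records the position of the indices (\<open>u\<close> upper, \<open>d\<close> lower),
  and the last index is the differentiation index. Thus
  \<open>cov_d a w x i k = w\<^sub>i\<^sub>|\<^sub>k\<close>, \<open>cov_u a v x i k = v\<^sup>i\<^sub>|\<^sub>k\<close>,
  \<open>cov_dd a t x i j k = t\<^sub>i\<^sub>j\<^sub>|\<^sub>k\<close> and \<open>cov_ud a t x i j k = t\<^sup>i\<^sub>j\<^sub>|\<^sub>k\<close>.\<close>

definition cov_d :: "(real^'n::finite \<Rightarrow> real^'n^'n) \<Rightarrow> (real^'n \<Rightarrow> 'n \<Rightarrow> real) \<Rightarrow>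
    real^'n \<Rightarrow> 'n \<Rightarrow> 'n \<Rightarrow> real" where
  "cov_d a w x i k = partial_deriv k (\<lambda>z. w z i) x - (\<Sum>l\<in>UNIV. christoffel a x l i k * w x l)"

definition cov_u :: "(real^'n::finite \<Rightarrow> real^'n^'n) \<Rightarrow> (real^'n \<Rightarrow> 'n \<Rightarrow> real) \<Rightarrow>
    real^'n \<Rightarrow> 'n \<Rightarrow> 'n \<Rightarrow> real" where
  "cov_u a v x i k = partial_deriv k (\<lambda>z. v z i) x + (\<Sum>l\<in>UNIV. christoffel a x i l k * v x l)"

definition cov_dd :: "(real^'n::finite \<Rightarrow> real^'n^'n) \<Rightarrow> (real^'n \<Rightarrow> 'n \<Rightarrow> 'n \<Rightarrow> real) \<Rightarrow>
    real^'n \<Rightarrow> 'n \<Rightarrow> 'n \<Rightarrow> 'n \<Rightarrow> real" where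
  "cov_dd a t x i j k = partial_deriv k (\<lambda>z. t z i j) x
     - (\<Sum>l\<in>UNIV. christoffel a x l i k * t x l j) - (\<Sum>l\<in>UNIV. christoffel a x l j k * t x i l)"

definition cov_ud :: "(real^'n::finite \<Rightarrow> real^'n^'n) \<Rightarrow> (real^'n \<Rightarrow> 'n \<Rightarrow> 'n \<Rightarrow> real) \<Rightarrow>
    real^'n \<Rightarrow> 'n \<Rightarrow> 'n \<Rightarrow> 'n \<Rightarrow> real" where
  "cov_ud a t x i j k = partial_deriv k (\<lambda>z. t z i j) x
     + (\<Sum>l\<in>UNIV. christoffel a x i l k * t x l j) - (\<Sum>l\<in>UNIV. christoffel a x l j k * t x i l)"

definition raise_d :: "(real^'n::finite \<Rightarrow> real^'n^'n) \<Rightarrow> (real^'n \<Rightarrow> 'n \<Rightarrow> real) \<Rightarrow>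
    real^'n \<Rightarrow> 'n \<Rightarrow> real" where
  "raise_d a w x i = (\<Sum>j\<in>UNIV. inv_metric a x i j * w x j)"

definition raise_dd :: "(real^'n::finite \<Rightarrow> real^'n^'n) \<Rightarrow> (real^'n \<Rightarrow> 'n \<Rightarrow> 'n \<Rightarrow> real) \<Rightarrow>
    real^'n \<Rightarrow> 'n \<Rightarrow> 'n \<Rightarrow> real" where
  "raise_dd a t x i j = (\<Sum>k\<in>UNIV. inv_metric a x i k * t x k j)"

text \<open>\<open>riemann_curv a x j i k l\<close> is \<open>R\<^sub>j\<^sup>i\<^sub>k\<^sub>l\<close>, with the same index and sign conventions as for Finsler
  metrics below: round spheres have positive Ricci curvature.\<close>

definition riemann_curv ::
  "(real^'n::finite \<Rightarrow> real^'n^'n) \<Rightarrow> real^'n \<Rightarrow> 'n \<Rightarrow> 'n \<Rightarrow> 'n \<Rightarrow> 'n \<Rightarrow> real" where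
  "riemann_curv a x j i k l =
     partial_deriv k (\<lambda>z. christoffel a z i j l) x - partial_deriv l (\<lambda>z. christoffel a z i j k) x
     + (\<Sum>m\<in>UNIV. christoffel a x i k m * christoffel a x m j l)
     - (\<Sum>m\<in>UNIV. christoffel a x i l m * christoffel a x m j k)"

definition riemann_ricci :: "(real^'n::finite \<Rightarrow> real^'n^'n) \<Rightarrow> real^'n \<Rightarrow> 'n \<Rightarrow> 'n \<Rightarrow> real" where
  "riemann_ricci a x i j = (\<Sum>m\<in>UNIV. riemann_curv a x i m m j)"

definition riemann_scalar :: "(real^'n::finite \<Rightarrow> real^'n^'n) \<Rightarrow> real^'n \<Rightarrow> real" where
  "riemann_scalar a x = (\<Sum>i\<in>UNIV. \<Sum>j\<in>UNIV. inv_metric a x i j * riemann_ricci a x i j)"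


section \<open>The tensors built from \<open>\<beta>\<close>\<close>

text \<open>In the names, \<open>r_dd\<close>, \<open>r_d\<close>, \<open>r_u\<close>, \<open>r_ud\<close> stand for \<open>r\<^sub>i\<^sub>j\<close>, \<open>r\<^sub>i\<close>, \<open>r\<^sup>i\<close>, \<open>r\<^sup>i\<^sub>j\<close>, and similarly
  for \<open>s\<close>.\<close>

definition b_d :: "(real^'n::finite \<Rightarrow> real^'n) \<Rightarrow> real^'n \<Rightarrow> 'n \<Rightarrow> real" where
  "b_d b x i = b x $ i"

definition b_u :: "(real^'n::finite \<Rightarrow> real^'n^'n) \<Rightarrow> (real^'n \<Rightarrow> real^'n) \<Rightarrow> real^'n \<Rightarrow> 'n \<Rightarrow> real" where
  "b_u a b = raise_d a (b_d b)"

definition r_dd :: "(real^'n::finite \<Rightarrow> real^'n^'n) \<Rightarrow> (real^'n \<Rightarrow> real^'n) \<Rightarrow>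
    real^'n \<Rightarrow> 'n \<Rightarrow> 'n \<Rightarrow> real" where
  "r_dd a b x i j = 1/2 * (cov_d a (b_d b) x i j + cov_d a (b_d b) x j i)"

definition s_dd :: "(real^'n::finite \<Rightarrow> real^'n^'n) \<Rightarrow> (real^'n \<Rightarrow> real^'n) \<Rightarrow>
    real^'n \<Rightarrow> 'n \<Rightarrow> 'n \<Rightarrow> real" where
  "s_dd a b x i j = 1/2 * (cov_d a (b_d b) x i j - cov_d a (b_d b) x j i)"

definition r_d :: "(real^'n::finite \<Rightarrow> real^'n^'n) \<Rightarrow> (real^'n \<Rightarrow> real^'n) \<Rightarrow> real^'n \<Rightarrow> 'n \<Rightarrow> real" where
  "r_d a b x i = (\<Sum>j\<in>UNIV. b_u a b x j * r_dd a b x i j)"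

definition s_d :: "(real^'n::finite \<Rightarrow> real^'n^'n) \<Rightarrow> (real^'n \<Rightarrow> real^'n) \<Rightarrow> real^'n \<Rightarrow> 'n \<Rightarrow> real" where
  "s_d a b x i = (\<Sum>j\<in>UNIV. b_u a b x j * s_dd a b x j i)"

definition r_u :: "(real^'n::finite \<Rightarrow> real^'n^'n) \<Rightarrow> (real^'n \<Rightarrow> real^'n) \<Rightarrow> real^'n \<Rightarrow> 'n \<Rightarrow> real" where
  "r_u a b = raise_d a (r_d a b)"

definition s_u :: "(real^'n::finite \<Rightarrow> real^'n^'n) \<Rightarrow> (real^'n \<Rightarrow> real^'n) \<Rightarrow> real^'n \<Rightarrow> 'n \<Rightarrow> real" where
  "s_u a b = raise_d a (s_d a b)"

definition r_ud :: "(real^'n::finite \<Rightarrow> real^'n^'n) \<Rightarrow> (real^'n \<Rightarrow> real^'n) \<Rightarrow>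
    real^'n \<Rightarrow> 'n \<Rightarrow> 'n \<Rightarrow> real" where
  "r_ud a b = raise_dd a (r_dd a b)"

definition s_ud :: "(real^'n::finite \<Rightarrow> real^'n^'n) \<Rightarrow> (real^'n \<Rightarrow> real^'n) \<Rightarrow>
    real^'n \<Rightarrow> 'n \<Rightarrow> 'n \<Rightarrow> real" where
  "s_ud a b = raise_dd a (s_dd a b)"


section \<open>Finsler curvatures in coordinates\<close>

definition dx :: "'n::finite \<Rightarrow> (real^'n \<Rightarrow> real^'n \<Rightarrow> real) \<Rightarrow> real^'n \<Rightarrow> real^'n \<Rightarrow> real" where
  "dx i f x y = partial_deriv i (\<lambda>z. f z y) x"

definition dy :: "'n::finite \<Rightarrow> (real^'n \<Rightarrow> real^'n \<Rightarrow> real) \<Rightarrow> real^'n \<Rightarrow> real^'n \<Rightarrow> real" where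
  "dy i f x y = partial_deriv i (f x) y"

definition sq :: "(real^'n::finite \<Rightarrow> real^'n \<Rightarrow> real) \<Rightarrow> real^'n \<Rightarrow> real^'n \<Rightarrow> real" where
  "sq F x y = (F x y)^2"

definition fundamental_tensor ::
  "(real^'n::finite \<Rightarrow> real^'n \<Rightarrow> real) \<Rightarrow> real^'n \<Rightarrow> real^'n \<Rightarrow> real^'n^'n" where
  "fundamental_tensor F x y = (\<chi> i j. 1/2 * dy j (dy i (sq F)) x y)"

definition inv_fundamental ::
  "(real^'n::finite \<Rightarrow> real^'n \<Rightarrow> real) \<Rightarrow> 'n \<Rightarrow> 'n \<Rightarrow> real^'n \<Rightarrow> real^'n \<Rightarrow> real" where
  "inv_fundamental F i j x y = matrix_inv (fundamental_tensor F x y) $ i $ j"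

definition spray_coeff ::
  "(real^'n::finite \<Rightarrow> real^'n \<Rightarrow> real) \<Rightarrow> 'n \<Rightarrow> real^'n \<Rightarrow> real^'n \<Rightarrow> real" where
  "spray_coeff F i x y = 1/4 * (\<Sum>k\<in>UNIV. inv_fundamental F i k x y *
      ((\<Sum>j\<in>UNIV. dy k (dx j (sq F)) x y * y $ j) - dx k (sq F) x y))"

text \<open>\<open>finsler_riemann F i k\<close> is \<open>R\<^sup>i\<^sub>k\<close>, and \<open>finsler_riemann_tensor F j i k l\<close> is \<open>R\<^sub>j\<^sup>i\<^sub>k\<^sub>l\<close>.\<close>

definition finsler_riemann ::
  "(real^'n::finite \<Rightarrow> real^'n \<Rightarrow> real) \<Rightarrow> 'n \<Rightarrow> 'n \<Rightarrow> real^'n \<Rightarrow> real^'n \<Rightarrow> real" where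
  "finsler_riemann F i k x y =
     2 * dx k (spray_coeff F i) x y
     - (\<Sum>j\<in>UNIV. y $ j * dx j (dy k (spray_coeff F i)) x y)
     + 2 * (\<Sum>j\<in>UNIV. spray_coeff F j x y * dy j (dy k (spray_coeff F i)) x y)
     - (\<Sum>j\<in>UNIV. dy j (spray_coeff F i) x y * dy k (spray_coeff F j) x y)"

definition finsler_riemann_tensor ::
  "(real^'n::finite \<Rightarrow> real^'n \<Rightarrow> real) \<Rightarrow> 'n \<Rightarrow> 'n \<Rightarrow> 'n \<Rightarrow> 'n \<Rightarrow> real^'n \<Rightarrow> real^'n \<Rightarrow> real" where
  "finsler_riemann_tensor F j i k l x y =
     1/3 * (dy l (dy j (finsler_riemann F i k)) x y - dy k (dy j (finsler_riemann F i l)) x y)"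

definition finsler_ricci_bar ::
  "(real^'n::finite \<Rightarrow> real^'n \<Rightarrow> real) \<Rightarrow> 'n \<Rightarrow> 'n \<Rightarrow> real^'n \<Rightarrow> real^'n \<Rightarrow> real" where
  "finsler_ricci_bar F i j x y = (\<Sum>m\<in>UNIV. finsler_riemann_tensor F i m m j x y)"

definition finsler_ricci ::
  "(real^'n::finite \<Rightarrow> real^'n \<Rightarrow> real) \<Rightarrow> 'n \<Rightarrow> 'n \<Rightarrow> real^'n \<Rightarrow> real^'n \<Rightarrow> real" where
  "finsler_ricci F i j x y = 1/2 * (finsler_ricci_bar F i j x y + finsler_ricci_bar F j i x y)"

definition finsler_scalar ::
  "(real^'n::finite \<Rightarrow> real^'n \<Rightarrow> real) \<Rightarrow> real^'n \<Rightarrow> real^'n \<Rightarrow> real" where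
  "finsler_scalar F x y = (\<Sum>i\<in>UNIV. \<Sum>j\<in>UNIV. inv_fundamental F i j x y * finsler_ricci F i j x y)"


section \<open>Kropina metrics\<close>

definition alpha_norm :: "(real^'n::finite \<Rightarrow> real^'n^'n) \<Rightarrow> real^'n \<Rightarrow> real^'n \<Rightarrow> real" where
  "alpha_norm a x y = sqrt (\<Sum>i\<in>UNIV. \<Sum>j\<in>UNIV. a x $ i $ j * y $ i * y $ j)"

definition beta_form :: "(real^'n::finite \<Rightarrow> real^'n) \<Rightarrow> real^'n \<Rightarrow> real^'n \<Rightarrow> real" where
  "beta_form b x y = (\<Sum>i\<in>UNIV. b x $ i * y $ i)"

text \<open>Meaningful on the open cone where \<open>\<beta> > 0\<close> only.\<close>

definition kropina :: "(real^'n::finite \<Rightarrow> real^'n^'n) \<Rightarrow> (real^'n \<Rightarrow> real^'n) \<Rightarrow>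
    real^'n \<Rightarrow> real^'n \<Rightarrow> real" where
  "kropina a b x y = (alpha_norm a x y)^2 / beta_form b x y"

end

theory Submission
  imports Defs "HOL-Real_Asymp.Real_Asymp"
begin

text \<open>
  For every Finsler metric the scalar curvature is \<open>R = (\<Delta> Ric + D (\<Delta> \<Pi>)) / 2\<close>, where \<open>\<Delta>\<close> is the second-order
  operator with symbol \<open>g\<^sup>i\<^sup>j\<close> in the fibre variables, \<open>\<Pi>\<close> the fibre divergence of the spray coefficients and \<open>D\<close>
  the derivative along the spray; this holds because the metric is parallel along its spray. For a
  Kropina metric the spray coefficients differ from those of \<open>\<alpha>\<close> by
  \<open>T\<^sup>i = F (U b\<^sup>i - s\<^sup>i\<^sub>0) / 2 - U y\<^sup>i\<close> with \<open>U = (s\<^sub>0 + r\<^sub>0\<^sub>0 / F) / b\<^sup>2\<close>. Hence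
  \<open>Ric\<close> is a sum of terms \<open>F\<^sup>k p\<^sub>k\<close> with \<open>-2 \<le> k \<le> 2\<close> and \<open>p\<^sub>k\<close> a polynomial of degree \<open>2 - k\<close> in \<open>y\<close>, and
  \<open>\<Delta> (F\<^sup>k p\<^sub>k)\<close> follows from Euler's theorem and \<open>\<Delta> p\<^sub>k\<close>. As \<open>D F = 0\<close>, the term \<open>D (\<Delta> \<Pi>)\<close> is elementary too, and
  a polynomial identity between contractions remains.
\<close>

text \<open>Expanded literally, the curvature tensor takes four derivatives of spray coefficients
  that already contain an inverse matrix. The trace is therefore reduced to scalars on phase space
  before any Kropina formula enters: the fibre divergence of R^i_k and the fibre gradient of Ric
  differ, up to constant factors, only by derivatives of \<Pi>. The spray is verified, not derived.
  The candidate satisfies DF = 0 and the Euler-Lagrange equation D(F^2)_{y^k} = (F^2)_{x^k}, and the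
  inverse fundamental tensor then identifies it with the defined coefficients. Within the given
  shape of T, the equation DF = 0 determines U. Coordinate derivatives would flood every formula
  with Christoffel symbols. Derivatives are therefore split along the horizontal distribution of
  \<alpha>: there a tensor contracted with y differentiates to its covariant derivative, and
  Christoffel symbols stay only in the Ricci tensor of \<alpha> or in terms that cancel. Since x-
  and y-derivatives are interchanged all the time, smoothness is joint in (x, y), and the symmetry
  of second derivatives is proved for directional derivatives on the product space.\<close>

text \<open>A sum without a range is a finite sum over an index type, not an infinite series.\<close>

no_notation suminf (binder "\<Sum>" 10)

abbreviation (input) sum_UNIV :: "('a \<Rightarrow> 'b::comm_monoid_add) \<Rightarrow> 'b" (binder "\<Sum>" 10) where
  "sum_UNIV f \<equiv> sum f UNIV"

lemmas sum_distribs = sum_distrib_left sum_distrib_right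

section \<open>Iterated directional derivatives\<close>

definition ddir :: "'v::euclidean_space \<Rightarrow> ('v \<Rightarrow> real) \<Rightarrow> 'v \<Rightarrow> real" where
  "ddir e f p = deriv (\<lambda>t. f (p + t *\<^sub>R e)) 0"

text \<open>The counterpart of \<open>Ck_on\<close> on an arbitrary Euclidean space, here used for
  pairs (x, y). Total differentiability is demanded at every level, so derivatives are linear in the
  direction and basis directions are enough.\<close>

primrec Cd :: "nat \<Rightarrow> 'v::euclidean_space set \<Rightarrow> ('v \<Rightarrow> real) \<Rightarrow> bool" where
  "Cd 0 S f \<longleftrightarrow> continuous_on S f"
| "Cd (Suc k) S f \<longleftrightarrow> f differentiable_on S \<and> (\<forall>e\<in>Basis. Cd k S (ddir e f))"

lemma has_derivative_along:
  assumes "(f has_derivative f') (at p)"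
  shows "((\<lambda>t. f (p + t *\<^sub>R e)) has_real_derivative f' e) (at 0)"
proof -
  have "((\<lambda>t::real. p + t *\<^sub>R e) has_derivative (\<lambda>t. t *\<^sub>R e)) (at 0)"
    by (auto intro!: derivative_eq_intros)
  moreover have "(f has_derivative f') (at (p + 0 *\<^sub>R e))" using assms by simp
  ultimately have "((\<lambda>t::real. f (p + t *\<^sub>R e)) has_derivative (\<lambda>t. f' (t *\<^sub>R e))) (at 0)"
    by (rule has_derivative_compose)
  moreover have "(\<lambda>t. f' (t *\<^sub>R e)) = (*) (f' e)"
    using linear_scale[OF has_derivative_linear[OF assms]] by (auto simp: mult.commute)
  ultimately show ?thesis by (simp add: has_field_derivative_def)
qed

lemma ddir_eq: "(f has_derivative f') (at p) \<Longrightarrow> ddir e f p = f' e"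
  unfolding ddir_def by (rule DERIV_imp_deriv[OF has_derivative_along])

lemma ddir_cong:
  assumes "open S" "p \<in> S" "\<And>q. q \<in> S \<Longrightarrow> f q = g q"
  shows "ddir e f p = ddir e g p"
proof -
  have "open ((\<lambda>t::real. p + t *\<^sub>R e) -` S)"
    by (intro open_vimage assms(1) continuous_intros)
  then have "eventually (\<lambda>t. t \<in> (\<lambda>t::real. p + t *\<^sub>R e) -` S) (nhds 0)"
    using assms(2) by (intro eventually_nhds_in_open) auto
  then show ?thesis unfolding ddir_def
    by (intro deriv_cong_ev) (auto elim!: eventually_mono simp: assms(3))
qed

lemma open_differentiable_onD:
  "f differentiable_on S \<Longrightarrow> open S \<Longrightarrow> p \<in> S \<Longrightarrow> f differentiable (at p)"
  by (simp add: differentiable_on_eq_differentiable_at)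

text \<open>The product and quotient rules hold only at points of S. Openness of S allows the
  derivative to be replaced by their right-hand sides at every level of the induction.\<close>

lemma Cd_cong:
  assumes "open S" "\<And>q. q \<in> S \<Longrightarrow> f q = g q" "Cd k S f"
  shows "Cd k S g"
  using assms(2,3)
proof (induction k arbitrary: f g)
  case 0
  then show ?case using continuous_on_cong[of S S f g] by simp
next
  case (Suc k)
  have "g differentiable_on S"
    unfolding differentiable_on_def
  proof
    fix p assume "p \<in> S"
    then show "g differentiable (at p within S)"
      using Suc.prems by (auto simp: differentiable_on_def intro: differentiable_transform_within[OF _ zero_less_one])
  qed
  moreover have "Cd k S (ddir e g)" if "e \<in> Basis" for e
  proof (rule Suc.IH)
    show "ddir e f q = ddir e g q" if "q \<in> S" for q
      by (rule ddir_cong[OF assms(1) that Suc.prems(1)])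
    show "Cd k S (ddir e f)" using Suc.prems(2) that by simp
  qed
  ultimately show ?case by simp
qed

lemma Cd_Suc_D: "Cd (Suc k) S f \<Longrightarrow> Cd k S f"
proof (induction k arbitrary: f)
  case 0
  then show ?case by (simp add: differentiable_imp_continuous_on)
next
  case (Suc k)
  from Suc.prems show ?case by (subst Cd.simps(2), subst (asm) Cd.simps(2)) (blast intro: Suc.IH)
qed

section \<open>Closure of k-fold differentiability under algebraic operations\<close>

lemma ddir_const: "ddir e (\<lambda>_. c) = (\<lambda>_. 0)"
  by (rule ext) (simp add: ddir_def)

lemma Cd_const: "Cd k S (\<lambda>_. c)"
  by (induction k arbitrary: c) (auto simp: ddir_const)

lemma Cd_linear:
  assumes "bounded_linear f" shows "Cd k S f"
proof (cases k)
  case (Suc k)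
  have "ddir e f = (\<lambda>_. f e)" for e
    using ddir_eq[OF bounded_linear_imp_has_derivative[OF assms]] by auto
  then show ?thesis using Suc assms
    by (auto simp: Cd_const bounded_linear_imp_differentiable_on)
qed (simp add: assms linear_continuous_on)

lemma ddir_add:
  "f differentiable (at p) \<Longrightarrow> g differentiable (at p) \<Longrightarrow>
    ddir e (\<lambda>p. f p + g p) p = ddir e f p + ddir e g p"
  by (auto simp: differentiable_def ddir_eq[OF has_derivative_add] ddir_eq)

lemma ddir_mult:
  "f differentiable (at p) \<Longrightarrow> g differentiable (at p) \<Longrightarrow>
    ddir e (\<lambda>p. f p * g p) p = f p * ddir e g p + ddir e f p * g p"
  by (auto simp: differentiable_def ddir_eq[OF has_derivative_mult] ddir_eq)

lemma ddir_inverse: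
  "f differentiable (at p) \<Longrightarrow> f p \<noteq> 0 \<Longrightarrow>
    ddir e (\<lambda>p. inverse (f p)) p = - (ddir e f p * (inverse (f p) * inverse (f p)))"
  by (auto simp: differentiable_def ddir_eq[OF Deriv.has_derivative_inverse] ddir_eq)

lemma Cd_add:
  assumes "open S" shows "Cd k S f \<Longrightarrow> Cd k S g \<Longrightarrow> Cd k S (\<lambda>p. f p + g p)"
proof (induction k arbitrary: f g)
  case (Suc k)
  have "Cd k S (ddir e (\<lambda>p. f p + g p))" if "e \<in> Basis" for e
  proof (rule Cd_cong[OF assms])
    show "Cd k S (\<lambda>p. ddir e f p + ddir e g p)"
      using Suc.prems that by (intro Suc.IH) auto
  qed (use Suc.prems in \<open>simp add: ddir_add open_differentiable_onD[OF _ assms]\<close>)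
  with Suc.prems show ?case by simp
qed (auto intro: continuous_intros)

lemma Cd_mult:
  assumes "open S" shows "Cd k S f \<Longrightarrow> Cd k S g \<Longrightarrow> Cd k S (\<lambda>p. f p * g p)"
proof (induction k arbitrary: f g)
  case (Suc k)
  have "Cd k S (ddir e (\<lambda>p. f p * g p))" if "e \<in> Basis" for e
  proof (rule Cd_cong[OF assms])
    show "Cd k S (\<lambda>p. f p * ddir e g p + ddir e f p * g p)"
      using Suc.prems Cd_Suc_D[OF Suc.prems(1)] Cd_Suc_D[OF Suc.prems(2)] that
      by (intro Cd_add[OF assms] Suc.IH) auto
  qed (use Suc.prems in \<open>simp add: ddir_mult open_differentiable_onD[OF _ assms]\<close>)
  with Suc.prems show ?case by simp
qed (auto intro: continuous_intros)

lemma Cd_inverse: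
  assumes "open S" "\<And>p. p \<in> S \<Longrightarrow> f p \<noteq> 0"
  shows "Cd k S f \<Longrightarrow> Cd k S (\<lambda>p. inverse (f p))"
proof (induction k)
  case (Suc k)
  have i: "Cd k S (\<lambda>p. inverse (f p))" using Suc Cd_Suc_D by blast
  have "Cd k S (ddir e (\<lambda>p. inverse (f p)))" if "e \<in> Basis" for e
  proof (rule Cd_cong[OF assms(1), of "\<lambda>p. (-1) * (ddir e f p * (inverse (f p) * inverse (f p)))"])
    show "Cd k S (\<lambda>p. (-1) * (ddir e f p * (inverse (f p) * inverse (f p))))"
      using Suc.prems that by (intro Cd_mult[OF assms(1)] Cd_const i) auto
  next
    fix q assume "q \<in> S"
    then show "- 1 * (ddir e f q * (inverse (f q) * inverse (f q))) = ddir e (\<lambda>p. inverse (f p)) q"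
      using ddir_inverse[of f q e] open_differentiable_onD[of f S q] Suc.prems assms by simp
  qed
  with Suc.prems assms(2) show ?case by (auto intro: differentiable_on_inverse)
qed (use assms in \<open>auto intro!: continuous_intros\<close>)

text \<open>The mean value theorem is applied twice, first to the difference of \<phi> between t = h
  and t = 0 as a function of s, then to \<open>\<phi>s\<close> in t. The two intermediate values
  form a pair so that a sequence of them can be chosen in one go.\<close>

lemma mixed_derivatives_aux:
  fixes \<phi> \<phi>s \<phi>st :: "real \<Rightarrow> real \<Rightarrow> real"
  assumes d: "d > 0"
    and s: "\<And>s t. \<bar>s\<bar> < d \<Longrightarrow> \<bar>t\<bar> < d \<Longrightarrow> ((\<lambda>s. \<phi> s t) has_real_derivative \<phi>s s t) (at s)"
    and st: "\<And>s t. \<bar>s\<bar> < d \<Longrightarrow> \<bar>t\<bar> < d \<Longrightarrow> ((\<lambda>t. \<phi>s s t) has_real_derivative \<phi>st s t) (at t)"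
    and h: "0 < h" "h < d"
  shows "\<exists>z. 0 < fst z \<and> fst z < h \<and> 0 < snd z \<and> snd z < h \<and>
    \<phi> h h - \<phi> h 0 - \<phi> 0 h + \<phi> 0 0 = h^2 * \<phi>st (fst z) (snd z)"
proof -
  have "\<exists>\<xi>. 0 < \<xi> \<and> \<xi> < h \<and> (\<phi> h h - \<phi> h 0) - (\<phi> 0 h - \<phi> 0 0) = (h - 0) * (\<phi>s \<xi> h - \<phi>s \<xi> 0)"
    using h by (intro MVT2) (auto intro!: derivative_intros s)
  then obtain \<xi> where \<xi>: "0 < \<xi>" "\<xi> < h"
    "(\<phi> h h - \<phi> h 0) - (\<phi> 0 h - \<phi> 0 0) = h * (\<phi>s \<xi> h - \<phi>s \<xi> 0)" by auto
  have "\<exists>\<eta>. 0 < \<eta> \<and> \<eta> < h \<and> \<phi>s \<xi> h - \<phi>s \<xi> 0 = (h - 0) * \<phi>st \<xi> \<eta>"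
    using h \<xi> by (intro MVT2) (auto intro!: st)
  then obtain \<eta> where "0 < \<eta>" "\<eta> < h" "\<phi>s \<xi> h - \<phi>s \<xi> 0 = h * \<phi>st \<xi> \<eta>" by auto
  with \<xi> show ?thesis by (intro exI[of _ "(\<xi>, \<eta>)"]) (auto simp: power2_eq_square)
qed

text \<open>The second difference over a square is symmetric in the two directions. Hence h^2 times
  either mixed derivative, each at some interior point, is the same number; dividing by h^2 and
  letting h tend to 0, continuity gives equality at p.\<close>

lemma ddir_commute:
  fixes f :: "'v::euclidean_space \<Rightarrow> real"
  assumes S: "open S" "p \<in> S" and f: "Cd 2 S f" and B: "e \<in> Basis" "g \<in> Basis"
  shows "ddir e (ddir g f) p = ddir g (ddir e f) p"
proof -
  define \<phi> where "\<phi> F s t = F (p + s *\<^sub>R e + t *\<^sub>R g)" for F :: "'v \<Rightarrow> real" and s t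
  have f2: "f differentiable_on S" "ddir e f differentiable_on S" "ddir g f differentiable_on S"
    "continuous_on S (ddir e (ddir g f))" "continuous_on S (ddir g (ddir e f))"
    using f B by (auto simp: numeral_2_eq_2)
  obtain r where r: "r > 0" "ball p r \<subseteq> S" using S openE by blast
  \<comment> \<open>Half the radius: two displacements along unit vectors, each shorter than d, stay
    in the ball.\<close>
  define d where "d = r / 2"
  have d: "d > 0" using r by (simp add: d_def)
  have inS: "p + s *\<^sub>R e + t *\<^sub>R g \<in> S" if "\<bar>s\<bar> < d" "\<bar>t\<bar> < d" for s t
  proof -
    have "norm (s *\<^sub>R e + t *\<^sub>R g) \<le> \<bar>s\<bar> + \<bar>t\<bar>"
      using norm_triangle_ineq[of "s *\<^sub>R e" "t *\<^sub>R g"] B by simp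
    also have "\<dots> < r" using that by (simp add: d_def)
    finally have "p + s *\<^sub>R e + t *\<^sub>R g \<in> ball p r"
      by (subst mem_ball, subst dist_commute) (simp add: dist_norm add.assoc)
    with r show ?thesis by auto
  qed
  have Ds: "((\<lambda>s. \<phi> F s t) has_real_derivative \<phi> (ddir e F) s t) (at s)"
    and Dt: "((\<lambda>t. \<phi> F s t) has_real_derivative \<phi> (ddir g F) s t) (at t)"
    if F: "F differentiable_on S" and st: "\<bar>s\<bar> < d" "\<bar>t\<bar> < d" for F s t
  proof -
    obtain F' where F': "(F has_derivative F') (at (p + s *\<^sub>R e + t *\<^sub>R g))"
      using open_differentiable_onD[OF F S(1) inS[OF st]] unfolding differentiable_def by blast
    have "((\<lambda>q. F (p + s *\<^sub>R e + t *\<^sub>R g + q *\<^sub>R e)) has_real_derivative F' e) (at 0)"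
      "((\<lambda>q. F (p + s *\<^sub>R e + t *\<^sub>R g + q *\<^sub>R g)) has_real_derivative F' g) (at 0)"
      by (rule has_derivative_along[OF F'])+
    then have "((\<lambda>q. \<phi> F (q + s) t) has_real_derivative F' e) (at 0)"
      "((\<lambda>q. \<phi> F s (q + t)) has_real_derivative F' g) (at 0)"
      by (simp_all add: \<phi>_def algebra_simps)
    then show "((\<lambda>s. \<phi> F s t) has_real_derivative \<phi> (ddir e F) s t) (at s)"
      "((\<lambda>t. \<phi> F s t) has_real_derivative \<phi> (ddir g F) s t) (at t)"
      using DERIV_shift[of "\<lambda>s. \<phi> F s t" "F' e" 0 s] DERIV_shift[of "\<lambda>t. \<phi> F s t" "F' g" 0 t]
      by (simp_all add: \<phi>_def ddir_eq[OF F'])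
  qed
  have lim: "(\<lambda>k. \<phi> G (\<xi> k) (\<eta> k)) \<longlonglongrightarrow> G p"
    if G: "continuous_on S G" and z: "\<And>k. 0 < \<xi> k \<and> \<xi> k < d / (real k + 2)"
      "\<And>k. 0 < \<eta> k \<and> \<eta> k < d / (real k + 2)" for G \<xi> \<eta>
  proof -
    have l: "(\<lambda>k. d / (real k + 2)) \<longlonglongrightarrow> 0"
      by real_asymp
    have "\<xi> \<longlonglongrightarrow> 0" "\<eta> \<longlonglongrightarrow> 0"
      by (rule tendsto_sandwich[OF _ _ tendsto_const l]; use z in \<open>auto intro!: always_eventually less_imp_le\<close>)+
    then have "(\<lambda>k. p + \<xi> k *\<^sub>R e + \<eta> k *\<^sub>R g) \<longlonglongrightarrow> p + 0 *\<^sub>R e + 0 *\<^sub>R g"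
      by (intro tendsto_intros)
    moreover have "isCont G p" using G S continuous_on_eq_continuous_at by blast
    ultimately show ?thesis unfolding \<phi>_def
      using isCont_tendsto_compose by fastforce
  qed
  \<comment> \<open>The offset 2 keeps h strictly below d already for k = 0.\<close>
  define h where "h k = d / (real k + 2)" for k :: nat
  have h: "0 < h k" "h k < d" for k using d by (auto simp: h_def field_simps intro!: add_pos_nonneg)
  let ?Q = "\<lambda>E k z. 0 < fst z \<and> fst z < h k \<and> 0 < snd z \<and> snd z < h k \<and>
    \<phi> f (h k) (h k) - \<phi> f (h k) 0 - \<phi> f 0 (h k) + \<phi> f 0 0 = (h k)^2 * E z"
  have "\<exists>z. ?Q (\<lambda>z. \<phi> (ddir g (ddir e f)) (fst z) (snd z)) k z" for k
    by (rule mixed_derivatives_aux[OF d Ds[OF f2(1)] Dt[OF f2(2)] h])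
  then have "\<exists>z. \<forall>k. ?Q (\<lambda>z. \<phi> (ddir g (ddir e f)) (fst z) (snd z)) k (z k)"
    by (intro choice allI)
  then obtain z where z: "\<And>k. ?Q (\<lambda>z. \<phi> (ddir g (ddir e f)) (fst z) (snd z)) k (z k)" by blast
  have "\<exists>z. ?Q (\<lambda>z. \<phi> (ddir e (ddir g f)) (snd z) (fst z)) k z" for k
  proof -
    have "\<exists>z. 0 < fst z \<and> fst z < h k \<and> 0 < snd z \<and> snd z < h k \<and>
        \<phi> f (h k) (h k) - \<phi> f 0 (h k) - \<phi> f (h k) 0 + \<phi> f 0 0
          = (h k)^2 * \<phi> (ddir e (ddir g f)) (snd z) (fst z)"
      by (rule mixed_derivatives_aux[where \<phi> = "\<lambda>s t. \<phi> f t s" and \<phi>s = "\<lambda>s t. \<phi> (ddir g f) t s"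
            and \<phi>st = "\<lambda>s t. \<phi> (ddir e (ddir g f)) t s", OF d Dt[OF f2(1)] Ds[OF f2(3)] h])
    then show ?thesis by (simp add: algebra_simps)
  qed
  then have "\<exists>z. \<forall>k. ?Q (\<lambda>z. \<phi> (ddir e (ddir g f)) (snd z) (fst z)) k (z k)"
    by (intro choice allI)
  then obtain z' where z': "\<And>k. ?Q (\<lambda>z. \<phi> (ddir e (ddir g f)) (snd z) (fst z)) k (z' k)" by blast
  have "\<phi> (ddir g (ddir e f)) (fst (z k)) (snd (z k)) = \<phi> (ddir e (ddir g f)) (snd (z' k)) (fst (z' k))" for k
  proof -
    have "(h k)^2 * \<phi> (ddir g (ddir e f)) (fst (z k)) (snd (z k))
        = (h k)^2 * \<phi> (ddir e (ddir g f)) (snd (z' k)) (fst (z' k))"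
      using z[of k] z'[of k] by linarith
    then show ?thesis using h(1)[of k] by simp
  qed
  moreover have "(\<lambda>k. \<phi> (ddir e (ddir g f)) (snd (z' k)) (fst (z' k))) \<longlonglongrightarrow> ddir e (ddir g f) p"
    by (rule lim[OF f2(4)]) (use z' in \<open>simp_all add: h_def\<close>)
  moreover have "(\<lambda>k. \<phi> (ddir g (ddir e f)) (fst (z k)) (snd (z k))) \<longlonglongrightarrow> ddir g (ddir e f) p"
    by (rule lim[OF f2(5)]) (use z in \<open>simp_all add: h_def\<close>)
  ultimately show ?thesis using LIMSEQ_unique by simp
qed

section \<open>Smooth functions on phase space\<close>

text \<open>\<open>dx\<close>, \<open>dy\<close>, the spray and the horizontal derivative
  \<open>hv\<close> are all derivatives along such a pair of component vectors, so the calculus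
  rules are proved once and then specialised.\<close>

definition dv :: "('n \<Rightarrow> real) \<Rightarrow> ('n \<Rightarrow> real) \<Rightarrow> (real^'n::finite \<Rightarrow> real^'n \<Rightarrow> real) \<Rightarrow>
    real^'n \<Rightarrow> real^'n \<Rightarrow> real" where
  "dv u v f x y = ddir (\<chi> i. u i, \<chi> i. v i) (\<lambda>p. f (fst p) (snd p)) (x, y)"

definition kron :: "'n \<Rightarrow> 'n \<Rightarrow> real" where
  "kron i j = (if i = j then 1 else 0)"

lemma kron_commute: "kron i j = kron j i"
  by (simp add: kron_def)

lemma sum_kron [simp]:
  fixes f :: "'n::finite \<Rightarrow> real"
  shows "(\<Sum>i. kron i j * f i) = f j" "(\<Sum>i. kron j i * f i) = f j"
    "(\<Sum>i. f i * kron i j) = f j" "(\<Sum>i. f i * kron j i) = f j"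
  by (simp_all add: kron_def if_distrib if_distribR cong: if_cong)

lemma axis_kron: "axis i 1 = (\<chi> j. kron i j)"
  by (simp add: axis_def kron_def vec_eq_iff)

lemma dx_dv:
  fixes f :: "real^'n::finite \<Rightarrow> real^'n \<Rightarrow> real"
  shows "dx i f = dv (kron i) (\<lambda>_. 0) f"
proof (intro ext)
  fix x y :: "real^'n"
  have "(\<chi> i. 0) = (0 :: real^'n)" by (simp add: vec_eq_iff)
  then show "dx i f x y = dv (kron i) (\<lambda>_. 0) f x y"
    by (simp add: dx_def dv_def partial_deriv_def ddir_def axis_kron)
qed

lemma dy_dv:
  fixes f :: "real^'n::finite \<Rightarrow> real^'n \<Rightarrow> real"
  shows "dy i f = dv (\<lambda>_. 0) (kron i) f"
proof (intro ext)
  fix x y :: "real^'n"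
  have "(\<chi> i. 0) = (0 :: real^'n)" by (simp add: vec_eq_iff)
  then show "dy i f x y = dv (\<lambda>_. 0) (kron i) f x y"
    by (simp add: dy_def dv_def partial_deriv_def ddir_def axis_kron)
qed

lemma pair_sum: "(\<Sum>i\<in>A. (f i, g i)) = (\<Sum>i\<in>A. f i, \<Sum>i\<in>A. g i)"
  by (induction A rule: infinite_finite_induct) (auto simp: zero_prod_def)

lemma dv_expand:
  assumes "(\<lambda>p. f (fst p) (snd p)) differentiable (at (x, y))"
  shows "dv u v f x y = (\<Sum>i. u i * dx i f x y) + (\<Sum>i. v i * dy i f x y)"
proof -
  obtain f' where f': "((\<lambda>p. f (fst p) (snd p)) has_derivative f') (at (x, y))"
    using assms by (auto simp: differentiable_def)
  have lin: "linear f'" by (rule has_derivative_linear[OF f'])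
  have e: "dv u v f x y = f' (\<chi> i. u i, \<chi> i. v i)" for u v
    unfolding dv_def by (rule ddir_eq[OF f'])
  have "(\<chi> i. u i, \<chi> i. v i)
      = (\<Sum>i. u i *\<^sub>R (\<chi> j. kron i j, \<chi> j. 0)) + (\<Sum>i. v i *\<^sub>R (\<chi> j. 0, \<chi> j. kron i j))"
    by (simp add: pair_sum vec_eq_iff)
  then show ?thesis unfolding dx_dv dy_dv e
    by (simp add: linear_add[OF lin] linear_sum[OF lin] linear_scale[OF lin] del: scaleR_Pair)
qed

locale phase_space =
  fixes Om :: "((real^'n::finite) \<times> (real^'n)) set"
  assumes open_Om: "open Om"
begin

definition sm :: "(real^'n \<Rightarrow> real^'n \<Rightarrow> real) \<Rightarrow> bool" where
  "sm f \<longleftrightarrow> (\<forall>k. Cd k Om (\<lambda>p. f (fst p) (snd p)))"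

lemma sm_differentiable:
  "sm f \<Longrightarrow> (x, y) \<in> Om \<Longrightarrow> (\<lambda>p. f (fst p) (snd p)) differentiable (at (x, y))"
  using open_differentiable_onD[OF _ open_Om] unfolding sm_def by (metis Cd.simps(2))

lemma sm_cong: "(\<And>x y. (x, y) \<in> Om \<Longrightarrow> f x y = g x y) \<Longrightarrow> sm f \<longleftrightarrow> sm g"
  unfolding sm_def by (metis (no_types, lifting) Cd_cong[OF open_Om] prod.collapse)

lemma dv_cong:
  "(\<And>x y. (x, y) \<in> Om \<Longrightarrow> f x y = g x y) \<Longrightarrow> (x, y) \<in> Om \<Longrightarrow> dv u v f x y = dv u v g x y"
  unfolding dv_def by (rule ddir_cong[OF open_Om]) auto

lemma dx_cong:
  "(\<And>x y. (x, y) \<in> Om \<Longrightarrow> f x y = g x y) \<Longrightarrow> (x, y) \<in> Om \<Longrightarrow> dx i f x y = dx i g x y"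
  unfolding dx_dv by (rule dv_cong)

lemma dy_cong:
  "(\<And>x y. (x, y) \<in> Om \<Longrightarrow> f x y = g x y) \<Longrightarrow> (x, y) \<in> Om \<Longrightarrow> dy i f x y = dy i g x y"
  unfolding dy_dv by (rule dv_cong)

lemma sm_ddir:
  assumes "sm f" "e \<in> Basis" shows "sm (\<lambda>x y. ddir e (\<lambda>p. f (fst p) (snd p)) (x, y))"
  unfolding sm_def
proof
  fix k
  have "Cd (Suc k) Om (\<lambda>p. f (fst p) (snd p))" using assms(1) by (simp add: sm_def del: Cd.simps)
  then show "Cd k Om (\<lambda>p. ddir e (\<lambda>p. f (fst p) (snd p)) (fst p, snd p))" using assms(2) by simp
qed

lemma Basis_axis: "(axis i 1, 0) \<in> (Basis :: ((real^'n) \<times> (real^'n)) set)"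
    "(0, axis i 1) \<in> (Basis :: ((real^'n) \<times> (real^'n)) set)"
  by (auto simp: Basis_prod_def Basis_vec_def)

lemma Basis_axisE:
  fixes e :: "(real^'n) \<times> (real^'n)"
  assumes "e \<in> Basis"
  obtains i where "e = (axis i 1, 0)" | i where "e = (0, axis i 1)"
proof -
  have B: "(Basis :: (real^'n) set) = range (\<lambda>i. axis i 1)"
    by (auto simp: Basis_vec_def)
  show thesis using assms that unfolding Basis_prod_def B by blast
qed

lemma vec_zero: "(\<chi> i. 0) = (0 :: real^'n)"
  by (simp add: vec_eq_iff)

lemma sm_dx [intro, simp]: "sm f \<Longrightarrow> sm (dx i f)"
  using sm_ddir[OF _ Basis_axis(1)] by (simp add: dx_dv dv_def[abs_def] axis_kron vec_zero)

lemma sm_dy [intro, simp]: "sm f \<Longrightarrow> sm (dy i f)"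
  using sm_ddir[OF _ Basis_axis(2)] by (simp add: dy_dv dv_def[abs_def] axis_kron vec_zero)

lemma sm_const [intro, simp]: "sm (\<lambda>x y. c)"
  by (simp add: sm_def Cd_const)

lemma sm_coord [intro, simp]: "sm (\<lambda>x y. y $ i)"
  unfolding sm_def by (auto intro!: Cd_linear bounded_linear_compose[OF bounded_linear_vec_nth] bounded_linear_snd)

lemma sm_add [intro, simp]: "sm f \<Longrightarrow> sm g \<Longrightarrow> sm (\<lambda>x y. f x y + g x y)"
  by (simp add: sm_def Cd_add[OF open_Om])

lemma sm_mult [intro, simp]: "sm f \<Longrightarrow> sm g \<Longrightarrow> sm (\<lambda>x y. f x y * g x y)"
  by (simp add: sm_def Cd_mult[OF open_Om])

lemma sm_minus [intro, simp]: "sm f \<Longrightarrow> sm (\<lambda>x y. - f x y)"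
  using sm_mult[OF sm_const[of "-1"], of f] by simp

lemma sm_diff [intro, simp]: "sm f \<Longrightarrow> sm g \<Longrightarrow> sm (\<lambda>x y. f x y - g x y)"
  using sm_add[of f, OF _ sm_minus] by simp

lemma sm_sum [intro, simp]: "(\<And>i. i \<in> I \<Longrightarrow> sm (f i)) \<Longrightarrow> sm (\<lambda>x y. \<Sum>i\<in>I. f i x y)"
  by (induction I rule: infinite_finite_induct) auto

lemma sm_prod [intro, simp]: "(\<And>i. i \<in> I \<Longrightarrow> sm (f i)) \<Longrightarrow> sm (\<lambda>x y. \<Prod>i\<in>I. f i x y)"
  by (induction I rule: infinite_finite_induct) auto

lemma sm_power [intro, simp]: "sm f \<Longrightarrow> sm (\<lambda>x y. f x y ^ m)"
  by (induction m) auto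

lemma sm_inverse [intro]:
  "sm f \<Longrightarrow> (\<And>x y. (x, y) \<in> Om \<Longrightarrow> f x y \<noteq> 0) \<Longrightarrow> sm (\<lambda>x y. inverse (f x y))"
  by (auto simp: sm_def intro!: Cd_inverse[OF open_Om])

lemma sm_divide [intro]:
  "sm f \<Longrightarrow> sm g \<Longrightarrow> (\<And>x y. (x, y) \<in> Om \<Longrightarrow> g x y \<noteq> 0) \<Longrightarrow> sm (\<lambda>x y. f x y / g x y)"
  unfolding divide_inverse by (intro sm_mult sm_inverse)

lemma sm_cdivide [intro, simp]: "sm f \<Longrightarrow> sm (\<lambda>x y. f x y / c)"
  unfolding divide_inverse by (intro sm_mult sm_const)

text \<open>For a function of x alone the derivative along a fibre direction is 0 and the one along
  a base direction is \<open>partial_deriv\<close>, so the recursion of \<open>Ck_on\<close> on the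
  chart carries over to phase space.\<close>

lemma sm_base:
  assumes S: "open S" "Om \<subseteq> S \<times> UNIV" and f: "smooth_on f S"
  shows "sm (\<lambda>x y. f x)"
proof -
  have "Cd k Om (\<lambda>p. f (fst p))" if "Ck_on k f S" for k
    using that
  proof (induction k arbitrary: f)
    case 0
    then have "continuous_on S f" by simp
    then have "continuous_on Om (\<lambda>p. f (fst p))"
      by (rule continuous_on_compose2[OF _ continuous_on_fst[OF continuous_on_id]]) (use S(2) in auto)
    then show ?case by simp
  next
    case (Suc k)
    have "(\<lambda>p. f (fst p)) differentiable_on Om"
      unfolding differentiable_on_eq_differentiable_at[OF open_Om]
    proof
      fix p assume "p \<in> Om"
      then have "f differentiable (at (fst p))"
        using Suc.prems S(2) by (intro open_differentiable_onD[OF _ S(1)]) auto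
      then show "(\<lambda>p. f (fst p)) differentiable (at p)"
        by (rule differentiable_compose)
          (rule differentiableI[OF bounded_linear_imp_has_derivative[OF bounded_linear_fst]])
    qed
    moreover have "Cd k Om (ddir e (\<lambda>p. f (fst p)))" if e: "e \<in> Basis" for e :: "(real^'n) \<times> (real^'n)"
    proof -
      from e show ?thesis
      proof (cases rule: Basis_axisE)
        case (1 i)
        then have "ddir e (\<lambda>p. f (fst p)) = (\<lambda>p. partial_deriv i f (fst p))"
          by (intro ext) (simp add: ddir_def partial_deriv_def)
        moreover have "Ck_on k (partial_deriv i f) S" using Suc.prems by simp
        ultimately show ?thesis using Suc.IH[of "partial_deriv i f"] by (simp only:)
      next
        case (2 i)
        then have "ddir e (\<lambda>p. f (fst p)) = (\<lambda>p. 0)"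
          by (intro ext) (simp add: ddir_def)
        then show ?thesis by (simp add: Cd_const)
      qed
    qed
    ultimately show ?case by simp
  qed
  then show ?thesis using f by (auto simp: sm_def smooth_on_def)
qed

section \<open>Differentiation rules on phase space\<close>

lemma dv_dx_dy:
  "sm f \<Longrightarrow> (x, y) \<in> Om \<Longrightarrow>
    dv u v f x y = (\<Sum>i. u i * dx i f x y) + (\<Sum>i. v i * dy i f x y)"
  by (rule dv_expand[OF sm_differentiable])

lemma dv_const: "dv u v (\<lambda>x y. c) x y = 0"
  by (simp add: dv_def ddir_const)

lemma dv_coord: "dv u v (\<lambda>x y. y $ i) x y = v i"
proof -
  have "((\<lambda>p. snd p $ i) has_derivative (\<lambda>p. snd p $ i)) (at (x, y))"
    by (intro bounded_linear_imp_has_derivative bounded_linear_compose[OF bounded_linear_vec_nth] bounded_linear_snd)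
  from ddir_eq[OF this] show ?thesis by (simp add: dv_def)
qed

lemma dv_add: "sm f \<Longrightarrow> sm g \<Longrightarrow> (x, y) \<in> Om \<Longrightarrow>
    dv u v (\<lambda>x y. f x y + g x y) x y = dv u v f x y + dv u v g x y"
  unfolding dv_def by (intro ddir_add sm_differentiable)

lemma dv_mult: "sm f \<Longrightarrow> sm g \<Longrightarrow> (x, y) \<in> Om \<Longrightarrow>
    dv u v (\<lambda>x y. f x y * g x y) x y = f x y * dv u v g x y + dv u v f x y * g x y"
  unfolding dv_def using ddir_mult[OF sm_differentiable sm_differentiable, of f x y g] by simp

lemma dv_minus: "sm f \<Longrightarrow> (x, y) \<in> Om \<Longrightarrow> dv u v (\<lambda>x y. - f x y) x y = - dv u v f x y"
  using dv_mult[OF sm_const[of "-1"], of f] by (simp add: dv_const)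

lemma dv_diff: "sm f \<Longrightarrow> sm g \<Longrightarrow> (x, y) \<in> Om \<Longrightarrow>
    dv u v (\<lambda>x y. f x y - g x y) x y = dv u v f x y - dv u v g x y"
  using dv_add[of f, OF _ sm_minus[of g]] by (simp add: dv_minus)

lemma dv_sum: "(\<And>i. i \<in> I \<Longrightarrow> sm (f i)) \<Longrightarrow> (x, y) \<in> Om \<Longrightarrow>
    dv u v (\<lambda>x y. \<Sum>i\<in>I. f i x y) x y = (\<Sum>i\<in>I. dv u v (f i) x y)"
  by (induction I rule: infinite_finite_induct) (auto simp: dv_const dv_add)

lemma dv_inverse: "sm f \<Longrightarrow> (x, y) \<in> Om \<Longrightarrow> f x y \<noteq> 0 \<Longrightarrow>
    dv u v (\<lambda>x y. inverse (f x y)) x y = - (dv u v f x y * (inverse (f x y) * inverse (f x y)))"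
  unfolding dv_def using ddir_inverse[OF sm_differentiable, of f x y] by simp

lemma dy_base [simp]: "dy i (\<lambda>x y. f x) x y = 0"
  by (simp add: dy_def partial_deriv_def)

lemma dx_coord [simp]: "dx i (\<lambda>x y. g y) x y = 0"
  by (simp add: dx_def partial_deriv_def)

lemmas dx_add = dv_add[where u="kron i" and v="\<lambda>_. 0" for i, folded dx_dv]
  and dx_mult = dv_mult[where u="kron i" and v="\<lambda>_. 0" for i, folded dx_dv]
  and dx_sum = dv_sum[where u="kron i" and v="\<lambda>_. 0" for i, folded dx_dv]

lemmas dy_add = dv_add[where u="\<lambda>_. 0" and v="kron i" for i, folded dy_dv]
  and dy_mult = dv_mult[where u="\<lambda>_. 0" and v="kron i" for i, folded dy_dv]
  and dy_diff = dv_diff[where u="\<lambda>_. 0" and v="kron i" for i, folded dy_dv]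
  and dy_sum = dv_sum[where u="\<lambda>_. 0" and v="kron i" for i, folded dy_dv]
  and dy_inverse = dv_inverse[where u="\<lambda>_. 0" and v="kron i" for i, folded dy_dv]

lemma dy_cmult: "sm f \<Longrightarrow> (x, y) \<in> Om \<Longrightarrow> dy i (\<lambda>x y. c * f x y) x y = c * dy i f x y"
  using dy_mult[OF sm_const] by (simp add: dy_dv dv_const)

lemma dv_cmult: "sm f \<Longrightarrow> (x, y) \<in> Om \<Longrightarrow> dv u v (\<lambda>x y. c * f x y) x y = c * dv u v f x y"
  using dv_mult[OF sm_const] by (simp add: dv_const)

lemma dv_cdivide: "sm f \<Longrightarrow> (x, y) \<in> Om \<Longrightarrow> dv u v (\<lambda>x y. f x y / c) x y = dv u v f x y / c"
  unfolding divide_inverse by (simp add: dv_mult dv_const)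

lemmas dy_cdivide = dv_cdivide[where u="\<lambda>_. 0" and v="kron i" for i, folded dy_dv]

lemma dy_coord: "dy i (\<lambda>x y. y $ j) x y = kron i j"
  by (simp add: dy_dv dv_coord)

lemma dy_commute:
  assumes "sm f" "(x, y) \<in> Om"
  shows "dy i (dy j f) x y = dy j (dy i f) x y"
    and "dy i (dx j f) x y = dx j (dy i f) x y"
proof -
  have f: "Cd 2 Om (\<lambda>p. f (fst p) (snd p))" using assms by (simp add: sm_def)
  show "dy i (dy j f) x y = dy j (dy i f) x y" "dy i (dx j f) x y = dx j (dy i f) x y"
    using ddir_commute[OF open_Om assms(2) f Basis_axis(2)[of i] Basis_axis(2)[of j]]
      ddir_commute[OF open_Om assms(2) f Basis_axis(2)[of i] Basis_axis(1)[of j]]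
    by (simp_all add: dx_dv dy_dv dv_def axis_kron vec_zero)
qed

end

section \<open>The scalar curvature of a spray with a parallel metric\<close>

definition spray_vf :: "('n::finite \<Rightarrow> real^'n \<Rightarrow> real^'n \<Rightarrow> real) \<Rightarrow> (real^'n \<Rightarrow> real^'n \<Rightarrow> real) \<Rightarrow>
    real^'n \<Rightarrow> real^'n \<Rightarrow> real" where
  "spray_vf G f x y = dv (\<lambda>i. y $ i) (\<lambda>i. - 2 * G i x y) f x y"

definition spray_riem :: "('n::finite \<Rightarrow> real^'n \<Rightarrow> real^'n \<Rightarrow> real) \<Rightarrow> 'n \<Rightarrow> 'n \<Rightarrow>
    real^'n \<Rightarrow> real^'n \<Rightarrow> real" where
  "spray_riem G i k x y =
     2 * dx k (G i) x y
     - (\<Sum>j. y $ j * dx j (dy k (G i)) x y)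
     + 2 * (\<Sum>j. G j x y * dy j (dy k (G i)) x y)
     - (\<Sum>j. dy j (G i) x y * dy k (G j) x y)"

definition spray_ric :: "('n::finite \<Rightarrow> real^'n \<Rightarrow> real^'n \<Rightarrow> real) \<Rightarrow> real^'n \<Rightarrow> real^'n \<Rightarrow> real" where
  "spray_ric G x y = (\<Sum>m. spray_riem G m m x y)"

definition spray_div :: "('n::finite \<Rightarrow> real^'n \<Rightarrow> real^'n \<Rightarrow> real) \<Rightarrow> real^'n \<Rightarrow> real^'n \<Rightarrow> real" where
  "spray_div G x y = (\<Sum>m. dy m (G m) x y)"

locale spray = phase_space Om for Om :: "((real^'n::finite) \<times> (real^'n)) set" +
  fixes G :: "'n \<Rightarrow> real^'n \<Rightarrow> real^'n \<Rightarrow> real"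
  assumes sm_G [intro, simp]: "sm (G i)"
begin

abbreviation "vf \<equiv> spray_vf G"

lemma vf_expand:
  "sm f \<Longrightarrow> (x, y) \<in> Om \<Longrightarrow>
    vf f x y = (\<Sum>j. y $ j * dx j f x y) - 2 * (\<Sum>j. G j x y * dy j f x y)"
  by (simp add: spray_vf_def dv_dx_dy sum_distrib_left sum_negf[symmetric] mult.assoc)

lemma sm_vf [intro, simp]: "sm f \<Longrightarrow> sm (vf f)"
  by (subst sm_cong[OF vf_expand]) (auto intro!: sm_diff sm_mult sm_sum)

lemmas vf_add = dv_add[where u="\<lambda>i. y $ i" and v="\<lambda>i. - 2 * G i x y" and x=x and y=y for x y, folded spray_vf_def]
lemmas vf_mult = dv_mult[where u="\<lambda>i. y $ i" and v="\<lambda>i. - 2 * G i x y" and x=x and y=y for x y, folded spray_vf_def]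
lemmas vf_cmult = dv_cmult[where u="\<lambda>i. y $ i" and v="\<lambda>i. - 2 * G i x y" and x=x and y=y for x y, folded spray_vf_def]
lemmas vf_cdivide = dv_cdivide[where u="\<lambda>i. y $ i" and v="\<lambda>i. - 2 * G i x y" and x=x and y=y for x y, folded spray_vf_def]
lemmas vf_sum = dv_sum[where u="\<lambda>i. y $ i" and v="\<lambda>i. - 2 * G i x y" and x=x and y=y for x y, folded spray_vf_def]
lemmas vf_cong = dv_cong[where u="\<lambda>i. y $ i" and v="\<lambda>i. - 2 * G i x y" and x=x and y=y for x y, folded spray_vf_def]

lemma vf_const: "vf (\<lambda>x y. c) x y = 0"
  by (simp add: spray_vf_def dv_const)

text \<open>The commutator of a fibre derivative with the spray. Besides the symmetry of second
  derivatives it is the only tool needed for the general curvature identities.\<close>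

lemma dy_vf:
  assumes f: "sm f" and xy: "(x, y) \<in> Om"
  shows "dy k (vf f) x y = vf (dy k f) x y + dx k f x y - 2 * (\<Sum>j. dy k (G j) x y * dy j f x y)"
proof -
  have "dy k (vf f) x y
      = dy k (\<lambda>x y. (\<Sum>j. y $ j * dx j f x y) - 2 * (\<Sum>j. G j x y * dy j f x y)) x y"
    using f by (intro dy_cong[OF _ xy] vf_expand)
  also have "\<dots> = (\<Sum>j. y $ j * dy k (dx j f) x y + kron k j * dx j f x y)
      - 2 * (\<Sum>j. G j x y * dy k (dy j f) x y + dy k (G j) x y * dy j f x y)"
    using f xy
    by (simp add: dy_diff dy_cmult dy_sum dy_mult dy_coord sm_sum sm_mult)
  also have "\<dots> = vf (dy k f) x y + dx k f x y - 2 * (\<Sum>j. dy k (G j) x y * dy j f x y)"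
    using f xy by (simp add: vf_expand dy_commute[of f x y k] sum.distrib algebra_simps)
  finally show ?thesis .
qed

text \<open>The two terms with second derivatives of G^i are exactly minus the spray derivative of
  dG^i/dy^k. In this form \<open>dy_vf\<close> can be used to differentiate the curvature.\<close>

lemma spray_riem_vf:
  "(x, y) \<in> Om \<Longrightarrow> spray_riem G i k x y
    = 2 * dx k (G i) x y - vf (dy k (G i)) x y - (\<Sum>j. dy j (G i) x y * dy k (G j) x y)"
  by (simp add: spray_riem_def vf_expand)

lemma sm_spray_riem [intro, simp]: "sm (spray_riem G i k)"
  by (subst sm_cong[OF spray_riem_vf]) (auto intro!: sm_diff sm_mult sm_sum)

lemma sm_spray_ric [intro, simp]: "sm (spray_ric G)"
  unfolding spray_ric_def[abs_def] by (intro sm_sum sm_spray_riem)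

lemma sm_spray_div [intro, simp]: "sm (spray_div G)"
  unfolding spray_div_def[abs_def] by (intro sm_sum sm_dy sm_G)

lemma dy_spray_riem:
  assumes xy: "(x, y) \<in> Om"
  shows "dy l (spray_riem G i k) x y =
    2 * dx k (dy l (G i)) x y
    - (vf (dy l (dy k (G i))) x y + dx l (dy k (G i)) x y
      - 2 * (\<Sum>j. dy l (G j) x y * dy j (dy k (G i)) x y))
    - (\<Sum>j. dy j (G i) x y * dy l (dy k (G j)) x y + dy l (dy j (G i)) x y * dy k (G j) x y)"
proof -
  have "dy l (spray_riem G i k) x y = dy l (\<lambda>x y. 2 * dx k (G i) x y - vf (dy k (G i)) x y
      - (\<Sum>j. dy j (G i) x y * dy k (G j) x y)) x y"
    by (intro dy_cong[OF _ xy] spray_riem_vf)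
  also have "\<dots> = 2 * dy l (dx k (G i)) x y - dy l (vf (dy k (G i))) x y
      - (\<Sum>j. dy j (G i) x y * dy l (dy k (G j)) x y + dy l (dy j (G i)) x y * dy k (G j) x y)"
    using xy by (simp add: dy_diff dy_cmult dy_sum dy_mult dy_dv[symmetric] dv_const sm_sum sm_mult)
  finally show ?thesis using xy by (simp add: dy_vf dy_commute)
qed

lemma spray_div_derivs:
  assumes xy: "(x, y) \<in> Om"
  shows "dx k (spray_div G) x y = (\<Sum>m. dx k (dy m (G m)) x y)"
    and "dy k (spray_div G) x y = (\<Sum>m. dy k (dy m (G m)) x y)"
    and "vf (dy k (spray_div G)) x y = (\<Sum>m. vf (dy k (dy m (G m))) x y)"
proof -
  show "dx k (spray_div G) x y = (\<Sum>m. dx k (dy m (G m)) x y)"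
    and "dy k (spray_div G) x y = (\<Sum>m. dy k (dy m (G m)) x y)"
    unfolding spray_div_def[abs_def] using xy by (simp_all add: dx_sum dy_sum)
  have "vf (dy k (spray_div G)) x y = vf (\<lambda>x y. \<Sum>m. dy k (dy m (G m)) x y) x y"
    unfolding spray_div_def[abs_def] by (intro vf_cong[OF _ xy] dy_sum) auto
  then show "vf (dy k (spray_div G)) x y = (\<Sum>m. vf (dy k (dy m (G m))) x y)"
    using xy by (simp add: vf_sum)
qed

text \<open>Both the fibre divergence of R^m_k and the fibre gradient of Ric are combinations of the
  five contractions \<open>a\<close> to \<open>e\<close>. Adding half the gradient to the divergence
  eliminates \<open>b\<close>, \<open>d\<close> and \<open>e\<close>; what is left, \<open>a\<close>
  and \<open>c\<close>, are derivatives of \<Pi>.\<close>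

lemma div_spray_riem:
  assumes xy: "(x, y) \<in> Om"
  shows "(\<Sum>m. dy m (spray_riem G m k) x y) =
    3/2 * (dx k (spray_div G) x y - vf (dy k (spray_div G)) x y) - 1/2 * dy k (spray_ric G) x y"
proof -
  define a where "a = (\<Sum>m. dx k (dy m (G m)) x y)"
  define b where "b = (\<Sum>m. dx m (dy k (G m)) x y)"
  define c where "c = (\<Sum>m. vf (dy k (dy m (G m))) x y)"
  define d where "d = (\<Sum>m j. dy k (G j) x y * dy j (dy m (G m)) x y)"
  define e where "e = (\<Sum>m j. dy m (G j) x y * dy j (dy k (G m)) x y)"
  have e': "(\<Sum>m j. dy j (G m) x y * dy k (dy m (G j)) x y) = e"
    using xy unfolding e_def by (subst sum.swap) (simp add: dy_commute[of _ x y k])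
  have e'': "(\<Sum>m j. dy k (dy j (G m)) x y * dy m (G j) x y) = e"
    using xy unfolding e_def by (simp add: dy_commute[of _ x y k] mult.commute)
  have e''': "(\<Sum>m j. dy j (G m) x y * dy m (dy k (G j)) x y) = e"
    unfolding e_def by (subst sum.swap) simp
  have d': "(\<Sum>m j. dy m (dy j (G m)) x y * dy k (G j) x y) = d"
    using xy unfolding d_def
    by (intro sum.cong refl) (metis dy_commute(1) mult.commute sm_G)
  have c': "(\<Sum>m. vf (dy m (dy k (G m))) x y) = c"
    unfolding c_def by (intro sum.cong refl vf_cong dy_commute xy) auto
  have "dy k (spray_ric G) x y = (\<Sum>m. dy k (spray_riem G m m) x y)"
    unfolding spray_ric_def[abs_def] using xy by (simp add: dy_sum)
  also have "\<dots> = 2 * b - (c + a - 2 * d) - (e + e)"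
    using xy by (simp add: dy_spray_riem sum_subtractf sum.distrib sum_distrib_left[symmetric] e' e''
        a_def[symmetric] b_def[symmetric] c_def[symmetric] d_def[symmetric])
  finally have R: "dy k (spray_ric G) x y = 2 * b - (c + a - 2 * d) - (e + e)" .
  have "(\<Sum>m. dy m (spray_riem G m k) x y) = 2 * a - (c + b - 2 * e) - (e + d)"
    using xy by (simp add: dy_spray_riem sum_subtractf sum.distrib sum_distrib_left[symmetric] c' d' e'''
        a_def[symmetric] b_def[symmetric] e_def[symmetric])
  then show ?thesis
    unfolding R using xy by (simp add: spray_div_derivs a_def[symmetric] c_def[symmetric] field_simps)
qed

text \<open>The first trace is the fibre Hessian of Ric, the second is a derivative of
  \<open>div_spray_riem\<close>; the factor 1/2 of the Hessian is 1/3 (1 + 1/2). The part with dx is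
  skew in i and j.\<close>

lemma spray_ricci_bar:
  assumes xy: "(x, y) \<in> Om"
  shows "(\<Sum>m. 1/3 * (dy j (dy i (spray_riem G m m)) x y - dy m (dy i (spray_riem G m j)) x y)) =
    1/2 * dy i (dy j (spray_ric G)) x y
    + 1/2 * (vf (dy i (dy j (spray_div G))) x y + dx i (dy j (spray_div G)) x y - dx j (dy i (spray_div G)) x y
       - 2 * (\<Sum>m. dy i (G m) x y * dy m (dy j (spray_div G)) x y))"
proof -
  have "(\<Sum>m. dy j (dy i (spray_riem G m m)) x y) = dy j (\<lambda>x y. \<Sum>m. dy i (spray_riem G m m) x y) x y"
    using xy by (simp add: dy_sum)
  also have "\<dots> = dy j (dy i (spray_ric G)) x y"
    by (intro dy_cong[OF _ xy]) (simp add: spray_ric_def[abs_def] dy_sum)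
  finally have 1: "(\<Sum>m. dy j (dy i (spray_riem G m m)) x y) = dy i (dy j (spray_ric G)) x y"
    using xy by (simp add: dy_commute[of _ x y i j])
  have "(\<Sum>m. dy m (dy i (spray_riem G m j)) x y) = (\<Sum>m. dy i (dy m (spray_riem G m j)) x y)"
    using xy by (simp add: dy_commute[of _ x y i])
  also have "\<dots> = dy i (\<lambda>x y. \<Sum>m. dy m (spray_riem G m j) x y) x y"
    using xy by (simp add: dy_sum)
  also have "\<dots> = dy i (\<lambda>x y. 3/2 * (dx j (spray_div G) x y - vf (dy j (spray_div G)) x y)
      - 1/2 * dy j (spray_ric G) x y) x y"
    by (intro dy_cong[OF _ xy] div_spray_riem)
  also have "\<dots> = 3/2 * (dy i (dx j (spray_div G)) x y - dy i (vf (dy j (spray_div G))) x y)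
      - 1/2 * dy i (dy j (spray_ric G)) x y"
    using xy by (simp add: dy_diff dy_cmult dy_cdivide)
  finally have 2: "(\<Sum>m. dy m (dy i (spray_riem G m j)) x y) = \<dots>" .
  have "(\<Sum>m. 1/3 * (dy j (dy i (spray_riem G m m)) x y - dy m (dy i (spray_riem G m j)) x y))
    = 1/3 * ((\<Sum>m. dy j (dy i (spray_riem G m m)) x y) - (\<Sum>m. dy m (dy i (spray_riem G m j)) x y))"
    by (simp add: sum_distrib_left sum_subtractf right_diff_distrib)
  then show ?thesis unfolding 1 2 using xy by (simp add: dy_vf dy_commute[of _ x y i] algebra_simps)
qed

end

text \<open>\<open>L\<close> stands for F^2 and \<open>gi\<close> for the inverse fundamental
  tensor. The spray equation is stated with the index lowered, so that it can be differentiated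
  without differentiating \<open>gi\<close>.\<close>

locale finsler_spray = spray Om G for Om :: "((real^'n::finite) \<times> (real^'n)) set" and G :: "'n \<Rightarrow> real^'n \<Rightarrow> real^'n \<Rightarrow> real" +
  fixes L :: "real^'n \<Rightarrow> real^'n \<Rightarrow> real" and gi :: "'n \<Rightarrow> 'n \<Rightarrow> real^'n \<Rightarrow> real^'n \<Rightarrow> real"
  assumes sm_L [intro, simp]: "sm L" and sm_gi [intro, simp]: "sm (gi i j)"
    and gi_sym: "(x, y) \<in> Om \<Longrightarrow> gi i j x y = gi j i x y"
    and gi_inv: "(x, y) \<in> Om \<Longrightarrow> (\<Sum>k. gi i k x y * (1/2 * dy j (dy k L) x y)) = kron i j"
    and spray_eq: "(x, y) \<in> Om \<Longrightarrow>
      (\<Sum>j. dy k (dx j L) x y * y $ j) - dx k L x y = 2 * (\<Sum>m. G m x y * dy m (dy k L) x y)"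
begin

definition "lap f x y = (\<Sum>i j. gi i j x y * dy i (dy j f) x y)"

text \<open>The spray equation for k is differentiated in y^l and then averaged with the equation in
  which k and l are exchanged; the skew terms L_{x^l y^k} - L_{x^k y^l} cancel. This says that the
  fundamental tensor is parallel along the spray.\<close>

lemma vf_fundamental:
  assumes xy: "(x, y) \<in> Om"
  shows "vf (dy l (dy k L)) x y =
    (\<Sum>m. dy l (G m) x y * dy m (dy k L) x y) + (\<Sum>m. dy k (G m) x y * dy m (dy l L) x y)"
proof -
  have *: "dx l (dy k L) x y + (\<Sum>j. y $ j * dx j (dy l (dy k L)) x y) - dx k (dy l L) x y =
    2 * (\<Sum>m. G m x y * dy m (dy l (dy k L)) x y) + 2 * (\<Sum>m. dy l (G m) x y * dy m (dy k L) x y)" for l k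
  proof -
    have c: "dy l (dy k (dx j L)) x y = dx j (dy l (dy k L)) x y" for j
    proof -
      have "dy l (dy k (dx j L)) x y = dy l (dx j (dy k L)) x y"
        by (intro dy_cong[OF _ xy] dy_commute) auto
      also have "\<dots> = dx j (dy l (dy k L)) x y" using xy by (intro dy_commute) auto
      finally show ?thesis .
    qed
    have "dy l (\<lambda>x y. (\<Sum>j. dy k (dx j L) x y * y $ j) - dx k L x y) x y
        = dy l (\<lambda>x y. 2 * (\<Sum>m. G m x y * dy m (dy k L) x y)) x y"
      by (intro dy_cong[OF _ xy] spray_eq)
    moreover have "dy l (\<lambda>x y. (\<Sum>j. dy k (dx j L) x y * y $ j) - dx k L x y) x y
        = (\<Sum>j. dy k (dx j L) x y * kron l j + dx j (dy l (dy k L)) x y * y $ j) - dx k (dy l L) x y"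
      using xy by (simp add: dy_diff dy_sum dy_mult dy_coord c dy_commute(2)[of L x y l k])
    moreover have "dy l (\<lambda>x y. 2 * (\<Sum>m. G m x y * dy m (dy k L) x y)) x y
        = 2 * (\<Sum>m. G m x y * dy m (dy l (dy k L)) x y + dy l (G m) x y * dy m (dy k L) x y)"
      using xy by (simp add: dy_cmult dy_sum dy_mult
          dy_commute(1)[of "dy k L" x y l])
    moreover have "dy k (dx l L) x y = dx l (dy k L) x y" using xy by (intro dy_commute) auto
    ultimately show ?thesis by (simp add: sum.distrib algebra_simps)
  qed
  have s: "dx j (dy l (dy k L)) x y = dx j (dy k (dy l L)) x y" for j
    by (intro dx_cong[OF _ xy] dy_commute) auto
  have s': "dy j (dy l (dy k L)) x y = dy j (dy k (dy l L)) x y" for j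
    by (intro dy_cong[OF _ xy] dy_commute) auto
  have "vf (dy l (dy k L)) x y = (\<Sum>j. y $ j * dx j (dy l (dy k L)) x y)
      - 2 * (\<Sum>m. G m x y * dy m (dy l (dy k L)) x y)"
    using xy by (simp add: vf_expand)
  then show ?thesis using *[of l k] *[of k l] unfolding s s' by linarith
qed

text \<open>The relation g^{ik} g_{kl} = \<delta>^i_l is differentiated along the spray, and the
  result is multiplied by g^{lj}.\<close>

lemma vf_inverse_fundamental:
  assumes xy: "(x, y) \<in> Om"
  shows "vf (gi i j) x y =
    - (\<Sum>l. dy l (G i) x y * gi l j x y) - (\<Sum>k. gi i k x y * dy k (G j) x y)"
proof -
  define g where "g k l = 1/2 * dy l (dy k L) x y" for k l
  have g_sym: "g k l = g l k" for k l using xy by (simp add: g_def dy_commute)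
  have inv: "(\<Sum>k. gi i k x y * g k j) = kron i j" for i j
    using gi_inv[OF xy] by (simp add: g_def)
  have inv': "(\<Sum>k. g i k * gi k j x y) = kron i j" for i j
    using inv[of j i] g_sym gi_sym[OF xy] by (simp add: mult.commute kron_commute)
  define Dg where "Dg k l = vf (\<lambda>x y. 1/2 * dy l (dy k L) x y) x y" for k l
  have Dg: "Dg k l = (\<Sum>m. dy l (G m) x y * g m k) + (\<Sum>m. dy k (G m) x y * g m l)" for k l
  proof -
    have "Dg k l = 1/2 * vf (dy l (dy k L)) x y"
      unfolding Dg_def using xy by (intro vf_cmult) auto
    then show ?thesis using xy
      by (simp add: vf_fundamental g_def sum_distrib_left dy_commute(1)[of L x y] distrib_left)
  qed
  have "(\<Sum>k. gi i k x y * Dg k l + vf (gi i k) x y * g k l) = 0" for l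
  proof -
    have "vf (\<lambda>x y. \<Sum>k. gi i k x y * (1/2 * dy l (dy k L) x y)) x y = vf (\<lambda>x y. kron i l) x y"
      by (intro vf_cong[OF _ xy] gi_inv)
    then show ?thesis using xy by (simp add: vf_sum vf_mult vf_const vf_cdivide add_divide_distrib Dg_def g_def)
  qed
  then have 1: "(\<Sum>k. vf (gi i k) x y * g k l) = - (\<Sum>k. gi i k x y * Dg k l)" for l
    by (simp add: sum.distrib eq_neg_iff_add_eq_0 add.commute)
  have 2: "(\<Sum>k. gi i k x y * Dg k l)
      = dy l (G i) x y + (\<Sum>k m. gi i k x y * dy k (G m) x y * g m l)" for l
  proof -
    have "(\<Sum>k. gi i k x y * (\<Sum>m. dy l (G m) x y * g m k))
        = (\<Sum>m. dy l (G m) x y * (\<Sum>k. gi i k x y * g k m))"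
      unfolding sum_distrib_left by (subst sum.swap) (simp add: g_sym mult.left_commute)
    also have "\<dots> = dy l (G i) x y" by (simp add: inv)
    finally show ?thesis by (simp add: Dg distrib_left sum.distrib) (simp add: sum_distrib_left mult.assoc)
  qed
  have "vf (gi i j) x y = (\<Sum>k. vf (gi i k) x y * (\<Sum>l. g k l * gi l j x y))"
    by (simp add: inv')
  also have "\<dots> = (\<Sum>l. (\<Sum>k. vf (gi i k) x y * g k l) * gi l j x y)"
    unfolding sum_distribs by (subst sum.swap) (simp add: mult.assoc)
  also have "\<dots> = - (\<Sum>l. dy l (G i) x y * gi l j x y)
      - (\<Sum>l. (\<Sum>k m. gi i k x y * dy k (G m) x y * g m l) * gi l j x y)"
    by (simp add: 1 2 left_diff_distrib sum_subtractf sum_negf)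
  also have "(\<Sum>l. (\<Sum>k m. gi i k x y * dy k (G m) x y * g m l) * gi l j x y)
      = (\<Sum>k m. gi i k x y * dy k (G m) x y * (\<Sum>l. g m l * gi l j x y))"
    unfolding sum_distribs
    by (subst sum.swap, rule sum.cong[OF refl], subst sum.swap) (simp add: mult.assoc)
  also have "\<dots> = (\<Sum>k. gi i k x y * dy k (G j) x y)" by (simp add: inv')
  finally show ?thesis .
qed

text \<open>The metric is parallel along its spray, so the mean Berwald part of the scalar curvature
  is a derivative of a scalar along the spray.\<close>

lemma scalar_curvature_spray:
  assumes xy: "(x, y) \<in> Om"
  shows "(\<Sum>i j. gi i j x y *
      (\<Sum>m. 1/3 * (dy j (dy i (spray_riem G m m)) x y - dy m (dy i (spray_riem G m j)) x y))) =
    1/2 * lap (spray_ric G) x y + 1/2 * vf (lap (spray_div G)) x y"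
proof -
  define P where "P i j = dy i (dy j (spray_div G)) x y" for i j
  define C where "C i j = (\<Sum>m. dy i (G m) x y * P m j)" for i j
  have P_sym: "P i j = P j i" for i j using xy by (simp add: P_def dy_commute)
  have vP: "vf (lap (spray_div G)) x y = (\<Sum>i j. gi i j x y * vf (dy i (dy j (spray_div G))) x y)
      + (\<Sum>i j. vf (gi i j) x y * P i j)"
    unfolding lap_def[abs_def] using xy by (simp add: vf_sum vf_mult sum.distrib P_def sm_sum sm_mult)
  have a: "(\<Sum>i j. (\<Sum>l. dy l (G i) x y * gi l j x y) * P i j)
      = (\<Sum>i j. gi i j x y * C i j)"
  proof -
    have "(\<Sum>i j. (\<Sum>l. dy l (G i) x y * gi l j x y) * P i j)
        = (\<Sum>i l j. dy l (G i) x y * gi l j x y * P i j)"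
      unfolding sum_distrib_right by (rule sum.cong[OF refl], rule sum.swap)
    also have "\<dots> = (\<Sum>l i j. dy l (G i) x y * gi l j x y * P i j)"
      by (rule sum.swap)
    also have "\<dots> = (\<Sum>l j i. dy l (G i) x y * gi l j x y * P i j)"
      by (rule sum.cong[OF refl], rule sum.swap)
    finally show ?thesis unfolding C_def sum_distrib_left by (simp add: mult_ac)
  qed
  have b: "(\<Sum>i j. (\<Sum>k. gi i k x y * dy k (G j) x y) * P i j)
      = (\<Sum>i j. gi i j x y * C i j)"
  proof -
    have "(\<Sum>i j. (\<Sum>k. gi i k x y * dy k (G j) x y) * P i j)
        = (\<Sum>i k j. gi i k x y * dy k (G j) x y * P i j)"
      unfolding sum_distrib_right by (rule sum.cong[OF refl], rule sum.swap)
    also have "\<dots> = (\<Sum>k i j. gi i k x y * dy k (G j) x y * P i j)"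
      by (rule sum.swap)
    finally show ?thesis unfolding C_def sum_distrib_left
      using gi_sym[OF xy] P_sym by (simp add: mult_ac)
  qed
  \<comment> \<open>The skew part of the traced tensor disappears against the symmetric
    g^{ij}.\<close>
  have c: "(\<Sum>i j. gi i j x y * dx i (dy j (spray_div G)) x y)
      = (\<Sum>i j. gi i j x y * dx j (dy i (spray_div G)) x y)"
    by (subst sum.swap) (simp add: gi_sym[OF xy])
  \<comment> \<open>Parallelism makes the derivative of g^{ij} produce exactly the term -2
    \<open>C\<close> present in the traced tensor, so the spray derivative can be pulled out of the
    contraction.\<close>
  have v: "(\<Sum>i j. vf (gi i j) x y * P i j) = - 2 * (\<Sum>i j. gi i j x y * C i j)"
    using xy by (simp add: vf_inverse_fundamental left_diff_distrib sum_subtractf sum_negf a b)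
  have "(\<Sum>i j. gi i j x y *
      (\<Sum>m. 1/3 * (dy j (dy i (spray_riem G m m)) x y - dy m (dy i (spray_riem G m j)) x y)))
    = 1/2 * lap (spray_ric G) x y
      + 1/2 * ((\<Sum>i j. gi i j x y * vf (dy i (dy j (spray_div G))) x y)
        - 2 * (\<Sum>i j. gi i j x y * C i j))"
    using c unfolding spray_ricci_bar[OF xy] P_def[symmetric] C_def[symmetric] lap_def
    by (simp add: distrib_left right_diff_distrib sum.distrib sum_subtractf sum_distrib_left[symmetric]
        mult.left_commute[of _ 2] sum_divide_distrib[symmetric])
  then show ?thesis unfolding vP v by simp
qed

end

section \<open>The Levi-Civita connection on phase space\<close>

lemma matrix_inv_works:
  fixes A :: "real^'n::finite^'n"
  assumes "invertible A"
  shows "A ** matrix_inv A = mat 1" "matrix_inv A ** A = mat 1"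
proof -
  have "A ** matrix_inv A = mat 1 \<and> matrix_inv A ** A = mat 1"
    using assms unfolding invertible_def matrix_inv_def by (rule someI_ex)
  then show "A ** matrix_inv A = mat 1" "matrix_inv A ** A = mat 1" by blast+
qed

lemma matrix_inv_eqI:
  fixes A B :: "real^'n::finite^'n"
  assumes "B ** A = mat 1" shows "matrix_inv A = B"
proof -
  have "invertible A" using assms invertible_left_inverse by blast
  then have "A ** matrix_inv A = mat 1" by (rule matrix_inv_works)
  then have "B ** (A ** matrix_inv A) = B" by simp
  then show ?thesis by (simp add: matrix_mul_assoc assms)
qed

text \<open>Cramer's rule writes the entries of the inverse as rational functions of the entries,
  which is how smoothness of a^{ij} is obtained.\<close>

lemma matrix_inv_cramer:
  fixes A :: "real^'n::finite^'n"
  assumes "invertible A"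
  shows "matrix_inv A $ k $ j = det (\<chi> i l. if l = k then kron i j else A $ i $ l) / det A"
proof -
  have d: "det A \<noteq> 0" using assms invertible_det_nz by blast
  have "A *v column j (matrix_inv A) = (\<chi> i. kron i j)"
  proof (subst vec_eq_iff, intro allI)
    fix i
    have "(A ** matrix_inv A) $ i $ j = mat 1 $ i $ j" by (simp add: matrix_inv_works assms)
    then show "(A *v column j (matrix_inv A)) $ i = (\<chi> i. kron i j) $ i"
      by (simp add: matrix_matrix_mult_def matrix_vector_mult_def column_def mat_def kron_def)
  qed
  from this[unfolded cramer[OF d]] show ?thesis by (simp add: vec_eq_iff column_def cong: if_cong)
qed

section \<open>One chart with a metric and a nowhere vanishing 1-form\<close>

locale kropina_chart =
  fixes S :: "(real^'n::finite) set" and a :: "real^'n \<Rightarrow> real^'n^'n" and b :: "real^'n \<Rightarrow> real^'n"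
  assumes open_S: "open S"
    and smooth_a: "smooth_on (\<lambda>x. a x $ i $ j) S"
    and sym_a: "x \<in> S \<Longrightarrow> a x $ i $ j = a x $ j $ i"
    and pos_a: "x \<in> S \<Longrightarrow> v \<noteq> 0 \<Longrightarrow> v \<bullet> (a x *v v) > 0"
    and smooth_b: "smooth_on (\<lambda>x. b x $ i) S"
    and b_nz: "x \<in> S \<Longrightarrow> b x \<noteq> 0"
begin

definition Om :: "((real^'n) \<times> (real^'n)) set" where
  "Om = {(x, y). x \<in> S \<and> beta_form b x y > 0}"

lemma Om_S: "(x, y) \<in> Om \<Longrightarrow> x \<in> S"
  by (simp add: Om_def)

lemma open_Om: "open Om"
proof -
  have c: "continuous_on S (\<lambda>x. b x $ i)" for i
    using smooth_b[of i] by (auto simp: smooth_on_def dest: spec[of _ 0])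
  have "continuous_on (S \<times> UNIV) (\<lambda>p. beta_form b (fst p) (snd p))"
    unfolding beta_form_def
    by (intro continuous_intros continuous_on_compose2[OF c]) auto
  then have "open ((\<lambda>p. beta_form b (fst p) (snd p)) -` {0<..} \<inter> (S \<times> UNIV))"
    by (rule continuous_on_open_vimage[THEN iffD1, rule_format, rotated]) (auto intro: open_Times open_S)
  also have "(\<lambda>p. beta_form b (fst p) (snd p)) -` {0<..} \<inter> (S \<times> UNIV) = Om"
    by (auto simp: Om_def)
  finally show ?thesis .
qed

sublocale phase_space Om
  by unfold_locales (rule open_Om)

abbreviation smb :: "(real^'n \<Rightarrow> real) \<Rightarrow> bool" where
  "smb f \<equiv> sm (\<lambda>x y. f x)"

abbreviation "pd \<equiv> partial_deriv"

lemma smb_partial [intro, simp]: "smb f \<Longrightarrow> smb (pd k f)"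
  using sm_dx[of "\<lambda>x y. f x" k] by (simp add: dx_def[abs_def])

lemma smb_smooth: "smooth_on f S \<Longrightarrow> smb f"
  by (rule sm_base[OF open_S]) (auto simp: Om_def)

lemma smb_a [intro, simp]: "smb (\<lambda>x. a x $ i $ j)"
  by (rule smb_smooth[OF smooth_a])

lemma smb_b [intro, simp]: "smb (\<lambda>x. b x $ i)"
  by (rule smb_smooth[OF smooth_b])

lemma pd_mult: "smb f \<Longrightarrow> smb g \<Longrightarrow> (x, y) \<in> Om \<Longrightarrow>
    pd k (\<lambda>x. f x * g x) x = f x * pd k g x + pd k f x * g x"
  using dx_mult[of "\<lambda>x y. f x" "\<lambda>x y. g x" x y k] by (simp add: dx_def)

lemma pd_sum: "(\<And>i. i \<in> I \<Longrightarrow> smb (f i)) \<Longrightarrow> (x, y) \<in> Om \<Longrightarrow>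
    pd k (\<lambda>x. \<Sum>i\<in>I. f i x) x = (\<Sum>i\<in>I. pd k (f i) x)"
  using dx_sum[of I "\<lambda>i x y. f i x" x y k] by (simp add: dx_def)

lemma pd_cong: "(\<And>x. x \<in> S \<Longrightarrow> f x = g x) \<Longrightarrow> (x, y) \<in> Om \<Longrightarrow> pd k f x = pd k g x"
  using dx_cong[of "\<lambda>x y. f x" "\<lambda>x y. g x" x y k] by (simp add: dx_def Om_def)

lemma pd_const: "pd k (\<lambda>x. c) x = 0"
  by (simp add: partial_deriv_def)

abbreviation "ai \<equiv> inv_metric a"
abbreviation "Gam \<equiv> christoffel a"
abbreviation "bu \<equiv> b_u a b"
abbreviation "bd \<equiv> b_d b"
abbreviation "rd \<equiv> r_d a b"
abbreviation "sd \<equiv> s_d a b"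
abbreviation "ru \<equiv> r_u a b"
abbreviation "su \<equiv> s_u a b"
abbreviation "rud \<equiv> r_ud a b"
abbreviation "sud \<equiv> s_ud a b"
abbreviation "rl \<equiv> r_dd a b"
abbreviation "sl \<equiv> s_dd a b"
abbreviation "Ric \<equiv> riemann_ricci a"
abbreviation "be \<equiv> beta_form b"
abbreviation "Drud \<equiv> cov_ud a rud"
abbreviation "Dsud \<equiv> cov_ud a sud"
abbreviation "Dbu \<equiv> cov_u a bu"
abbreviation "Dbd \<equiv> cov_d a bd"
abbreviation "Drd \<equiv> cov_d a rd"
abbreviation "Dsd \<equiv> cov_d a sd"
abbreviation "Drdd \<equiv> cov_dd a rl"

lemma invertible_a: "x \<in> S \<Longrightarrow> invertible (a x)"
proof -
  assume x: "x \<in> S"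
  have "v = 0" if "a x *v v = 0" for v
    using pos_a[OF x, of v] that by auto
  then show ?thesis using matrix_left_invertible_ker invertible_left_inverse by blast
qed

lemma ai_a: "x \<in> S \<Longrightarrow> (\<Sum>k. ai x i k * a x $ k $ j) = kron i j"
  and a_ai: "x \<in> S \<Longrightarrow> (\<Sum>k. a x $ i $ k * ai x k j) = kron i j"
  using matrix_inv_works[OF invertible_a, of x]
  by (simp_all add: vec_eq_iff matrix_matrix_mult_def mat_def kron_def inv_metric_def)

lemma ai_sym: "x \<in> S \<Longrightarrow> ai x i j = ai x j i"
proof -
  assume x: "x \<in> S"
  have "transpose (matrix_inv (a x)) ** a x = mat 1"
    using a_ai[OF x] by (simp add: vec_eq_iff matrix_matrix_mult_def mat_def kron_def[symmetric]
        transpose_def inv_metric_def sym_a[OF x, of _ "j" for j] mult.commute kron_commute)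
  then have "matrix_inv (a x) = transpose (matrix_inv (a x))" by (rule matrix_inv_eqI)
  from arg_cong[OF this, of "\<lambda>M. M $ i $ j"] show ?thesis
    by (simp add: inv_metric_def transpose_def)
qed

lemma smb_ai [intro, simp]: "smb (\<lambda>x. ai x i j)"
proof -
  have "sm (\<lambda>x y. det (\<chi> k l. if l = i then kron k j else a x $ k $ l) / det (a x))"
    unfolding det_def
  proof (intro sm_divide sm_sum sm_mult sm_const sm_prod)
    fix x y :: "real^'n" assume "(x, y) \<in> Om"
    then have "det (a x) \<noteq> 0" using invertible_a invertible_det_nz Om_S by blast
    then show "(\<Sum>p | p permutes UNIV. of_int (sign p) * (\<Prod>i\<in>UNIV. a x $ i $ p i)) \<noteq> 0"
      unfolding det_def .
  next
    fix p :: "'n \<Rightarrow> 'n" and k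
    show "sm (\<lambda>x y. (\<chi> k l. if l = i then kron k j else a x $ k $ l) $ k $ p k)"
      by (cases "p k = i") auto
  qed auto
  then show ?thesis
    by (subst sm_cong) (auto simp: inv_metric_def matrix_inv_cramer invertible_a dest: Om_S)
qed

lemma smb_Gam [intro, simp]: "smb (\<lambda>x. Gam x i j k)"
  unfolding christoffel_def by (intro sm_mult sm_const sm_sum sm_add sm_diff) auto

lemma Gam_sym: "(x, y) \<in> Om \<Longrightarrow> Gam x i j k = Gam x i k j"
proof -
  assume xy: "(x, y) \<in> Om"
  have "pd l (\<lambda>z. a z $ j $ k) x = pd l (\<lambda>z. a z $ k $ j) x" for l
    by (rule pd_cong[OF _ xy]) (rule sym_a)
  then show ?thesis unfolding christoffel_def by (simp add: add.commute)
qed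

section \<open>Covariant constancy of the metric\<close>

lemma a_Gam:
  assumes xy: "(x, y) \<in> Om"
  shows "(\<Sum>l. a x $ i $ l * Gam x l j k) = 1/2 * (pd j (\<lambda>z. a z $ i $ k) x
    + pd k (\<lambda>z. a z $ i $ j) x - pd i (\<lambda>z. a z $ j $ k) x)"
proof -
  define E where "E m = pd j (\<lambda>z. a z $ m $ k) x
    + pd k (\<lambda>z. a z $ m $ j) x - pd m (\<lambda>z. a z $ j $ k) x" for m
  have "(\<Sum>l. a x $ i $ l * Gam x l j k) = (\<Sum>l m. 1/2 * (a x $ i $ l * ai x l m) * E m)"
    unfolding christoffel_def E_def[symmetric] by (simp add: sum_distrib_left mult_ac)
  also have "\<dots> = (\<Sum>m. 1/2 * (\<Sum>l. a x $ i $ l * ai x l m) * E m)"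
    by (subst sum.swap) (simp add: sum_distribs)
  also have "\<dots> = 1/2 * E i"
    by (simp add: a_ai[OF Om_S[OF xy]] sum_divide_distrib[symmetric])
  finally show ?thesis unfolding E_def .
qed

text \<open>Two instances of \<open>a_Gam\<close> with i and j exchanged are added; the other two
  derivatives of the metric cancel.\<close>

lemma partial_a:
  assumes xy: "(x, y) \<in> Om"
  shows "pd k (\<lambda>z. a z $ i $ j) x
    = (\<Sum>l. Gam x l i k * a x $ l $ j) + (\<Sum>l. Gam x l j k * a x $ i $ l)"
proof -
  have s: "pd l (\<lambda>z. a z $ j $ k) x = pd l (\<lambda>z. a z $ k $ j) x" for l j k
    by (rule pd_cong[OF _ xy]) (rule sym_a)
  have 1: "(\<Sum>l. Gam x l i k * a x $ l $ j) = (\<Sum>l. a x $ j $ l * Gam x l i k)"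
    by (rule sum.cong[OF refl]) (simp add: sym_a[OF Om_S[OF xy], of j])
  have 2: "(\<Sum>l. Gam x l j k * a x $ i $ l) = (\<Sum>l. a x $ i $ l * Gam x l j k)"
    by (simp add: mult.commute)
  show ?thesis unfolding 1 2
    using a_Gam[OF xy, of j i k] a_Gam[OF xy, of i j k] s[of k j i] by (simp add: field_simps)
qed

lemma partial_ai:
  assumes xy: "(x, y) \<in> Om"
  shows "pd k (\<lambda>z. ai z i j) x
    = - (\<Sum>l. Gam x i l k * ai x l j) - (\<Sum>l. Gam x j l k * ai x i l)"
proof -
  note x = Om_S[OF xy]
  have 0: "(\<Sum>m. ai x i m * pd k (\<lambda>z. a z $ m $ l) x + pd k (\<lambda>z. ai z i m) x * a x $ m $ l) = 0" for l
  proof -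
    have "pd k (\<lambda>z. \<Sum>m. ai z i m * a z $ m $ l) x = pd k (\<lambda>z. kron i l) x"
      by (rule pd_cong[OF _ xy]) (rule ai_a)
    then show ?thesis by (simp add: pd_sum[OF _ xy] pd_mult[OF _ _ xy] pd_const)
  qed
  have 1: "(\<Sum>m. pd k (\<lambda>z. ai z i m) x * a x $ m $ l)
      = - (\<Sum>m p. ai x i m * Gam x p m k * a x $ p $ l) - Gam x i l k" for l
  proof -
    have "(\<Sum>m. ai x i m * (\<Sum>p. Gam x p l k * a x $ m $ p)) = Gam x i l k"
    proof -
      have "(\<Sum>m. ai x i m * (\<Sum>p. Gam x p l k * a x $ m $ p))
          = (\<Sum>p. Gam x p l k * (\<Sum>m. ai x i m * a x $ m $ p))"
        unfolding sum_distrib_left by (subst sum.swap) (simp add: mult_ac)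
      then show ?thesis by (simp add: ai_a[OF x])
    qed
    then show ?thesis using 0[of l]
      by (simp add: partial_a[OF xy] sum.distrib distrib_left sum_distrib_left mult.assoc)
  qed
  have "pd k (\<lambda>z. ai z i j) x
      = (\<Sum>m. pd k (\<lambda>z. ai z i m) x * (\<Sum>l. a x $ m $ l * ai x l j))"
    by (simp add: a_ai[OF x])
  also have "\<dots> = (\<Sum>l. (\<Sum>m. pd k (\<lambda>z. ai z i m) x * a x $ m $ l) * ai x l j)"
    unfolding sum_distribs by (subst sum.swap) (simp add: mult.assoc)
  also have "\<dots> = - (\<Sum>l. (\<Sum>m p. ai x i m * Gam x p m k * a x $ p $ l) * ai x l j)
      - (\<Sum>l. Gam x i l k * ai x l j)"
    by (simp add: 1 left_diff_distrib sum_subtractf sum_negf)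
  also have "(\<Sum>l. (\<Sum>m p. ai x i m * Gam x p m k * a x $ p $ l) * ai x l j)
      = (\<Sum>m p. ai x i m * Gam x p m k * (\<Sum>l. a x $ p $ l * ai x l j))"
    unfolding sum_distribs
    by (subst sum.swap, rule sum.cong[OF refl], subst sum.swap) (simp add: mult.assoc)
  also have "\<dots> = (\<Sum>l. Gam x j l k * ai x i l)"
    by (simp add: a_ai[OF x]) (simp add: mult.commute)
  finally show ?thesis by simp
qed

section \<open>Covariant derivatives: smoothness, raising of indices, Leibniz rules\<close>

lemma smb_cov_d [intro, simp]: "(\<And>i. smb (\<lambda>x. w x i)) \<Longrightarrow> smb (\<lambda>x. cov_d a w x i k)"
  unfolding cov_d_def by (intro sm_diff sm_sum sm_mult smb_partial smb_Gam) auto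

lemma smb_raise_d [intro, simp]: "(\<And>i. smb (\<lambda>x. w x i)) \<Longrightarrow> smb (\<lambda>x. raise_d a w x i)"
  unfolding raise_d_def by (intro sm_sum sm_mult smb_ai) auto

lemma smb_raise_dd [intro, simp]: "(\<And>i j. smb (\<lambda>x. t x i j)) \<Longrightarrow> smb (\<lambda>x. raise_dd a t x i j)"
  unfolding raise_dd_def by (intro sm_sum sm_mult smb_ai) auto

lemma smb_b_d [intro, simp]: "smb (\<lambda>x. bd x i)"
  by (simp add: b_d_def)

lemma smb_b_u [intro, simp]: "smb (\<lambda>x. bu x i)"
  unfolding b_u_def by (intro smb_raise_d smb_b_d)

lemma smb_r_dd [intro, simp]: "smb (\<lambda>x. rl x i j)"
  unfolding r_dd_def by (intro sm_mult sm_add sm_const smb_cov_d smb_b_d)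

lemma smb_s_dd [intro, simp]: "smb (\<lambda>x. sl x i j)"
  unfolding s_dd_def by (intro sm_mult sm_diff sm_const smb_cov_d smb_b_d)

lemma smb_r_d [intro, simp]: "smb (\<lambda>x. rd x i)"
  unfolding r_d_def by (intro sm_sum sm_mult smb_b_u smb_r_dd)

lemma smb_s_d [intro, simp]: "smb (\<lambda>x. sd x i)"
  unfolding s_d_def by (intro sm_sum sm_mult smb_b_u smb_s_dd)

lemma smb_s_ud [intro, simp]: "smb (\<lambda>x. sud x i j)"
  unfolding s_ud_def by (intro smb_raise_dd smb_s_dd)

lemma smb_r_ud [intro, simp]: "smb (\<lambda>x. rud x i j)"
  unfolding r_ud_def by (intro smb_raise_dd smb_r_dd)

lemma cov_u_raise:
  assumes w: "\<And>i. smb (\<lambda>x. w x i)" and xy: "(x, y) \<in> Om"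
  shows "cov_u a (raise_d a w) x i k = (\<Sum>j. ai x i j * cov_d a w x j k)"
proof -
  have 1: "(\<Sum>j. (\<Sum>l. Gam x j l k * ai x i l) * w x j) = (\<Sum>j. ai x i j * (\<Sum>l. Gam x l j k * w x l))"
    unfolding sum_distribs by (subst sum.swap) (simp add: mult_ac)
  have 2: "(\<Sum>j. (\<Sum>l. Gam x i l k * ai x l j) * w x j) = (\<Sum>l. Gam x i l k * raise_d a w x l)"
    unfolding sum_distribs raise_d_def by (subst sum.swap) (simp add: mult_ac)
  have "pd k (\<lambda>z. raise_d a w z i) x
      = (\<Sum>j. ai x i j * pd k (\<lambda>z. w z j) x + pd k (\<lambda>z. ai z i j) x * w x j)"
    unfolding raise_d_def using w by (simp add: pd_sum[OF _ xy] pd_mult[OF _ _ xy])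
  then show ?thesis
    by (simp add: cov_u_def cov_d_def partial_ai[OF xy] sum.distrib left_diff_distrib right_diff_distrib
        sum_subtractf sum_negf 1 2)
qed

lemma cov_ud_raise:
  assumes t: "\<And>i j. smb (\<lambda>x. t x i j)" and xy: "(x, y) \<in> Om"
  shows "cov_ud a (raise_dd a t) x i j k = (\<Sum>l. ai x i l * cov_dd a t x l j k)"
proof -
  have 1: "(\<Sum>j'. (\<Sum>l. Gam x j' l k * ai x i l) * t x j' j) = (\<Sum>j'. ai x i j' * (\<Sum>l. Gam x l j' k * t x l j))"
    unfolding sum_distribs by (subst sum.swap) (simp add: mult_ac)
  have 2: "(\<Sum>j'. (\<Sum>l. Gam x i l k * ai x l j') * t x j' j) = (\<Sum>l. Gam x i l k * raise_dd a t x l j)"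
    unfolding sum_distribs raise_dd_def by (subst sum.swap) (simp add: mult_ac)
  have 3: "(\<Sum>l. Gam x l j k * raise_dd a t x i l) = (\<Sum>p. ai x i p * (\<Sum>l. Gam x l j k * t x p l))"
    unfolding sum_distrib_left raise_dd_def by (subst sum.swap) (simp add: mult_ac)
  have "pd k (\<lambda>z. raise_dd a t z i j) x
      = (\<Sum>l. ai x i l * pd k (\<lambda>z. t z l j) x + pd k (\<lambda>z. ai z i l) x * t x l j)"
    unfolding raise_dd_def using t by (simp add: pd_sum[OF _ xy] pd_mult[OF _ _ xy])
  then show ?thesis
    by (simp add: cov_ud_def cov_dd_def partial_ai[OF xy] sum.distrib left_diff_distrib right_diff_distrib
        sum_subtractf sum_negf 1 2 3)
qed

lemma partial_pairing:
  assumes v: "\<And>i. smb (\<lambda>x. v x i)" and w: "\<And>i. smb (\<lambda>x. w x i)" and xy: "(x, y) \<in> Om"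
  shows "pd k (\<lambda>x. \<Sum>i. v x i * w x i) x
    = (\<Sum>i. cov_u a v x i k * w x i) + (\<Sum>i. v x i * cov_d a w x i k)"
proof -
  have "(\<Sum>i. (\<Sum>l. Gam x i l k * v x l) * w x i) = (\<Sum>i. v x i * (\<Sum>l. Gam x l i k * w x l))"
    unfolding sum_distribs by (subst sum.swap) (simp add: mult_ac)
  then show ?thesis
    using v w by (simp add: pd_sum[OF _ xy] pd_mult[OF _ _ xy] cov_u_def cov_d_def sum.distrib
        distrib_right right_diff_distrib sum_subtractf)
qed

lemma partial_trace:
  assumes t: "\<And>i j. smb (\<lambda>x. t x i j)" and xy: "(x, y) \<in> Om"
  shows "pd k (\<lambda>x. \<Sum>i. t x i i) x = (\<Sum>i. cov_ud a t x i i k)"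
proof -
  have "(\<Sum>i l. Gam x i l k * t x l i) = (\<Sum>i l. Gam x l i k * t x i l)"
    by (rule sum.swap)
  then show ?thesis
    using t by (simp add: pd_sum[OF _ xy] cov_ud_def sum.distrib sum_subtractf)
qed

lemma cov_d_contract:
  assumes v: "\<And>i. smb (\<lambda>x. v x i)" and t: "\<And>i j. smb (\<lambda>x. t x i j)" and xy: "(x, y) \<in> Om"
  shows "cov_d a (\<lambda>x i. \<Sum>j. v x j * t x i j) x i k
    = (\<Sum>j. cov_u a v x j k * t x i j) + (\<Sum>j. v x j * cov_dd a t x i j k)"
proof -
  have 1: "(\<Sum>j. (\<Sum>l. Gam x j l k * v x l) * t x i j) = (\<Sum>j. v x j * (\<Sum>l. Gam x l j k * t x i l))"
    unfolding sum_distribs by (subst sum.swap) (simp add: mult_ac)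
  have 2: "(\<Sum>l. Gam x l i k * (\<Sum>j. v x j * t x l j)) = (\<Sum>j. v x j * (\<Sum>l. Gam x l i k * t x l j))"
    unfolding sum_distrib_left by (subst sum.swap) (simp add: mult_ac)
  show ?thesis
    using v t 1 2 by (simp add: pd_sum[OF _ xy] pd_mult[OF _ _ xy] cov_u_def cov_d_def cov_dd_def sum.distrib
        distrib_right right_diff_distrib sum_subtractf)
qed

lemma r_sym: "rl x i j = rl x j i"
  by (simp add: r_dd_def)

lemma s_skew: "sl x i j = - sl x j i"
  unfolding s_dd_def by (simp only: mult_minus_right[symmetric] minus_diff_eq)

lemma cov_b: "Dbd x i k = rl x i k + sl x i k"
  by (simp add: r_dd_def s_dd_def field_simps)

lemma cov_bu: "(x, y) \<in> Om \<Longrightarrow> Dbu x i k = rud x i k + sud x i k"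
  unfolding b_u_def using cov_u_raise[of "bd" x y i k]
  by (simp add: cov_b r_ud_def s_ud_def raise_dd_def distrib_left sum.distrib)

section \<open>Horizontal and vertical derivatives on phase space\<close>

definition "N x y i k = (\<Sum>j. Gam x i k j * y $ j)"

text \<open>The derivative along the vector with base component \<open>u\<close> and vertical component \<open>w\<close>
  in the splitting of the tangent bundle defined by the Levi-Civita connection of \<open>\<alpha>\<close>.\<close>

definition "hv u w f x y = dv u (\<lambda>i. w i - (\<Sum>k. N x y i k * u k)) f x y"

lemma dy_hv: "dy j f x y = hv (\<lambda>_. 0) (kron j) f x y"
  by (simp add: hv_def dy_dv)

lemmas hv_add = dv_add[where v="\<lambda>i. w i - (\<Sum>k. N x y i k * u k)" and u=u and x=x and y=y for x y w u, folded hv_def]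
lemmas hv_diff = dv_diff[where v="\<lambda>i. w i - (\<Sum>k. N x y i k * u k)" and u=u and x=x and y=y for x y w u, folded hv_def]
lemmas hv_mult = dv_mult[where v="\<lambda>i. w i - (\<Sum>k. N x y i k * u k)" and u=u and x=x and y=y for x y w u, folded hv_def]
lemmas hv_sum = dv_sum[where v="\<lambda>i. w i - (\<Sum>k. N x y i k * u k)" and u=u and x=x and y=y for x y w u, folded hv_def]
lemmas hv_inverse = dv_inverse[where v="\<lambda>i. w i - (\<Sum>k. N x y i k * u k)" and u=u and x=x and y=y for x y w u, folded hv_def]
lemmas hv_cong = dv_cong[where v="\<lambda>i. w i - (\<Sum>k. N x y i k * u k)" and u=u and x=x and y=y for x y w u, folded hv_def]
lemmas hv_cdivide = dv_cdivide[where v="\<lambda>i. w i - (\<Sum>k. N x y i k * u k)" and u=u and x=x and y=y for x y w u, folded hv_def]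

lemma hv_const: "hv u w (\<lambda>x y. c) x y = 0"
  by (simp add: hv_def dv_const)

lemma hv_coord: "hv u w (\<lambda>x y. y $ i) x y = w i - (\<Sum>k. N x y i k * u k)"
  by (simp add: hv_def dv_coord)

lemma hv_base: "smb f \<Longrightarrow> (x, y) \<in> Om \<Longrightarrow> hv u w (\<lambda>x y. f x) x y = (\<Sum>k. pd k f x * u k)"
  by (simp add: hv_def dv_dx_dy) (simp add: dx_def mult.commute)

text \<open>The horizontal derivative of y^i is -N^i_k u^k, which supplies just the Christoffel
  terms that turn the partial derivative of t_i into the covariant one. The same happens for both
  indices in \<open>hv_quadratic\<close>.\<close>

lemma hv_linear:
  assumes t: "\<And>i. smb (\<lambda>x. t x i)" and xy: "(x, y) \<in> Om"
  shows "hv u w (\<lambda>x y. \<Sum>i. t x i * y $ i) x y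
    = (\<Sum>i k. cov_d a t x i k * y $ i * u k) + (\<Sum>i. t x i * w i)"
proof -
  have "(\<Sum>i. t x i * (\<Sum>k. N x y i k * u k))
      = (\<Sum>i k j. t x i * Gam x i k j * y $ j * u k)"
    by (simp add: N_def sum_distribs mult.assoc)
  also have "\<dots> = (\<Sum>i j k. t x i * Gam x i j k * y $ j * u k)"
    by (rule sum.cong[OF refl], subst sum.swap) (simp add: Gam_sym[OF xy])
  also have "\<dots> = (\<Sum>j k. (\<Sum>i. Gam x i j k * t x i) * y $ j * u k)"
    unfolding sum_distrib_right
    by (subst sum.swap, rule sum.cong[OF refl], subst sum.swap) (simp add: mult_ac)
  finally have 1: "(\<Sum>i. t x i * (\<Sum>k. N x y i k * u k)) = \<dots>" .
  have "hv u w (\<lambda>x y. \<Sum>i. t x i * y $ i) x y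
    = (\<Sum>i. t x i * (w i - (\<Sum>k. N x y i k * u k)) + (\<Sum>k. pd k (\<lambda>x. t x i) x * u k) * y $ i)"
    using t xy by (simp add: hv_sum hv_mult hv_coord hv_base)
  then show ?thesis
    by (simp add: right_diff_distrib sum.distrib sum_subtractf 1 cov_d_def left_diff_distrib)
      (simp add: sum_distribs mult_ac)
qed

lemma hv_quadratic:
  assumes t: "\<And>i j. smb (\<lambda>x. t x i j)" and xy: "(x, y) \<in> Om"
  shows "hv u w (\<lambda>x y. \<Sum>i j. t x i j * y $ i * y $ j) x y
    = (\<Sum>i j k. cov_dd a t x i j k * y $ i * y $ j * u k)
      + (\<Sum>i j. t x i j * (w i * y $ j + y $ i * w j))"
proof -
  define q where "q i = (\<Sum>k. N x y i k * u k)" for i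
  have 1: "(\<Sum>i j. t x i j * q i * y $ j)
      = (\<Sum>i j k. (\<Sum>l. Gam x l i k * t x l j) * y $ i * y $ j * u k)"
  proof -
    have "(\<Sum>i j. t x i j * q i * y $ j)
        = (\<Sum>i j. \<Sum>k l. Gam x i l k * t x i j * y $ l * y $ j * u k)"
      by (simp add: q_def N_def sum_distribs Gam_sym[OF xy] mult_ac)
    also have "\<dots> = (\<Sum>j k. \<Sum>l i. Gam x i l k * t x i j * y $ l * y $ j * u k)"
      by (subst sum.swap, rule sum.cong[OF refl], subst sum.swap, rule sum.cong[OF refl], subst sum.swap) simp
    also have "\<dots> = (\<Sum>j l. \<Sum>k i. Gam x i l k * t x i j * y $ l * y $ j * u k)"
      by (rule sum.cong[OF refl], subst sum.swap) simp
    also have "\<dots> = (\<Sum>l j. \<Sum>k i. Gam x i l k * t x i j * y $ l * y $ j * u k)"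
      by (subst sum.swap) simp
    finally show ?thesis by (simp add: sum_distrib_right)
  qed
  have 2: "(\<Sum>i j. t x i j * y $ i * q j)
      = (\<Sum>i j k. (\<Sum>l. Gam x l j k * t x i l) * y $ i * y $ j * u k)"
  proof -
    have "(\<Sum>i j. t x i j * y $ i * q j)
        = (\<Sum>i j. \<Sum>k l. Gam x j l k * t x i j * y $ i * y $ l * u k)"
      by (simp add: q_def N_def sum_distribs Gam_sym[OF xy] mult_ac)
    also have "\<dots> = (\<Sum>i k. \<Sum>l j. Gam x j l k * t x i j * y $ i * y $ l * u k)"
      by (rule sum.cong[OF refl], subst sum.swap, rule sum.cong[OF refl], subst sum.swap) simp
    also have "\<dots> = (\<Sum>i l. \<Sum>k j. Gam x j l k * t x i j * y $ i * y $ l * u k)"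
      by (rule sum.cong[OF refl], subst sum.swap) simp
    finally show ?thesis by (simp add: sum_distrib_right)
  qed
  have "hv u w (\<lambda>x y. \<Sum>i j. t x i j * y $ i * y $ j) x y
    = (\<Sum>i j. t x i j * y $ i * (w j - q j)
        + (t x i j * (w i - q i) + (\<Sum>k. pd k (\<lambda>x. t x i j) x * u k) * y $ i) * y $ j)"
    using t xy by (simp add: hv_sum hv_mult hv_coord hv_base q_def)
  also have "\<dots> = (\<Sum>i j k. pd k (\<lambda>x. t x i j) x * y $ i * y $ j * u k)
      + (\<Sum>i j. t x i j * (w i * y $ j + y $ i * w j))
      - (\<Sum>i j. t x i j * q i * y $ j) - (\<Sum>i j. t x i j * y $ i * q j)"
    by (simp add: sum.distrib sum_subtractf algebra_simps sum_distribs)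
  finally show ?thesis
    unfolding 1 2 cov_dd_def by (simp add: left_diff_distrib sum_subtractf)
qed

lemma hv_a: "(x, y) \<in> Om \<Longrightarrow> hv u w (\<lambda>x y. \<Sum>i j. a x $ i $ j * y $ i * y $ j) x y
    = 2 * (\<Sum>i. (\<Sum>j. a x $ i $ j * y $ j) * w i)"
proof -
  assume xy: "(x, y) \<in> Om"
  have 0: "cov_dd a (\<lambda>x i j. a x $ i $ j) x i j k = 0" for i j k
    by (simp add: cov_dd_def partial_a[OF xy])
  have "(\<Sum>i j. a x $ i $ j * (y $ i * w j)) = (\<Sum>j i. a x $ j $ i * (y $ i * w j))"
    by (subst sum.swap) (simp add: sym_a[OF Om_S[OF xy]])
  then show ?thesis
    using hv_quadratic[of "\<lambda>x i j. a x $ i $ j" x y u w] xy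
    by (simp add: 0 distrib_left sum.distrib) (simp add: sum_distrib_left mult_ac)
qed

end

section \<open>The Ricci curvature of a perturbed spray\<close>

locale perturbed_spray = kropina_chart S a b
  for S :: "(real^'n::finite) set" and a :: "real^'n \<Rightarrow> real^'n^'n" and b :: "real^'n \<Rightarrow> real^'n" +
  fixes T :: "'n \<Rightarrow> real^'n \<Rightarrow> real^'n \<Rightarrow> real"
  assumes sm_T [intro, simp]: "sm (T i)"
begin

definition "A i x y = (\<Sum>j k. Gam x i j k * y $ j * y $ k) / 2"

definition "G i x y = A i x y + T i x y"

definition "Q x y = (\<Sum>m. dy m (T m) x y)"

text \<open>The covariant divergence T^m_{|m}: \<open>hv\<close> differentiates each component along
  the horizontal lift, and the Christoffel term accounts for the free index.\<close>

definition "divT x y = (\<Sum>m. hv (kron m) (\<lambda>_. 0) (T m) x y) + (\<Sum>m k. Gam x m m k * T k x y)"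

lemma sm_A [intro, simp]: "sm (A i)"
  unfolding A_def[abs_def] by (intro sm_cdivide sm_sum sm_mult smb_Gam sm_coord)

sublocale spray Om G
  by unfold_locales (auto simp: G_def[abs_def])

lemma sm_N [intro, simp]: "sm (\<lambda>x y. N x y i k)"
  unfolding N_def by (intro sm_sum sm_mult smb_Gam sm_coord)

lemma sm_Q [intro, simp]: "sm Q"
  unfolding Q_def[abs_def] by (intro sm_sum sm_dy sm_T)

lemma A_N: "(x, y) \<in> Om \<Longrightarrow> 2 * A i x y = (\<Sum>k. N x y i k * y $ k)"
  by (simp add: A_def N_def sum_distribs mult_ac)

lemma vf_hv: "(x, y) \<in> Om \<Longrightarrow> vf f x y = hv (\<lambda>i. y $ i) (\<lambda>i. - 2 * T i x y) f x y"
proof -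
  assume xy: "(x, y) \<in> Om"
  have "(\<lambda>i. - 2 * G i x y) = (\<lambda>i. - 2 * T i x y - (\<Sum>k. N x y i k * y $ k))"
    using A_N[OF xy] by (simp add: G_def fun_eq_iff algebra_simps)
  then show ?thesis by (simp add: spray_vf_def hv_def)
qed

lemma dy_A: "(x, y) \<in> Om \<Longrightarrow> dy j (A i) x y = N x y i j"
proof -
  assume xy: "(x, y) \<in> Om"
  have 1: "(\<Sum>p k. Gam x i p k * y $ p * kron j k) = N x y i j"
    by (simp add: N_def Gam_sym[OF xy, of i j])
  have 2: "(\<Sum>p k. Gam x i p k * kron j p * y $ k) = N x y i j"
    by (subst sum.swap) (simp add: N_def mult.assoc mult.left_commute[of _ "kron _ _"])
  have "dy j (A i) x y = (\<Sum>p k. Gam x i p k * y $ p * kron j k + Gam x i p k * kron j p * y $ k) / 2"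
    unfolding A_def[abs_def] using xy by (simp add: dy_cdivide dy_sum dy_mult dy_coord)
  then show ?thesis unfolding sum.distrib 1 2 by simp
qed

lemma dy_G: "(x, y) \<in> Om \<Longrightarrow> dy j (G i) x y = N x y i j + dy j (T i) x y"
  unfolding G_def[abs_def] by (simp add: dy_add dy_A)

lemma spray_div_G: "(x, y) \<in> Om \<Longrightarrow> spray_div G x y = (\<Sum>m. N x y m m) + Q x y"
  by (simp add: spray_div_def dy_G Q_def sum.distrib)

lemma dx_hv: "sm f \<Longrightarrow> (x, y) \<in> Om \<Longrightarrow>
    dx m f x y = hv (kron m) (\<lambda>_. 0) f x y + (\<Sum>l. N x y l m * dy l f x y)"
  by (simp add: hv_def dv_dx_dy sum_negf)

lemma vf_trace_N:
  assumes xy: "(x, y) \<in> Om"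
  shows "vf (\<lambda>x y. \<Sum>m. N x y m m) x y =
    (\<Sum>m i j. pd j (\<lambda>x. Gam x m i m) x * y $ i * y $ j)
    - 2 * (\<Sum>m k. Gam x m m k * G k x y)"
proof -
  have 1: "dx j (\<lambda>x y. \<Sum>m. N x y m m) x y = (\<Sum>m i. pd j (\<lambda>x. Gam x m i m) x * y $ i)" for j
  proof -
    have d: "dx j (\<lambda>x y. \<Sum>m. N x y m m) x y = (\<Sum>m i. pd j (\<lambda>x. Gam x m m i) x * y $ i)"
      unfolding N_def using xy by (simp add: dx_sum dx_mult) (simp add: dx_def)
    have c: "pd j (\<lambda>x. Gam x m m i) x = pd j (\<lambda>x. Gam x m i m) x" for m i
      using dx_cong[of "\<lambda>x y. Gam x m m i" "\<lambda>x y. Gam x m i m", OF Gam_sym xy] by (simp add: dx_def)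
    show ?thesis unfolding d by (intro sum.cong refl arg_cong2[where f="(*)"] c)
  qed
  have 2: "dy k (\<lambda>x y. \<Sum>m. N x y m m) x y = (\<Sum>m. Gam x m m k)" for k
    unfolding N_def using xy by (simp add: dy_sum dy_mult dy_coord)
  have 3: "(\<Sum>j. y $ j * (\<Sum>m i. pd j (\<lambda>x. Gam x m i m) x * y $ i))
      = (\<Sum>m i j. pd j (\<lambda>x. Gam x m i m) x * y $ i * y $ j)"
    unfolding sum_distrib_left
    by (subst sum.swap, rule sum.cong[OF refl], subst sum.swap) (simp add: mult_ac)
  have 4: "(\<Sum>k. G k x y * (\<Sum>m. Gam x m m k)) = (\<Sum>m k. Gam x m m k * G k x y)"
    unfolding sum_distrib_left by (subst sum.swap) (simp add: mult_ac)
  show ?thesis using xy by (simp add: vf_expand 1 2 3 4)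
qed

text \<open>\<open>A\<close> is the spray of \<alpha> and \<open>N\<close> its fibre derivative, so
  this is the spray expression of the Ricci curvature of \<alpha>. Its derivative terms are indexed
  so as to match \<open>vf_trace_N\<close>.\<close>

lemma alpha_ric:
  assumes xy: "(x, y) \<in> Om"
  shows "(\<Sum>i j. Ric x i j * y $ i * y $ j) =
    (\<Sum>m i j. pd m (\<lambda>x. Gam x m i j) x * y $ i * y $ j)
    - (\<Sum>m i j. pd j (\<lambda>x. Gam x m i m) x * y $ i * y $ j)
    + 2 * (\<Sum>m k. Gam x m m k * A k x y)
    - (\<Sum>m k. N x y m k * N x y k m)"
proof -
  have s: "(\<Sum>i j. (\<Sum>m. f m i j) * y $ i * y $ j)
      = (\<Sum>m i j. f m i j * y $ i * y $ j)" for f :: "'n \<Rightarrow> 'n \<Rightarrow> 'n \<Rightarrow> real"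
  proof -
    have "(\<Sum>i j. (\<Sum>m. f m i j) * y $ i * y $ j)
        = (\<Sum>i m j. f m i j * y $ i * y $ j)"
      unfolding sum_distrib_right by (rule sum.cong[OF refl], rule sum.swap)
    then show ?thesis by (subst (asm) sum.swap)
  qed
  have 1: "(\<Sum>m i j. (\<Sum>k. Gam x m m k * Gam x k i j) * y $ i * y $ j)
      = 2 * (\<Sum>m k. Gam x m m k * A k x y)"
  proof -
    have "2 * (\<Sum>m k. Gam x m m k * A k x y) = (\<Sum>m k. Gam x m m k * (2 * A k x y))"
      by (simp add: sum_distrib_left mult_ac)
    moreover have "2 * A k x y = (\<Sum>i j. Gam x k i j * y $ i * y $ j)" for k
      by (simp add: A_def)
    ultimately show ?thesis unfolding s by (simp add: sum_distribs mult.assoc)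
  qed
  have "(\<Sum>i j. Gam x m j k * Gam x k i m * y $ i * y $ j) = N x y m k * N x y k m" for m k
    unfolding N_def sum_distribs
    by (simp add: Gam_sym[OF xy, of m _ k] Gam_sym[OF xy, of k _ m] mult_ac)
  then have 2: "(\<Sum>m i j. (\<Sum>k. Gam x m j k * Gam x k i m) * y $ i * y $ j)
      = (\<Sum>m k. N x y m k * N x y k m)"
    unfolding s by simp
  show ?thesis
    unfolding riemann_ricci_def s riemann_curv_def
    by (simp add: left_diff_distrib distrib_right sum_subtractf sum.distrib 1 2)
qed

text \<open>The terms in \<open>A\<close> and \<open>N\<close> alone form the Ricci curvature of
  \<alpha>. The mixed products of \<open>N\<close> with dT/dy from the base derivatives and from the
  quadratic term cancel, and the products of Christoffel symbols with T complete the divergence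
  \<open>divT\<close>. The derivative of \<open>Q\<close> is along the full spray.\<close>

lemma spray_ric_G:
  assumes xy: "(x, y) \<in> Om"
  shows "spray_ric G x y = (\<Sum>i j. Ric x i j * y $ i * y $ j)
    + 2 * divT x y - vf Q x y - (\<Sum>m j. dy j (T m) x y * dy m (T j) x y)"
proof -
  have dv: "vf (spray_div G) x y = vf (\<lambda>x y. \<Sum>m. N x y m m) x y + vf Q x y"
  proof -
    have "vf (spray_div G) x y = vf (\<lambda>x y. (\<Sum>m. N x y m m) + Q x y) x y"
      by (rule vf_cong[OF spray_div_G xy])
    also have "\<dots> = vf (\<lambda>x y. \<Sum>m. N x y m m) x y + vf Q x y"
      using xy by (intro vf_add) auto
    finally show ?thesis .
  qed
  have dvs: "(\<Sum>m. vf (dy m (G m)) x y) = vf (spray_div G) x y"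
    unfolding spray_div_def[abs_def] using xy by (simp add: vf_sum)
  have dA: "(\<Sum>m. dx m (A m) x y)
      = 1/2 * (\<Sum>m i j. pd m (\<lambda>x. Gam x m i j) x * y $ i * y $ j)"
  proof -
    have "dx m (A m) x y = (\<Sum>i j. pd m (\<lambda>x. Gam x m i j) x * y $ i * y $ j) / 2" for m
    proof -
      have "dx m (A m) x y = dv (kron m) (\<lambda>_. 0) (\<lambda>x y. (\<Sum>i j. Gam x m i j * y $ i * y $ j) / 2) x y"
        by (simp add: A_def[abs_def] dx_dv)
      also have "\<dots> = (\<Sum>i j. dx m (\<lambda>x y. Gam x m i j) x y * y $ i * y $ j) / 2"
        using xy by (simp add: dv_cdivide dv_sum dv_mult dv_coord dx_dv)
      finally show ?thesis by (simp add: dx_def)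
    qed
    then show ?thesis by (simp add: sum_divide_distrib)
  qed
  have dG: "(\<Sum>m. dx m (G m) x y) = (\<Sum>m. dx m (A m) x y)
      + (\<Sum>m. hv (kron m) (\<lambda>_. 0) (T m) x y) + (\<Sum>m l. N x y l m * dy l (T m) x y)"
    unfolding G_def[abs_def] using xy by (simp add: dx_add dx_hv[of "T m" for m] sum.distrib)
  have sw: "(\<Sum>m l. N x y l m * dy l (T m) x y) = (\<Sum>m l. N x y m l * dy m (T l) x y)"
    by (rule sum.swap)
  have GG: "(\<Sum>m j. dy j (G m) x y * dy m (G j) x y)
      = (\<Sum>m j. N x y m j * N x y j m) + 2 * (\<Sum>m l. N x y m l * dy m (T l) x y)
        + (\<Sum>m j. dy j (T m) x y * dy m (T j) x y)"
    using xy by (simp add: dy_G distrib_left distrib_right sum.distrib) (subst sum.swap, simp add: mult.commute)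
  have "spray_ric G x y = 2 * (\<Sum>m. dx m (G m) x y) - vf (spray_div G) x y
      - (\<Sum>m j. dy j (G m) x y * dy m (G j) x y)"
    unfolding spray_ric_def using xy by (simp add: spray_riem_vf sum_subtractf sum_distrib_left[symmetric] dvs)
  moreover have "(\<Sum>m k. Gam x m m k * G k x y)
      = (\<Sum>m k. Gam x m m k * A k x y) + (\<Sum>m k. Gam x m m k * T k x y)"
    by (simp add: G_def distrib_left sum.distrib)
  ultimately show ?thesis
    unfolding alpha_ric[OF xy] dv dG dA vf_trace_N[OF xy] GG divT_def sw by (simp add: algebra_simps)
qed

end

section \<open>The spray of a Kropina metric\<close>

text \<open>Contractions are written as pairings of component functions, so that linearity becomes
  rewriting and each contraction is reduced to a table of basic ones.\<close>

definition dot :: "('n::finite \<Rightarrow> real) \<Rightarrow> ('n \<Rightarrow> real) \<Rightarrow> real" where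
  "dot f g = (\<Sum>i. f i * g i)"

lemma dot_commute: "dot f g = dot g f"
  by (simp add: dot_def mult.commute)

lemma dot_linear [simp]:
  "dot f (\<lambda>i. g i + h i) = dot f g + dot f h" "dot (\<lambda>i. g i + h i) f = dot g f + dot h f"
  "dot f (\<lambda>i. g i - h i) = dot f g - dot f h" "dot (\<lambda>i. g i - h i) f = dot g f - dot h f"
  "dot f (\<lambda>i. c * g i) = c * dot f g" "dot (\<lambda>i. c * g i) f = c * dot g f"
  "dot f (\<lambda>i. g i * c) = dot f g * c" "dot (\<lambda>i. g i * c) f = dot g f * c"
  "dot f (\<lambda>i. g i / c) = dot f g / c" "dot (\<lambda>i. g i / c) f = dot g f / c"
  "dot f (\<lambda>i. - g i) = - dot f g" "dot (\<lambda>i. - g i) f = - dot g f"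
  "dot f (\<lambda>i. 0) = 0" "dot (\<lambda>i. 0) f = 0"
  "dot f (kron j) = f j" "dot (kron j) f = f j"
  by (simp_all add: dot_def distrib_left distrib_right left_diff_distrib right_diff_distrib sum.distrib
      sum_subtractf sum_distribs sum_divide_distrib sum_negf mult_ac)

context kropina_chart
begin

text \<open>Here \<open>be\<close>, \<open>Al\<close>, \<open>Fk\<close>, \<open>Ek\<close>, \<open>ib\<close> are \<open>\<beta>\<close>, \<open>\<alpha>\<^sup>2\<close>, \<open>F\<close>, \<open>1/F\<close>, \<open>1/b\<^sup>2\<close>, and \<open>yl\<close>, \<open>rd0\<close>, \<open>sd0\<close>, \<open>sg\<close> are
  \<open>a\<^sub>i\<^sub>j y\<^sup>j\<close>, \<open>r\<^sub>i\<^sub>0\<close>, \<open>s\<^sub>i\<^sub>0\<close>, \<open>s\<^sup>i\<^sub>0\<close>. A \<open>D\<close> in front of \<open>r\<close>, \<open>s\<close> is a covariant derivative, and a final \<open>0\<close>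
  is a contraction with \<open>y\<close>.\<close>

definition "Al x y = (\<Sum>i j. a x $ i $ j * y $ i * y $ j)"
definition "Fk x y = Al x y * inverse (be x y)"
definition "Ek x y = be x y * inverse (Al x y)"
definition "b2 x = (\<Sum>i. bu x i * bd x i)"
definition "ib x = inverse (b2 x)"
definition "R0 x y = (\<Sum>i. rd x i * y $ i)"
definition "S0 x y = (\<Sum>i. sd x i * y $ i)"
definition "R00 x y = (\<Sum>i j. rl x i j * y $ i * y $ j)"
definition "rs x = (\<Sum>i. bu x i * rd x i)"
definition "tr x = (\<Sum>i. rud x i i)"
definition "U x y = (S0 x y + R00 x y * Ek x y) * ib x"

definition "yl x y i = (\<Sum>j. a x $ i $ j * y $ j)"
definition "rd0 x y i = (\<Sum>j. rl x i j * y $ j)"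
abbreviation "ru0 x y \<equiv> raise_d a (\<lambda>_. rd0 x y) x"
definition "sd0 x y i = (\<Sum>j. sl x i j * y $ j)"
definition "sg x y i = (\<Sum>j. sud x i j * y $ j)"
definition "Dr0 x y k = (\<Sum>i. Drd x i k * y $ i)"
definition "Ds0 x y k = (\<Sum>i. Dsd x i k * y $ i)"
definition "Dr00 x y k = (\<Sum>i j. Drdd x i j k * y $ i * y $ j)"

section \<open>Contractions of the tensors built from \<beta>\<close>

lemma raise_dot: "x \<in> S \<Longrightarrow> dot (raise_d a v x) (w x) = dot (v x) (raise_d a w x)"
proof -
  assume x: "x \<in> S"
  have "dot (raise_d a v x) (w x) = (\<Sum>i j. ai x i j * v x j * w x i)"
    by (simp add: dot_def raise_d_def sum_distribs mult_ac)
  also have "\<dots> = (\<Sum>i j. ai x i j * v x i * w x j)"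
    by (subst sum.swap) (simp add: ai_sym[OF x] mult_ac)
  finally show ?thesis by (simp add: dot_def raise_d_def sum_distrib_left mult_ac)
qed

lemma sg_raise: "sg x y = raise_d a (\<lambda>x. sd0 x y) x"
proof
  fix i
  show "sg x y i = raise_d a (\<lambda>x. sd0 x y) x i"
    unfolding sg_def raise_d_def sd0_def s_ud_def raise_dd_def sum_distribs
    by (subst sum.swap) (simp add: mult_ac)
qed

lemma raise_yl: "x \<in> S \<Longrightarrow> raise_d a (\<lambda>x. yl x y) x i = y $ i"
proof -
  assume x: "x \<in> S"
  have "raise_d a (\<lambda>x. yl x y) x i = (\<Sum>j. (\<Sum>k. ai x i k * a x $ k $ j) * y $ j)"
    unfolding raise_d_def yl_def sum_distribs by (subst sum.swap) (simp add: mult_ac)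
  then show ?thesis by (simp add: ai_a[OF x])
qed

lemma lower_bu: "x \<in> S \<Longrightarrow> (\<Sum>j. a x $ i $ j * raise_d a w x j) = w x i"
proof -
  assume x: "x \<in> S"
  have "(\<Sum>j. a x $ i $ j * raise_d a w x j) = (\<Sum>j. (\<Sum>k. a x $ i $ k * ai x k j) * w x j)"
    unfolding raise_d_def sum_distribs by (subst sum.swap) (simp add: mult_ac)
  then show ?thesis by (simp add: a_ai[OF x])
qed

lemma skew_form: "(\<Sum>i. v i * (\<Sum>j. sl x i j * w j)) = - (\<Sum>i. w i * (\<Sum>j. sl x i j * v j))"
proof -
  have "(\<Sum>i. v i * (\<Sum>j. sl x i j * w j)) = (\<Sum>j i. v i * sl x i j * w j)"
    unfolding sum_distrib_left by (subst sum.swap) (simp add: mult_ac)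
  also have "\<dots> = (\<Sum>j i. - (w j * sl x j i * v i))"
    by (intro sum.cong refl) (subst s_skew, simp add: mult_ac)
  finally show ?thesis by (simp add: sum_distrib_left sum_negf mult_ac)
qed

lemma skew_form_self: "(\<Sum>i. v i * (\<Sum>j. sl x i j * v j)) = 0"
  using skew_form[of v x v] by linarith

lemma sym_form: "(\<Sum>i. v i * (\<Sum>j. rl x i j * w j)) = (\<Sum>i. w i * (\<Sum>j. rl x i j * v j))"
proof -
  have "(\<Sum>i. v i * (\<Sum>j. rl x i j * w j)) = (\<Sum>j i. v i * rl x i j * w j)"
    unfolding sum_distrib_left by (subst sum.swap) (simp add: mult_ac)
  also have "\<dots> = (\<Sum>j i. w j * rl x j i * v i)"
    by (intro sum.cong refl) (subst r_sym, simp add: mult_ac)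
  finally show ?thesis by (simp add: sum_distrib_left mult_ac)
qed

lemma sd_alt: "sd x i = - (\<Sum>j. sl x i j * bu x j)"
  unfolding s_d_def sum_negf[symmetric] by (intro sum.cong refl) (subst s_skew, simp)

lemma rd_alt: "rd x i = (\<Sum>j. rl x i j * bu x j)"
  by (simp add: r_d_def mult.commute)

lemma sud_skew: "x \<in> S \<Longrightarrow> (\<Sum>m. sud x m m) = 0"
proof -
  assume x: "x \<in> S"
  have 1: "(\<Sum>m. sud x m m) = (\<Sum>m k. ai x m k * sl x k m)"
    by (simp add: s_ud_def raise_dd_def)
  also have "\<dots> = (\<Sum>m k. - (ai x m k * sl x k m))"
    by (subst sum.swap, intro sum.cong refl) (subst s_skew, simp add: ai_sym[OF x])
  also have "\<dots> = - (\<Sum>m. sud x m m)" unfolding 1 by (simp add: sum_negf)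
  finally show ?thesis by linarith
qed

text \<open>The pairings among y, b, s^i_0, s^i and the 1-forms in use. The zeros come from the
  skewness of s_{ij}.\<close>

lemma dot_table:
  assumes xy: "(x, y) \<in> Om"
  shows "dot (bd x) (($) y) = be x y" "dot (bd x) (bu x) = b2 x" "dot (bd x) (sg x y) = S0 x y"
    "dot (yl x y) (($) y) = Al x y" "dot (yl x y) (bu x) = be x y" "dot (yl x y) (sg x y) = 0"
    "dot (rd x) (($) y) = R0 x y" "dot (rd x) (bu x) = rs x"
    "dot (sd x) (($) y) = S0 x y" "dot (sd x) (bu x) = 0"
    "dot (rd0 x y) (($) y) = R00 x y" "dot (rd0 x y) (bu x) = R0 x y"
    "dot (sd0 x y) (($) y) = 0" "dot (sd0 x y) (bu x) = S0 x y"
    "dot (bd x) (su x) = 0" "dot (yl x y) (su x) = S0 x y"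
proof -
  note x = Om_S[OF xy]
  show 1: "dot (bd x) (($) y) = be x y" by (simp add: dot_def beta_form_def b_d_def)
  show "dot (bd x) (bu x) = b2 x" by (simp add: dot_def b2_def mult.commute)
  show sb: "dot (sd0 x y) (bu x) = S0 x y"
  proof -
    have "dot (sd0 x y) (bu x) = (\<Sum>i. bu x i * (\<Sum>j. sl x i j * y $ j))"
      by (simp add: dot_def sd0_def mult.commute)
    also have "\<dots> = - (\<Sum>i. y $ i * (\<Sum>j. sl x i j * bu x j))" by (rule skew_form)
    finally show ?thesis by (simp add: S0_def sd_alt sum_negf mult.commute)
  qed
  show "dot (bd x) (sg x y) = S0 x y"
    using raise_dot[OF x, of "bd" "\<lambda>x. sd0 x y"] sb by (simp add: sg_raise b_u_def dot_commute)
  show "dot (yl x y) (($) y) = Al x y"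
    by (simp add: dot_def yl_def Al_def sum_distrib_left mult_ac)
  have ry: "raise_d a (\<lambda>x. yl x y) x = ($) y" using raise_yl[OF x] by auto
  show "dot (yl x y) (bu x) = be x y"
    using raise_dot[OF x, of "\<lambda>x. yl x y" "bd"] 1 by (simp add: ry b_u_def dot_commute)
  show s0: "dot (sd0 x y) (($) y) = 0"
    using skew_form_self[of "($) y" x] by (simp add: dot_def sd0_def mult.commute)
  show "dot (yl x y) (sg x y) = 0"
    using raise_dot[OF x, of "\<lambda>x. yl x y" "\<lambda>x. sd0 x y"] s0 by (simp add: ry sg_raise dot_commute)
  show "dot (rd x) (($) y) = R0 x y" "dot (sd x) (($) y) = S0 x y"
    by (simp_all add: dot_def R0_def S0_def)
  show "dot (rd x) (bu x) = rs x" by (simp add: dot_def rs_def mult.commute)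
  show sdb: "dot (sd x) (bu x) = 0"
    using skew_form_self[of "bu x" x] by (simp add: dot_def sd_alt sum_negf mult.commute)
  show "dot (rd0 x y) (($) y) = R00 x y"
    by (simp add: dot_def rd0_def R00_def sum_distribs mult_ac)
  show "dot (rd0 x y) (bu x) = R0 x y"
    using sym_form[of "bu x" x "($) y"] by (simp add: dot_def rd0_def R0_def rd_alt mult.commute)
  show "dot (bd x) (su x) = 0"
    using raise_dot[OF x, of "bd" "sd"] sdb by (simp add: s_u_def b_u_def dot_commute)
  show "dot (yl x y) (su x) = S0 x y"
    using raise_dot[OF x, of "\<lambda>x. yl x y" "sd"] by (simp add: ry s_u_def dot_def S0_def mult.commute)
qed

section \<open>Positivity and smoothness of the basic scalars\<close>

lemma be_pos: "(x, y) \<in> Om \<Longrightarrow> be x y > 0"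
  by (simp add: Om_def)

lemma Al_inner: "Al x y = y \<bullet> (a x *v y)"
  by (simp add: Al_def inner_vec_def matrix_vector_mult_def sum_distrib_left mult_ac)

lemma Al_pos: "(x, y) \<in> Om \<Longrightarrow> Al x y > 0"
proof -
  assume xy: "(x, y) \<in> Om"
  have "y \<noteq> 0" using be_pos[OF xy] by (auto simp: beta_form_def)
  then show ?thesis using pos_a[OF Om_S[OF xy]] by (simp add: Al_inner)
qed

lemma b2_pos: "x \<in> S \<Longrightarrow> b2 x > 0"
proof -
  assume x: "x \<in> S"
  define v where "v = (\<chi> i. bu x i)"
  have av: "a x *v v = b x"
    using lower_bu[OF x, of _ "bd"]
    by (simp add: v_def b_u_def vec_eq_iff matrix_vector_mult_def b_d_def)
  then have "v \<noteq> 0" using b_nz[OF x] by auto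
  from pos_a[OF x this] show ?thesis
    by (simp add: av) (simp add: v_def inner_vec_def b2_def b_d_def)
qed

lemma nz:
  assumes "(x, y) \<in> Om"
  shows "be x y \<noteq> 0" "Al x y \<noteq> 0" "b2 x \<noteq> 0" "Fk x y * Ek x y = 1" "b2 x * ib x = 1"
    "Al x y = Fk x y * be x y" "U x y * b2 x = S0 x y + R00 x y * Ek x y" "Fk x y \<noteq> 0"
  using be_pos[OF assms] Al_pos[OF assms] b2_pos[OF Om_S[OF assms]]
  by (auto simp: Fk_def Ek_def ib_def U_def field_simps)

lemma sm_scalars [intro, simp]:
  "sm be" "sm Al" "sm Fk" "sm Ek" "smb b2" "smb ib" "sm R0" "sm S0" "sm R00" "smb rs" "smb tr" "sm U"
  "sm (\<lambda>x y. yl x y i)" "sm (\<lambda>x y. rd0 x y i)" "sm (\<lambda>x y. sd0 x y i)" "sm (\<lambda>x y. sg x y i)"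
proof -
  show be: "sm be" unfolding beta_form_def[abs_def] by (intro sm_sum sm_mult smb_b sm_coord)
  show Al: "sm Al" unfolding Al_def[abs_def] by (intro sm_sum sm_mult smb_a sm_coord)
  show "sm Fk" unfolding Fk_def[abs_def] using nz by (intro sm_mult sm_inverse be Al) auto
  show E: "sm Ek" unfolding Ek_def[abs_def] using nz by (intro sm_mult sm_inverse be Al) auto
  show b2: "smb b2" unfolding b2_def by (intro sm_sum sm_mult smb_b_u smb_b_d)
  show ib: "smb ib" unfolding ib_def using nz by (intro sm_inverse b2) auto
  show "sm R0" unfolding R0_def[abs_def] by (intro sm_sum sm_mult smb_r_d sm_coord)
  show S0: "sm S0" unfolding S0_def[abs_def] by (intro sm_sum sm_mult smb_s_d sm_coord)
  show R00: "sm R00" unfolding R00_def[abs_def] by (intro sm_sum sm_mult smb_r_dd sm_coord)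
  show "smb rs" unfolding rs_def by (intro sm_sum sm_mult smb_b_u smb_r_d)
  show "smb tr" unfolding tr_def by (intro sm_sum smb_r_ud)
  show "sm U" unfolding U_def[abs_def] by (intro sm_mult sm_add S0 R00 E ib)
  show "sm (\<lambda>x y. yl x y i)" unfolding yl_def by (intro sm_sum sm_mult smb_a sm_coord)
  show "sm (\<lambda>x y. rd0 x y i)" unfolding rd0_def by (intro sm_sum sm_mult smb_r_dd sm_coord)
  show "sm (\<lambda>x y. sd0 x y i)" unfolding sd0_def by (intro sm_sum sm_mult smb_s_dd sm_coord)
  show "sm (\<lambda>x y. sg x y i)" unfolding sg_def by (intro sm_sum sm_mult smb_s_ud sm_coord)
qed

section \<open>Derivatives of the basic scalars\<close>

lemma hv_form:
  assumes t: "\<And>i. smb (\<lambda>x. t x i)" and xy: "(x, y) \<in> Om"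
  shows "hv u w (\<lambda>x y. \<Sum>i. t x i * y $ i) x y
    = dot (\<lambda>k. \<Sum>i. cov_d a t x i k * y $ i) u + dot (t x) w"
  using hv_linear[OF assms, of u w] unfolding dot_def sum_distrib_right
  by (subst (asm) sum.swap) simp

lemma hv_scalars:
  assumes xy: "(x, y) \<in> Om"
  shows "hv u w Al x y = 2 * dot (yl x y) w"
    and "hv u w be x y = dot (rd0 x y) u - dot (sd0 x y) u + dot (bd x) w"
    and "hv u w (\<lambda>x y. b2 x) x y = 2 * (dot (rd x) u + dot (sd x) u)"
    and "hv u w (\<lambda>x y. ib x) x y = - 2 * (ib x)^2 * (dot (rd x) u + dot (sd x) u)"
    and "hv u w R0 x y = dot (Dr0 x y) u + dot (rd x) w"
    and "hv u w S0 x y = dot (Ds0 x y) u + dot (sd x) w"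
    and "hv u w R00 x y = dot (Dr00 x y) u + 2 * dot (rd0 x y) w"
proof -
  note x = Om_S[OF xy]
  show "hv u w Al x y = 2 * dot (yl x y) w"
    unfolding Al_def[abs_def] using hv_a[OF xy] by (simp add: dot_def yl_def)
  show "hv u w be x y = dot (rd0 x y) u - dot (sd0 x y) u + dot (bd x) w"
  proof -
    \<comment> \<open>The contraction is over the first index of b_{i|k}; exchanging the indices of
      s_{ik} gives the minus sign.\<close>
    have "(\<Sum>i. Dbd x i k * y $ i) = rd0 x y k - sd0 x y k" for k
      unfolding cov_b rd0_def sd0_def sum_subtractf[symmetric]
      by (intro sum.cong refl) (subst r_sym, subst s_skew, simp add: algebra_simps)
    then show ?thesis
      using hv_form[of "bd" x y u w] xy by (simp add: beta_form_def[abs_def] b_d_def)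
  qed
  show hb2: "hv u w (\<lambda>x y. b2 x) x y = 2 * (dot (rd x) u + dot (sd x) u)"
  proof -
    have "pd k b2 x = 2 * (rd x k + sd x k)" for k
    proof -
      \<comment> \<open>Raising commutes with the covariant derivative, so the two terms of the
        Leibniz rule for b^i b_i agree; hence the factor 2.\<close>
      have c: "(\<Sum>i. Dbu x i k * bd x i) = (\<Sum>i. bu x i * Dbd x i k)"
        using raise_dot[OF x, of "\<lambda>x i. Dbd x i k" "bd"]
        unfolding b_u_def cov_u_raise[OF smb_b_d xy] by (simp add: dot_def raise_d_def[of a "\<lambda>x i. Dbd x i k"] mult.commute)
      have d: "(\<Sum>i. bu x i * Dbd x i k) = rd x k + sd x k"
        unfolding cov_b r_d_def s_d_def sum.distrib[symmetric]
        by (intro sum.cong refl) (simp add: r_sym[of x k] algebra_simps)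
      have "pd k b2 x = pd k (\<lambda>x. \<Sum>i. bu x i * bd x i) x"
        by (simp add: b2_def[abs_def])
      also have "\<dots> = 2 * (rd x k + sd x k)"
        using partial_pairing[of "bu" "bd" x y k, OF smb_b_u smb_b_d xy] unfolding c d by simp
      finally show ?thesis .
    qed
    then show ?thesis using xy by (simp add: hv_base) (simp add: dot_def distrib_right distrib_left sum.distrib sum_distrib_left mult.assoc)
  qed
  show "hv u w (\<lambda>x y. ib x) x y = - 2 * (ib x)^2 * (dot (rd x) u + dot (sd x) u)"
    unfolding ib_def using xy nz[OF xy] by (simp add: hv_inverse hb2 power2_eq_square)
  show "hv u w R0 x y = dot (Dr0 x y) u + dot (rd x) w"
    using hv_form[of "rd" x y u w] xy by (simp add: R0_def[abs_def] Dr0_def[abs_def])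
  show "hv u w S0 x y = dot (Ds0 x y) u + dot (sd x) w"
    using hv_form[of "sd" x y u w] xy by (simp add: S0_def[abs_def] Ds0_def[abs_def])
  show "hv u w R00 x y = dot (Dr00 x y) u + 2 * dot (rd0 x y) w"
  proof -
    have 1: "(\<Sum>i j k. Drdd x i j k * y $ i * y $ j * u k) = dot (Dr00 x y) u"
      unfolding dot_def Dr00_def sum_distrib_right
      by (subst (2) sum.swap, subst sum.swap, rule sum.cong[OF refl], rule sum.cong[OF refl]) simp
    have 2: "(\<Sum>i j. rl x i j * (w i * y $ j + y $ i * w j)) = 2 * dot (rd0 x y) w"
      using sym_form[of w x "($) y"]
      by (simp add: dot_def rd0_def distrib_left sum.distrib sum_distribs mult_ac)
    show ?thesis unfolding R00_def[abs_def] hv_quadratic[OF smb_r_dd xy] 1 2 ..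
  qed
qed

text \<open>\<open>HF\<close>, \<open>VF\<close> and \<open>HU\<close>, \<open>VU\<close> are the horizontal and vertical parts of the differentials of \<open>F\<close> and \<open>U\<close>.\<close>

definition "HF x y k = Fk x y * (sd0 x y k - rd0 x y k) / be x y"
definition "VF x y k = (2 * yl x y k - Fk x y * bd x k) * inverse (be x y)"
definition "HU x y k = ib x * (Ds0 x y k + Ek x y * Dr00 x y k - R00 x y * (Ek x y)^2 * HF x y k)
    - 2 * U x y * ib x * (rd x k + sd x k)"
definition "VU x y k = ib x * (sd x k + 2 * Ek x y * rd0 x y k - R00 x y * (Ek x y)^2 * VF x y k)"

lemma sm_VF [intro, simp]: "sm (\<lambda>x y. VF x y k)"
  unfolding VF_def by (intro sm_mult sm_diff sm_const sm_inverse sm_scalars smb_b_d) (use nz in auto)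

lemma hv_F:
  assumes xy: "(x, y) \<in> Om"
  shows "hv u w Fk x y = dot (HF x y) u + dot (VF x y) w"
proof -
  have "hv u w Fk x y = Al x y * - (hv u w be x y * (inverse (be x y) * inverse (be x y))) + hv u w Al x y * inverse (be x y)"
    unfolding Fk_def[abs_def] using xy nz by (subst hv_mult) (auto simp: hv_inverse)
  then show ?thesis
    using nz[OF xy] by (simp add: hv_scalars[OF xy] HF_def[abs_def] VF_def[abs_def] nz(6)[OF xy] field_simps)
qed

lemma hv_E:
  assumes xy: "(x, y) \<in> Om"
  shows "hv u w Ek x y = - ((Ek x y)^2 * hv u w Fk x y)"
proof -
  have "hv u w (\<lambda>x y. Fk x y * Ek x y) x y = hv u w (\<lambda>x y. 1) x y"
    by (rule hv_cong[OF _ xy]) (rule nz)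
  then have "Fk x y * hv u w Ek x y + hv u w Fk x y * Ek x y = 0"
    using xy by (simp add: hv_mult hv_const)
  then have "Ek x y * (Fk x y * hv u w Ek x y + hv u w Fk x y * Ek x y) = 0" by simp
  then have "(Fk x y * Ek x y) * hv u w Ek x y + (Ek x y)^2 * hv u w Fk x y = 0"
    by (simp add: algebra_simps power2_eq_square)
  then show ?thesis by (simp add: nz[OF xy])
qed

lemma hv_U:
  assumes xy: "(x, y) \<in> Om"
  shows "hv u w U x y = dot (HU x y) u + dot (VU x y) w"
proof -
  have "hv u w U x y = (S0 x y + R00 x y * Ek x y) * hv u w (\<lambda>x y. ib x) x y
      + (hv u w S0 x y + (R00 x y * hv u w Ek x y + hv u w R00 x y * Ek x y)) * ib x"
    unfolding U_def[abs_def] using xy by (simp add: hv_mult hv_add)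
  \<comment> \<open>The bracket is U b^2, which reduces the square of \<open>ib\<close> from its
    derivative to a single power.\<close>
  also have "(S0 x y + R00 x y * Ek x y) * hv u w (\<lambda>x y. ib x) x y
      = - 2 * U x y * ib x * (dot (rd x) u + dot (sd x) u)"
  proof -
    have "(S0 x y + R00 x y * Ek x y) * hv u w (\<lambda>x y. ib x) x y
        = - 2 * U x y * (b2 x * ib x) * ib x * (dot (rd x) u + dot (sd x) u)"
      by (simp add: nz(7)[OF xy, symmetric] hv_scalars[OF xy] power2_eq_square)
    then show ?thesis by (simp add: nz(5)[OF xy])
  qed
  also have "\<dots> + (hv u w S0 x y + (R00 x y * hv u w Ek x y + hv u w R00 x y * Ek x y)) * ib x
      = dot (HU x y) u + dot (VU x y) w"
    by (simp add: hv_E[OF xy] hv_F[OF xy] hv_scalars[OF xy] HU_def[abs_def] VU_def[abs_def] power2_eq_square algebra_simps)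
  finally show ?thesis .
qed

section \<open>The candidate spray\<close>

definition "Tk i x y = Fk x y * U x y * bu x i / 2 - Fk x y * sg x y i / 2 - U x y * y $ i"

lemma sm_Tk: "sm (Tk i)"
  unfolding Tk_def[abs_def] by (intro sm_diff sm_cdivide sm_mult sm_scalars smb_b_u sm_coord)

end

sublocale kropina_chart \<subseteq> perturbed_spray S a b Tk
  by unfold_locales (rule sm_Tk)

context kropina_chart
begin

lemma Fk_Ek: "(x, y) \<in> Om \<Longrightarrow> Ek x y \<noteq> 0" "(x, y) \<in> Om \<Longrightarrow> Fk x y = 1 / Ek x y"
  using be_pos[of x y] Al_pos[of x y] by (simp_all add: Fk_def Ek_def field_simps)

lemma dot_T: "dot f (\<lambda>i. Tk i x y)
    = (Fk x y * U x y * dot f (bu x) - Fk x y * dot f (sg x y)) / 2 - U x y * dot f (($) y)"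
  by (simp add: Tk_def diff_divide_distrib)

lemma VF_dot:
  assumes xy: "(x, y) \<in> Om"
  shows "dot (VF x y) (($) y) = Fk x y" "dot (VF x y) (bu x) = 2 - Fk x y * b2 x / be x y"
    "dot (VF x y) (sg x y) = - Fk x y * S0 x y / be x y"
  using nz[OF xy] by (simp_all add: VF_def[abs_def] dot_table[OF xy] field_simps)

text \<open>For a T of this shape, DF = 0 is a linear equation for \<open>U\<close> whose solution
  is the definition of \<open>U\<close>. By \<open>vf_be\<close>, \<open>U\<close> is then half the
  logarithmic derivative of \<beta> along the spray.\<close>

lemma vf_Fk: "(x, y) \<in> Om \<Longrightarrow> vf Fk x y = 0"
proof -
  assume xy: "(x, y) \<in> Om"
  \<comment> \<open>The defining equation of \<open>U\<close>, multiplied by F^2 to remove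
    1/F.\<close>
  have "Fk x y * (Fk x y * (U x y * b2 x)) = Fk x y * (Fk x y * S0 x y) + (Fk x y * Ek x y) * (Fk x y * R00 x y)"
    unfolding nz(7)[OF xy] by (simp add: algebra_simps)
  then have e: "Fk x y * (Fk x y * (U x y * b2 x)) = Fk x y * (Fk x y * S0 x y) + Fk x y * R00 x y"
    by (simp add: nz(4)[OF xy])
  have "vf Fk x y * be x y = Fk x y * (Fk x y * (U x y * b2 x)) - (Fk x y * (Fk x y * S0 x y) + Fk x y * R00 x y)"
    using nz(1)[OF xy] by (simp add: vf_hv[OF xy] hv_F[OF xy] dot_T VF_dot[OF xy])
      (simp add: HF_def[abs_def] dot_table[OF xy] field_simps)
  then show ?thesis using e nz(1)[OF xy] by simp
qed

lemma vf_be: "(x, y) \<in> Om \<Longrightarrow> vf be x y = 2 * U x y * be x y"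
proof -
  assume xy: "(x, y) \<in> Om"
  have "Fk x y * (U x y * b2 x) = Fk x y * S0 x y + (Fk x y * Ek x y) * R00 x y"
    unfolding nz(7)[OF xy] by (simp add: algebra_simps)
  then have "Fk x y * (U x y * b2 x) = Fk x y * S0 x y + R00 x y" by (simp add: nz(4)[OF xy])
  then show ?thesis
    by (simp add: vf_hv[OF xy] hv_scalars[OF xy] dot_T dot_table[OF xy])
qed

section \<open>The inverse fundamental tensor\<close>

definition "L x y = Fk x y * Fk x y"
text \<open>The coefficients of the inverse fundamental tensor in the ansatz
  \<open>c\<^sub>1 a\<^sup>i\<^sup>j + c\<^sub>2 b\<^sup>i b\<^sup>j + c\<^sub>3 (b\<^sup>i y\<^sup>j + y\<^sup>i b\<^sup>j) + c\<^sub>4 y\<^sup>i y\<^sup>j\<close>.\<close>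

definition "c1 x y = be x y * Ek x y / 2"
definition "c2 x y = - (be x y * Ek x y * ib x / 2)"
definition "c3 x y = be x y * ib x * (Ek x y)^2"
definition "c4 x y = (Ek x y)^2 - 2 * be x y * ib x * (Ek x y)^3"

definition "gi i j x y = c1 x y * ai x i j + c2 x y * bu x i * bu x j
    + c3 x y * (bu x i * y $ j + y $ i * bu x j) + c4 x y * y $ i * y $ j"

lemma sm_Lk: "sm L"
  unfolding L_def[abs_def] by (intro sm_mult sm_scalars)

lemma sm_c: "sm c1" "sm c2" "sm c3" "sm c4"
  unfolding c1_def[abs_def] c2_def[abs_def] c3_def[abs_def] c4_def[abs_def] by simp_all

lemma sm_gik: "sm (gi i j)"
  unfolding gi_def[abs_def] using sm_c by simp

lemma dy_Fk: "(x, y) \<in> Om \<Longrightarrow> dy j Fk x y = VF x y j"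
  by (simp add: dy_hv hv_F)

lemma dy_L: "(x, y) \<in> Om \<Longrightarrow> dy j L x y = 2 * (Fk x y * VF x y j)"
  unfolding L_def[abs_def] by (simp add: dy_mult dy_Fk)

text \<open>This is \<beta> F_{y^k} = 2 y_k - F b_k differentiated once more. Keeping dF unexpanded
  makes the fundamental tensor a multiple of a_{ij} plus dyads in dF and b, to which
  \<open>gi\<close> is applied termwise in \<open>gi_inverse\<close>.\<close>

lemma dy_VF:
  assumes xy: "(x, y) \<in> Om"
  shows "dy l (\<lambda>x y. VF x y k) x y = (2 * a x $ k $ l - VF x y l * bd x k - VF x y k * bd x l) * inverse (be x y)"
proof -
  have 1: "dy l (\<lambda>x y. yl x y k) x y = a x $ k $ l"
    unfolding yl_def using xy by (simp add: dy_sum dy_mult dy_coord)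
  have 2: "dy l be x y = bd x l" using xy by (simp add: dy_hv hv_scalars)
  have s: "sm (\<lambda>x y. inverse (be x y))" by (rule sm_inverse) (use nz in auto)
  have "dy l (\<lambda>x y. VF x y k) x y = (2 * yl x y k - Fk x y * bd x k) * - (bd x l * (inverse (be x y) * inverse (be x y)))
      + (2 * a x $ k $ l - VF x y l * bd x k) * inverse (be x y)"
    unfolding VF_def using xy s nz[OF xy] dy_Fk[OF xy, unfolded VF_def]
    by (simp add: dy_mult dy_diff dy_cmult dy_inverse 1 2)
  then show ?thesis by (simp add: VF_def algebra_simps)
qed

lemma hessian_L:
  assumes xy: "(x, y) \<in> Om"
  shows "1/2 * dy l (dy k L) x y = VF x y l * VF x y k
    + Fk x y * (2 * a x $ k $ l - VF x y l * bd x k - VF x y k * bd x l) * inverse (be x y)"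
proof -
  have "dy l (dy k L) x y = dy l (\<lambda>x y. 2 * (Fk x y * VF x y k)) x y"
    by (rule dy_cong[OF dy_L xy])
  then show ?thesis using xy by (simp add: dy_cmult dy_mult dy_Fk dy_VF)
qed

lemma gi_contract: "(\<Sum>k. gi i k x y * w k) = c1 x y * raise_d a (\<lambda>x. w) x i
    + c2 x y * bu x i * dot (bu x) w + c3 x y * (bu x i * dot (($) y) w + y $ i * dot (bu x) w)
    + c4 x y * y $ i * dot (($) y) w"
  by (simp add: gi_def raise_d_def dot_def distrib_right distrib_left sum.distrib sum_distrib_left mult_ac)

lemma raise_values:
  assumes "x \<in> S"
  shows "raise_d a (\<lambda>_. yl x y) x i = y $ i" "raise_d a (\<lambda>_. bd x) x i = bu x i"
    "raise_d a (\<lambda>_ k. a x $ k $ j) x i = kron i j"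
  using raise_yl[OF assms, of y i] ai_a[OF assms, of i j] by (simp_all add: raise_d_def b_u_def)

lemma gi_b:
  assumes xy: "(x, y) \<in> Om"
  shows "(\<Sum>k. gi i k x y * bd x k) = be x y * be x y * ib x * (Ek x y)^2 * bu x i
    + 2 * (be x y * (Ek x y)^2 - (be x y)^2 * ib x * (Ek x y)^3) * y $ i"
proof -
  \<comment> \<open>These relations explain two of the coefficients: \<open>c2\<close> is chosen so
    that its contribution along b^i cancels that of \<open>c1\<close>, and \<open>c3\<close> b^2 is
    then \<beta>/F^2.\<close>
  have 1: "c1 x y + c2 x y * b2 x = 0" "c3 x y * b2 x = be x y * (Ek x y)^2"
    using nz(4,5)[OF xy] unfolding c1_def c2_def c3_def by algebra+
  have "(\<Sum>k. gi i k x y * bd x k) = (c1 x y + c2 x y * b2 x + c3 x y * be x y) * bu x i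
      + (c3 x y * b2 x + c4 x y * be x y) * y $ i"
    unfolding gi_contract
    using dot_table[OF xy] by (simp add: raise_values[OF Om_S[OF xy]] dot_commute[of _ "bd x"] algebra_simps)
  from this[unfolded 1] show ?thesis
    by (simp add: c3_def c4_def algebra_simps power2_eq_square power3_eq_cube)
qed

lemma gi_yl:
  assumes xy: "(x, y) \<in> Om"
  shows "(\<Sum>k. gi i k x y * yl x y k) = be x y * be x y * ib x * Ek x y * bu x i / 2
    + (3 / 2 * be x y * Ek x y - (be x y)^2 * ib x * (Ek x y)^2) * y $ i"
proof -
  have E0: "Ek x y \<noteq> 0" and F: "Fk x y = 1 / Ek x y"
    by (rule Fk_Ek[OF xy])+
  have 1: "c3 x y * (Fk x y * be x y) + c2 x y * be x y = be x y * be x y * ib x * Ek x y / 2"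
    unfolding c3_def c2_def F using E0 by (simp add: field_simps power2_eq_square)
  have 2: "c1 x y + c3 x y * be x y + c4 x y * (Fk x y * be x y) = 3 / 2 * be x y * Ek x y - (be x y)^2 * ib x * (Ek x y)^2"
    unfolding c1_def c3_def c4_def F using E0 by (simp add: field_simps power2_eq_square power3_eq_cube)
  have "(\<Sum>k. gi i k x y * yl x y k) = (c3 x y * (Fk x y * be x y) + c2 x y * be x y) * bu x i
      + (c1 x y + c3 x y * be x y + c4 x y * (Fk x y * be x y)) * y $ i"
    unfolding gi_contract
    using dot_table[OF xy] by (simp add: raise_values[OF Om_S[OF xy]] dot_commute[of _ "yl x y"] nz(6)[OF xy] algebra_simps)
  then show ?thesis unfolding 1 2 by simp
qed

text \<open>The duality g^{ik} F_{y^k} = y^i/F, common to all Finsler metrics. It settles the dF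
  part of the inverse here and later turns the pairing with dF into the Euler operator.\<close>

lemma gi_VF:
  assumes xy: "(x, y) \<in> Om"
  shows "(\<Sum>k. gi i k x y * VF x y k) = Ek x y * y $ i"
proof -
  have "(\<Sum>k. gi i k x y * VF x y k) = (2 * (\<Sum>k. gi i k x y * yl x y k)
      - Fk x y * (\<Sum>k. gi i k x y * bd x k)) * inverse (be x y)"
    by (simp add: VF_def sum_distribs sum_subtractf left_diff_distrib right_diff_distrib mult_ac)
  also have "2 * (\<Sum>k. gi i k x y * yl x y k) - Fk x y * (\<Sum>k. gi i k x y * bd x k) = Ek x y * y $ i * be x y"
  proof -
    have E0: "Ek x y \<noteq> 0" and F: "Fk x y = 1 / Ek x y"
      by (rule Fk_Ek[OF xy])+
    show ?thesis unfolding gi_b[OF xy] gi_yl[OF xy] F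
      using E0 by (simp add: field_simps power2_eq_square power3_eq_cube)
  qed
  finally show ?thesis using nz(1)[OF xy] by simp
qed

lemma gi_inverse:
  assumes xy: "(x, y) \<in> Om"
  shows "(\<Sum>k. gi i k x y * (1/2 * dy j (dy k L) x y)) = kron i j"
proof -
  have a: "(\<Sum>k. gi i k x y * a x $ k $ j) = c1 x y * kron i j + c2 x y * bu x i * bd x j
      + c3 x y * (bu x i * yl x y j + y $ i * bd x j) + c4 x y * y $ i * yl x y j"
  proof -
    have "dot (bu x) (\<lambda>k. a x $ k $ j) = bd x j"
      using lower_bu[OF Om_S[OF xy], of j "bd"]
      by (simp add: dot_def b_u_def sym_a[OF Om_S[OF xy], of _ j] mult.commute)
    moreover have "dot (($) y) (\<lambda>k. a x $ k $ j) = yl x y j"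
      by (simp add: dot_def yl_def sym_a[OF Om_S[OF xy], of _ j] mult.commute)
    ultimately show ?thesis unfolding gi_contract by (simp add: raise_values[OF Om_S[OF xy]])
  qed
  have "(\<Sum>k. gi i k x y * (1/2 * dy j (dy k L) x y))
      = (\<Sum>k. gi i k x y * VF x y k) * VF x y j
        + Fk x y * (2 * (\<Sum>k. gi i k x y * a x $ k $ j) - VF x y j * (\<Sum>k. gi i k x y * bd x k)
          - (\<Sum>k. gi i k x y * VF x y k) * bd x j) * inverse (be x y)"
    unfolding hessian_L[OF xy]
    by (simp add: sum_distribs sum_subtractf sum.distrib left_diff_distrib right_diff_distrib distrib_left distrib_right mult_ac)
  also have "\<dots> = kron i j * (be x y * inverse (be x y))"
  proof -
    have v: "VF x y j = (2 * yl x y j - Fk x y * bd x j) * inverse (be x y)" by (simp add: VF_def)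
    have E0: "Ek x y \<noteq> 0" and F: "Fk x y = 1 / Ek x y"
      by (rule Fk_Ek[OF xy])+
    show ?thesis
      unfolding a gi_b[OF xy] gi_VF[OF xy] c1_def c2_def c3_def c4_def v F
      using nz(1)[OF xy] E0 by (simp add: field_simps power2_eq_square power3_eq_cube)
  qed
  finally show ?thesis using nz(1)[OF xy] by simp
qed

lemma gi_symmetric: "(x, y) \<in> Om \<Longrightarrow> gi i j x y = gi j i x y"
  using ai_sym[of x i j] Om_S by (auto simp: gi_def algebra_simps)

section \<open>The Euler-Lagrange equation\<close>

lemma vf_bd:
  assumes xy: "(x, y) \<in> Om"
  shows "vf (\<lambda>x y. bd x k) x y = rd0 x y k + sd0 x y k + (\<Sum>l. N x y l k * bd x l)"
proof -
  have 1: "pd p (\<lambda>x. bd x k) x = rl x k p + sl x k p + (\<Sum>l. Gam x l k p * bd x l)" for p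
    using cov_b[of x k p] by (simp add: cov_d_def algebra_simps)
  have 2: "(\<Sum>p. (\<Sum>l. Gam x l k p * bd x l) * y $ p) = (\<Sum>l. N x y l k * bd x l)"
    unfolding N_def sum_distrib_right by (subst sum.swap) (simp add: mult_ac)
  have "vf (\<lambda>x y. bd x k) x y = (\<Sum>p. pd p (\<lambda>x. bd x k) x * y $ p)"
    using xy by (simp add: vf_hv hv_base)
  then show ?thesis unfolding 1 by (simp add: distrib_right sum.distrib 2 rd0_def sd0_def)
qed

text \<open>Because the index k is free, a Christoffel term with \<open>N\<close> remains, as in
  \<open>vf_bd\<close>. Both are needed in \<open>vf_dL\<close>, where they match the difference
  between \<open>dx\<close> and the horizontal derivative.\<close>

lemma vf_yl:
  assumes xy: "(x, y) \<in> Om"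
  shows "vf (\<lambda>x y. yl x y k) x y = - 2 * (\<Sum>j. a x $ k $ j * Tk j x y) + (\<Sum>l. N x y l k * yl x y l)"
proof -
  have 1: "(\<Sum>j. (\<Sum>p. (\<Sum>l. Gam x l k p * a x $ l $ j) * y $ p) * y $ j)
      = (\<Sum>l. N x y l k * yl x y l)"
  proof -
    have "(\<Sum>j. (\<Sum>p. (\<Sum>l. Gam x l k p * a x $ l $ j) * y $ p) * y $ j)
        = (\<Sum>j p l. Gam x l k p * a x $ l $ j * y $ p * y $ j)"
      by (simp add: sum_distrib_right)
    also have "\<dots> = (\<Sum>j l p. Gam x l k p * a x $ l $ j * y $ p * y $ j)"
      by (rule sum.cong[OF refl], rule sum.swap)
    also have "\<dots> = (\<Sum>l j p. Gam x l k p * a x $ l $ j * y $ p * y $ j)"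
      by (rule sum.swap)
    finally show ?thesis by (simp add: N_def yl_def sum_distribs mult_ac)
  qed
  have 2: "(\<Sum>j. (\<Sum>p. (\<Sum>l. Gam x l j p * a x $ k $ l) * y $ p) * y $ j)
      = (\<Sum>j. a x $ k $ j * (\<Sum>p. N x y j p * y $ p))"
  proof -
    have "(\<Sum>j. (\<Sum>p. (\<Sum>l. Gam x l j p * a x $ k $ l) * y $ p) * y $ j)
        = (\<Sum>j p l. Gam x l p j * a x $ k $ l * y $ p * y $ j)"
      by (simp add: sum_distrib_right Gam_sym[OF xy])
    also have "\<dots> = (\<Sum>p j l. Gam x l p j * a x $ k $ l * y $ p * y $ j)"
      by (rule sum.swap)
    also have "\<dots> = (\<Sum>p l j. Gam x l p j * a x $ k $ l * y $ p * y $ j)"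
      by (rule sum.cong[OF refl], rule sum.swap)
    also have "\<dots> = (\<Sum>l p j. Gam x l p j * a x $ k $ l * y $ p * y $ j)"
      by (rule sum.swap)
    finally show ?thesis by (simp add: N_def sum_distribs mult_ac)
  qed
  have "vf (\<lambda>x y. yl x y k) x y = (\<Sum>j. a x $ k $ j * (- 2 * Tk j x y - (\<Sum>p. N x y j p * y $ p)))
      + (\<Sum>j. (\<Sum>p. pd p (\<lambda>x. a x $ k $ j) x * y $ p) * y $ j)"
    unfolding yl_def using xy by (simp add: vf_hv hv_sum hv_mult hv_coord hv_base sum.distrib)
  from this[unfolded partial_a[OF xy] distrib_right sum.distrib 1 2] show ?thesis
    by (simp add: right_diff_distrib sum_subtractf sum_distrib_left sum_negf mult_ac)
qed

lemma lower_T: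
  assumes xy: "(x, y) \<in> Om"
  shows "(\<Sum>j. a x $ k $ j * Tk j x y) = Fk x y * U x y * bd x k / 2 - Fk x y * sd0 x y k / 2 - U x y * yl x y k"
proof -
  have 1: "(\<Sum>j. a x $ k $ j * bu x j) = bd x k"
    using lower_bu[OF Om_S[OF xy], of k "bd"] by (simp add: b_u_def)
  have 2: "(\<Sum>j. a x $ k $ j * sg x y j) = sd0 x y k"
    using lower_bu[OF Om_S[OF xy], of k "\<lambda>x. sd0 x y"] by (simp add: sg_raise)
  have "(\<Sum>j. a x $ k $ j * Tk j x y) = Fk x y * U x y * (\<Sum>j. a x $ k $ j * bu x j) / 2
      - Fk x y * (\<Sum>j. a x $ k $ j * sg x y j) / 2 - U x y * (\<Sum>j. a x $ k $ j * y $ j)"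
    by (simp add: Tk_def right_diff_distrib sum_subtractf sum_distrib_left sum_divide_distrib mult_ac)
  then show ?thesis unfolding 1 2 by (simp add: yl_def)
qed

text \<open>As F is constant along the spray, the Euler-Lagrange equation for F^2 reduces to
  D(F_{y^k}) = F_{x^k}. The derivatives of y_k, b_k and \<beta> add up to the horizontal part
  \<open>HF\<close> plus the \<open>N\<close> term that converts it into \<open>dx\<close>.\<close>

lemma vf_dL:
  assumes xy: "(x, y) \<in> Om"
  shows "vf (dy k L) x y = dx k L x y"
proof -
  have s: "sm (\<lambda>x y. inverse (be x y))" by (rule sm_inverse) (use nz in auto)
  have vV: "vf (\<lambda>x y. VF x y k) x y = (2 * vf (\<lambda>x y. yl x y k) x y - Fk x y * vf (\<lambda>x y. bd x k) x y
      - VF x y k * vf be x y) * inverse (be x y)"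
  proof -
    have "vf (\<lambda>x y. VF x y k) x y = (2 * yl x y k - Fk x y * bd x k) * - (vf be x y * (inverse (be x y) * inverse (be x y)))
      + (2 * vf (\<lambda>x y. yl x y k) x y - Fk x y * vf (\<lambda>x y. bd x k) x y) * inverse (be x y)"
      unfolding VF_def using xy s nz[OF xy] vf_Fk[OF xy]
      by (simp add: vf_hv hv_mult hv_diff hv_const hv_inverse)
    then show ?thesis by (simp add: VF_def algebra_simps)
  qed
  have NV: "(\<Sum>l. N x y l k * VF x y l)
      = (2 * (\<Sum>l. N x y l k * yl x y l) - Fk x y * (\<Sum>l. N x y l k * bd x l)) * inverse (be x y)"
    by (simp add: VF_def sum_distribs sum_subtractf left_diff_distrib right_diff_distrib mult_ac)
  have "vf (dy k L) x y = vf (\<lambda>x y. 2 * (Fk x y * VF x y k)) x y"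
    by (rule vf_cong[OF dy_L xy])
  also have "\<dots> = 2 * (Fk x y * vf (\<lambda>x y. VF x y k) x y)"
    using xy vf_Fk[OF xy] by (simp add: vf_cmult vf_mult)
  also have "vf (\<lambda>x y. VF x y k) x y = HF x y k + (\<Sum>l. N x y l k * VF x y l)"
    unfolding vV NV unfolding vf_yl[OF xy] lower_T[OF xy] vf_bd[OF xy] vf_be[OF xy] HF_def VF_def
    using nz(1)[OF xy] by (simp add: field_simps)
  also have "\<dots> = dx k Fk x y"
    using xy by (simp add: dx_hv hv_F dy_Fk)
  also have "2 * (Fk x y * \<dots>) = dx k L x y"
    unfolding L_def[abs_def] using xy by (simp add: dx_mult)
  finally show ?thesis .
qed

lemma spray_equation:
  assumes xy: "(x, y) \<in> Om"
  shows "(\<Sum>j. dy k (dx j L) x y * y $ j) - dx k L x y = 2 * (\<Sum>m. G m x y * dy m (dy k L) x y)"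
proof -
  have "(\<Sum>j. dy k (dx j L) x y * y $ j) = (\<Sum>j. y $ j * dx j (dy k L) x y)"
    using xy sm_Lk by (simp add: dy_commute(2) mult.commute)
  then show ?thesis
    using vf_dL[OF xy, of k] vf_expand[OF sm_dy[OF sm_Lk] xy, of k] by simp
qed

end

sublocale kropina_chart \<subseteq> finsler_spray Om G L gi
  by unfold_locales (rule sm_Lk, rule sm_gik, erule gi_symmetric, erule gi_inverse, erule spray_equation)

context kropina_chart
begin

section \<open>Identification with the coordinate definitions of the curvatures\<close>

lemma kropina_F: "(x, y) \<in> Om \<Longrightarrow> kropina a b x y = Fk x y"
  using Al_pos[of x y] by (simp add: kropina_def alpha_norm_def Fk_def Al_def[symmetric] divide_inverse)

lemma sq_L: "(x, y) \<in> Om \<Longrightarrow> sq (kropina a b) x y = L x y"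
  by (simp add: sq_def kropina_F L_def power2_eq_square)

lemma inv_fundamental_gi:
  assumes xy: "(x, y) \<in> Om"
  shows "inv_fundamental (kropina a b) i j x y = gi i j x y"
proof -
  have "dy k (dy l (sq (kropina a b))) x y = dy k (dy l L) x y" for k l
    by (intro dy_cong[OF _ xy] dy_cong sq_L)
  then have "fundamental_tensor (kropina a b) x y = (\<chi> l k. 1/2 * dy k (dy l L) x y)"
    by (simp add: fundamental_tensor_def)
  moreover have "(\<chi> i j. gi i j x y) ** (\<chi> l k. 1/2 * dy k (dy l L) x y) = mat 1"
    using gi_inverse[OF xy] by (simp add: vec_eq_iff matrix_matrix_mult_def mat_def kron_def)
  ultimately have "matrix_inv (fundamental_tensor (kropina a b) x y) = (\<chi> i j. gi i j x y)"
    by (simp add: matrix_inv_eqI)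
  then show ?thesis by (simp add: inv_fundamental_def)
qed

lemma spray_coeff_G:
  assumes xy: "(x, y) \<in> Om"
  shows "spray_coeff (kropina a b) i x y = G i x y"
proof -
  have 1: "dy k (dx j (sq (kropina a b))) x y = dy k (dx j L) x y" for k j
    by (intro dy_cong[OF _ xy] dx_cong sq_L)
  have 2: "dx k (sq (kropina a b)) x y = dx k L x y" for k
    by (intro dx_cong[OF _ xy] sq_L)
  have "spray_coeff (kropina a b) i x y
      = 1/4 * (\<Sum>k. gi i k x y * (2 * (\<Sum>m. G m x y * dy m (dy k L) x y)))"
    unfolding spray_coeff_def 1 2 inv_fundamental_gi[OF xy] spray_equation[OF xy] ..
  also have "\<dots> = (\<Sum>m. G m x y * (\<Sum>k. gi i k x y * (1/2 * dy m (dy k L) x y)))"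
    unfolding sum_distrib_left by (subst sum.swap) (simp add: mult_ac)
  finally show ?thesis unfolding gi_inverse[OF xy] by simp
qed

lemma finsler_riemann_G:
  assumes xy: "(x, y) \<in> Om"
  shows "finsler_riemann (kropina a b) i k x y = spray_riem G i k x y"
proof -
  have "dx j (dy k (spray_coeff (kropina a b) i)) x y = dx j (dy k (G i)) x y" for i j k
    by (intro dx_cong[OF _ xy] dy_cong spray_coeff_G)
  moreover have "dy j (dy k (spray_coeff (kropina a b) i)) x y = dy j (dy k (G i)) x y" for i j k
    by (intro dy_cong[OF _ xy] dy_cong spray_coeff_G)
  moreover have "dx k (spray_coeff (kropina a b) i) x y = dx k (G i) x y" for i k
    by (intro dx_cong[OF _ xy] spray_coeff_G)
  moreover have "dy k (spray_coeff (kropina a b) i) x y = dy k (G i) x y" for i k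
    by (intro dy_cong[OF _ xy] spray_coeff_G)
  ultimately show ?thesis using spray_coeff_G[OF xy] by (simp add: finsler_riemann_def spray_riem_def)
qed

lemma finsler_scalar_G:
  assumes xy: "(x, y) \<in> Om"
  shows "finsler_scalar (kropina a b) x y = 1/2 * lap (spray_ric G) x y + 1/2 * vf (lap (spray_div G)) x y"
proof -
  define B where "B i j = finsler_ricci_bar (kropina a b) i j x y" for i j
  have B: "B i j = (\<Sum>m. 1/3 * (dy j (dy i (spray_riem G m m)) x y - dy m (dy i (spray_riem G m j)) x y))" for i j
  proof -
    have "dy l (dy j (finsler_riemann (kropina a b) i k)) x y = dy l (dy j (spray_riem G i k)) x y" for l j i k
      by (intro dy_cong[OF _ xy] dy_cong finsler_riemann_G)
    then show ?thesis by (simp add: B_def finsler_ricci_bar_def finsler_riemann_tensor_def)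
  qed
  \<comment> \<open>Symmetrising the Ricci tensor does not change its contraction with the symmetric
    g^{ij}.\<close>
  have sw: "(\<Sum>i j. gi i j x y * B j i) = (\<Sum>i j. gi i j x y * B i j)"
    by (subst sum.swap) (simp add: gi_sym[OF xy])
  have "finsler_scalar (kropina a b) x y = 1/2 * (\<Sum>i j. gi i j x y * B i j)
      + 1/2 * (\<Sum>i j. gi i j x y * B j i)"
    unfolding finsler_scalar_def finsler_ricci_def inv_fundamental_gi[OF xy] B_def[symmetric]
    by (simp add: sum.distrib distrib_left sum_distrib_left sum_divide_distrib add_divide_distrib)
  also have "\<dots> = (\<Sum>i j. gi i j x y * B i j)" unfolding sw by simp
  also have "\<dots> = 1/2 * lap (spray_ric G) x y + 1/2 * vf (lap (spray_div G)) x y"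
    unfolding B by (rule scalar_curvature_spray[OF xy])
  finally show ?thesis .
qed

end

section \<open>The Ricci curvature of a Kropina metric\<close>

definition mtr :: "('n::finite \<Rightarrow> 'n \<Rightarrow> real) \<Rightarrow> ('n \<Rightarrow> 'n \<Rightarrow> real) \<Rightarrow> real" where
  "mtr X Y = (\<Sum>m j. X m j * Y j m)"

lemma mtr_commute: "mtr X Y = mtr Y X"
  unfolding mtr_def by (subst sum.swap) (simp add: mult.commute)

lemma mtr_linear:
  "mtr (\<lambda>m j. X m j + Y m j) Z = mtr X Z + mtr Y Z" "mtr Z (\<lambda>m j. X m j + Y m j) = mtr Z X + mtr Z Y"
  "mtr (\<lambda>m j. X m j - Y m j) Z = mtr X Z - mtr Y Z" "mtr Z (\<lambda>m j. X m j - Y m j) = mtr Z X - mtr Z Y"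
  "mtr (\<lambda>m j. c * X m j) Z = c * mtr X Z" "mtr Z (\<lambda>m j. c * X m j) = c * mtr Z X"
  by (simp_all add: mtr_def distrib_left distrib_right left_diff_distrib right_diff_distrib sum.distrib
      sum_subtractf sum_distrib_left mult_ac)

lemma mtr_rank1:
  "mtr (\<lambda>m j. \<alpha> j * p m) (\<lambda>m j. \<gamma> j * q m) = dot \<alpha> q * dot \<gamma> p"
  "mtr (\<lambda>m j. \<alpha> j * p m) X = dot \<alpha> (\<lambda>i. \<Sum>j. X i j * p j)"
  "mtr X kron = (\<Sum>m. X m m)"
  by (simp_all add: mtr_def dot_def sum_distribs mult_ac)
    (subst sum.swap; simp add: mult_ac)+

text \<open>The assumed shape is that of dT^m/dy^j in \<open>dy_T\<close>: two rank-one terms from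
  dF and dU, a multiple of s^m_j and a multiple of the identity.\<close>

lemma mtr_square:
  fixes \<alpha> \<gamma> p q :: "'n::finite \<Rightarrow> real"
  assumes M: "\<And>m j. M m j = \<alpha> j * p m + \<gamma> j * q m - c * X m j - d * kron m j"
  shows "(\<Sum>m j. M m j * M j m) = (dot \<alpha> p)^2 + (dot \<gamma> q)^2 + c^2 * mtr X X
    + real CARD('n) * d^2 + 2 * dot \<alpha> q * dot \<gamma> p
    - 2 * c * dot \<alpha> (\<lambda>i. \<Sum>j. X i j * p j) - 2 * c * dot \<gamma> (\<lambda>i. \<Sum>j. X i j * q j)
    - 2 * d * dot \<alpha> p - 2 * d * dot \<gamma> q + 2 * c * d * (\<Sum>m. X m m)"
proof -
  have k: "mtr (\<lambda>m j. \<alpha> j * p m) kron = dot \<alpha> p" for \<alpha> p :: "'n \<Rightarrow> real"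
    by (simp add: mtr_rank1(3) dot_def)
  have kk: "(\<Sum>m\<in>(UNIV :: 'n set). kron m m) = real CARD('n)"
    by (simp add: kron_def)
  have "(\<Sum>m j. M m j * M j m)
      = mtr (\<lambda>m j. \<alpha> j * p m + \<gamma> j * q m - c * X m j - d * kron m j) (\<lambda>m j. \<alpha> j * p m + \<gamma> j * q m - c * X m j - d * kron m j)"
    by (simp only: mtr_def M)
  then show ?thesis
    unfolding mtr_linear
    by (simp add: mtr_rank1(1) mtr_rank1(2)[of _ _ X] k kk mtr_rank1(3) mtr_commute[of kron]
        mtr_commute[of X "\<lambda>m j. \<alpha> j * p m"] mtr_commute[of X "\<lambda>m j. \<gamma> j * q m"]
        power2_eq_square algebra_simps)
qed

context kropina_chart
begin

section \<open>The derivative matrix and the divergences of T\<close>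

definition "tS2 x = (\<Sum>t m. sud x t m * sud x m t)"
definition "dsg x y = (\<Sum>m j. Dsud x m j m * y $ j)"
definition "Ric00 x y = (\<Sum>i j. Ric x i j * y $ i * y $ j)"

text \<open>\<open>wT\<close>/2 and \<open>zT\<close> are the partial derivatives of T with respect
  to F and to U, both regarded as independent variables.\<close>

definition "wT x y m = U x y * bu x m - sg x y m"
definition "zT x y m = Fk x y * bu x m / 2 - y $ m"

lemma dy_U: "(x, y) \<in> Om \<Longrightarrow> dy j U x y = VU x y j"
  by (simp add: dy_hv hv_U)

lemma dy_sg: "(x, y) \<in> Om \<Longrightarrow> dy j (\<lambda>x y. sg x y m) x y = sud x m j"
  unfolding sg_def by (simp add: dy_sum dy_mult dy_coord)

lemma dy_T:
  assumes xy: "(x, y) \<in> Om"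
  shows "dy j (Tk m) x y = VF x y j * (wT x y m / 2) + VU x y j * zT x y m - Fk x y / 2 * sud x m j - U x y * kron m j"
  unfolding Tk_def[abs_def] using xy
  by (simp add: dy_diff dy_cdivide dy_mult dy_Fk dy_U dy_sg dy_coord)
    (simp add: wT_def zT_def kron_commute[of j m] field_simps)

lemma VU_dot: "dot (VU x y) v = ib x * (dot (sd x) v + 2 * Ek x y * dot (rd0 x y) v - R00 x y * (Ek x y)^2 * dot (VF x y) v)"
  by (simp add: VU_def[abs_def])

lemma HU_dot: "dot (HU x y) v = ib x * (dot (Ds0 x y) v + Ek x y * dot (Dr00 x y) v - R00 x y * (Ek x y)^2 * dot (HF x y) v)
    - 2 * U x y * ib x * (dot (rd x) v + dot (sd x) v)"
  by (simp add: HU_def[abs_def])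

lemma wT_dot: "dot f (wT x y) = U x y * dot f (bu x) - dot f (sg x y)"
  by (simp add: wT_def[abs_def])

lemma zT_dot: "dot f (zT x y) = Fk x y * dot f (bu x) / 2 - dot f (($) y)"
  by (simp add: zT_def[abs_def])

lemma HF_dot:
  assumes xy: "(x, y) \<in> Om"
  shows "dot (HF x y) v = Fk x y * (dot (sd0 x y) v - dot (rd0 x y) v) / be x y"
  by (simp add: HF_def[abs_def])

lemma eliminate:
  assumes xy: "(x, y) \<in> Om"
  shows "b2 x = 1 / ib x" "ib x \<noteq> 0" "U x y = (S0 x y + R00 x y * Ek x y) * ib x"
  using nz(3)[OF xy] by (simp_all add: ib_def U_def field_simps)

text \<open>The trace of s vanishes and the factors 1/\<beta> from dF cancel. What remains is a
  1-form over b^2 and a multiple of \<open>U\<close>; this short form makes both D \<open>Q\<close>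
  and the fibre operator on \<Pi> manageable.\<close>

lemma Q_formula:
  assumes xy: "(x, y) \<in> Om"
  shows "Q x y = (R0 x y + S0 x y) * ib x - (real CARD('n) + 1) * U x y"
proof -
  have "Q x y = dot (VF x y) (wT x y) / 2 + dot (VU x y) (zT x y) - Fk x y / 2 * (\<Sum>m. sud x m m) - real CARD('n) * U x y"
    unfolding Q_def dy_T[OF xy]
    by (simp add: sum.distrib sum_subtractf dot_def sum_distrib_left sum_divide_distrib) (simp add: kron_def)
  also have "\<dots> = (R0 x y + S0 x y) * ib x - (real CARD('n) + 1) * U x y"
    unfolding VU_dot wT_dot zT_dot sud_skew[OF Om_S[OF xy]] VF_dot[OF xy] dot_table[OF xy] Fk_Ek(2)[OF xy] eliminate(1)[OF xy] eliminate(3)[OF xy]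
    using nz(1)[OF xy] Fk_Ek(1)[OF xy] eliminate(2)[OF xy]
    by (simp add: field_simps power2_eq_square)
  finally show ?thesis .
qed

lemma div_bu:
  assumes xy: "(x, y) \<in> Om"
  shows "(\<Sum>m. hv (kron m) (\<lambda>_. 0) (\<lambda>x y. bu x m) x y) + (\<Sum>m k. Gam x m m k * bu x k) = tr x"
proof -
  have "Dbu x m m = hv (kron m) (\<lambda>_. 0) (\<lambda>x y. bu x m) x y + (\<Sum>k. Gam x m m k * bu x k)" for m
    using xy by (simp add: cov_u_def hv_base Gam_sym[of x y m _ m])
  then have "(\<Sum>m. Dbu x m m)
      = (\<Sum>m. hv (kron m) (\<lambda>_. 0) (\<lambda>x y. bu x m) x y) + (\<Sum>m k. Gam x m m k * bu x k)"
    by (simp add: sum.distrib)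
  moreover have "(\<Sum>m. Dbu x m m) = tr x"
    by (simp add: cov_bu[OF xy] sum.distrib sud_skew[OF Om_S[OF xy]] tr_def)
  ultimately show ?thesis by simp
qed

lemma div_sg:
  assumes xy: "(x, y) \<in> Om"
  shows "(\<Sum>m. hv (kron m) (\<lambda>_. 0) (\<lambda>x y. sg x y m) x y) + (\<Sum>m k. Gam x m m k * sg x y k) = dsg x y"
proof -
  have "hv (kron m) (\<lambda>_. 0) (\<lambda>x y. sg x y m) x y + (\<Sum>k. Gam x m m k * sg x y k)
      = (\<Sum>j. Dsud x m j m * y $ j)" for m
  proof -
    have 1: "hv (kron m) (\<lambda>_. 0) (\<lambda>x y. sg x y m) x y = (\<Sum>j. cov_d a (\<lambda>x. sud x m) x j m * y $ j)"
      unfolding sg_def using hv_linear[of "\<lambda>x. sud x m" x y "kron m" "\<lambda>_. 0"] xy by simp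
    have 2: "(\<Sum>k. Gam x m m k * sg x y k) = (\<Sum>j. (\<Sum>k. Gam x m k m * sud x k j) * y $ j)"
      unfolding sg_def sum_distribs
      by (subst sum.swap) (simp add: Gam_sym[OF xy, of m _ m] mult_ac)
    show ?thesis unfolding 1 2 by (simp add: cov_ud_def cov_d_def sum.distrib[symmetric] distrib_right[symmetric] diff_add_eq)
  qed
  then show ?thesis by (simp add: dsg_def sum.distrib[symmetric])
qed

lemma divT_formula:
  assumes xy: "(x, y) \<in> Om"
  shows "divT x y = (U x y * dot (HF x y) (bu x) + Fk x y * dot (HU x y) (bu x)) / 2 + Fk x y * U x y * tr x / 2
    - dot (HF x y) (sg x y) / 2 - Fk x y * dsg x y / 2 - dot (HU x y) (($) y)"
proof -
  have 1: "hv (kron m) (\<lambda>_. 0) (Tk m) x y =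
      (U x y * (HF x y m * bu x m) + Fk x y * (HU x y m * bu x m)) / 2
      + Fk x y * U x y / 2 * hv (kron m) (\<lambda>_. 0) (\<lambda>x y. bu x m) x y
      - HF x y m * sg x y m / 2 - Fk x y / 2 * hv (kron m) (\<lambda>_. 0) (\<lambda>x y. sg x y m) x y
      - HU x y m * y $ m + U x y * N x y m m" for m
    unfolding Tk_def[abs_def] using xy
    by (simp add: hv_diff hv_cdivide hv_mult hv_F hv_U hv_coord) (simp add: field_simps)
  have NG: "(\<Sum>m. N x y m m) = (\<Sum>m k. Gam x m m k * y $ k)" by (simp add: N_def)
  have 2: "(\<Sum>m k. Gam x m m k * Tk k x y)
      = Fk x y * U x y / 2 * (\<Sum>m k. Gam x m m k * bu x k)
        - Fk x y / 2 * (\<Sum>m k. Gam x m m k * sg x y k)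
        - U x y * (\<Sum>m. N x y m m)"
    unfolding NG
    by (simp add: Tk_def right_diff_distrib sum_subtractf sum_distrib_left sum_divide_distrib mult_ac)
  have 3: "(\<Sum>m. hv (kron m) (\<lambda>_. 0) (Tk m) x y) =
      (U x y * dot (HF x y) (bu x) + Fk x y * dot (HU x y) (bu x)) / 2
      + Fk x y * U x y / 2 * (\<Sum>m. hv (kron m) (\<lambda>_. 0) (\<lambda>x y. bu x m) x y)
      - dot (HF x y) (sg x y) / 2 - Fk x y / 2 * (\<Sum>m. hv (kron m) (\<lambda>_. 0) (\<lambda>x y. sg x y m) x y)
      - dot (HU x y) (($) y) + U x y * (\<Sum>m. N x y m m)"
    unfolding 1 by (simp add: dot_def sum.distrib sum_subtractf sum_distrib_left sum_divide_distrib add_divide_distrib)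
  show ?thesis
    unfolding divT_def 2 3 div_bu[OF xy, symmetric] div_sg[OF xy, symmetric] by (simp add: algebra_simps add_divide_distrib)
qed

section \<open>The trace of the squared derivative matrix of T\<close>

definition "Sm x v i = (\<Sum>j. sud x i j * v j)"

lemma Sm_raise: "Sm x v i = raise_d a (\<lambda>x k. \<Sum>j. sl x k j * v j) x i"
  unfolding Sm_def raise_d_def s_ud_def raise_dd_def sum_distribs
  by (subst sum.swap) (simp add: mult_ac)

lemma Sm_dot:
  assumes xy: "(x, y) \<in> Om"
  shows "dot (yl x y) (Sm x v) = - dot (sd0 x y) v" "dot (bd x) (Sm x v) = dot (sd x) v"
    "dot (VF x y) (Sm x v) = - (2 * dot (sd0 x y) v + Fk x y * dot (sd x) v) / be x y"
    "Sm x (bu x) = (\<lambda>i. - su x i)" "Sm x (($) y) = sg x y"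
proof -
  note x = Om_S[OF xy]
  have ry: "raise_d a (\<lambda>x. yl x y) x = ($) y" using raise_yl[OF x] by auto
  have S: "Sm x v = raise_d a (\<lambda>x k. \<Sum>j. sl x k j * v j) x" by (intro ext Sm_raise)
  show 1: "dot (yl x y) (Sm x v) = - dot (sd0 x y) v"
    unfolding S raise_dot[OF x, of "\<lambda>x. yl x y", symmetric] ry
    using skew_form[of "($) y" x v] by (simp add: dot_def sd0_def mult.commute)
  show 2: "dot (bd x) (Sm x v) = dot (sd x) v"
    unfolding S raise_dot[OF x, of "bd", symmetric]
    using skew_form[of "bu x" x v] by (simp add: dot_def sd_alt b_u_def[symmetric] sum_negf mult.commute)
  show "dot (VF x y) (Sm x v) = - (2 * dot (sd0 x y) v + Fk x y * dot (sd x) v) / be x y"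
    by (simp add: VF_def[abs_def] 1 2 field_simps)
  show "Sm x (bu x) = (\<lambda>i. - su x i)"
    by (intro ext) (simp add: Sm_raise s_u_def raise_d_def sd_alt sum_negf)
  show "Sm x (($) y) = sg x y" by (intro ext) (simp add: Sm_def sg_def)
qed

text \<open>In index notation these ten are, in order, s_m s^m_0, r_m s^m_0, r_{m0} s^m_0, r_{m0}
  s^m, s_m s^m, b^m s_{0|m}, b^m r_{00|m}, s_{0|0}, r_{00|0} and r_{0|0}.\<close>

definition "ssg x y = dot (sd x) (sg x y)"
definition "rsg x y = dot (rd x) (sg x y)"
definition "r0sg x y = dot (rd0 x y) (sg x y)"
definition "r0s x y = dot (rd0 x y) (su x)"
definition "s2 x = dot (sd x) (su x)"
definition "bDs x y = dot (Ds0 x y) (bu x)"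
definition "bDr x y = dot (Dr00 x y) (bu x)"
definition "S00 x y = dot (Ds0 x y) (($) y)"
definition "R000 x y = dot (Dr00 x y) (($) y)"
definition "DR00 x y = dot (Dr0 x y) (($) y)"

lemmas new_atoms = ssg_def[symmetric] rsg_def[symmetric] r0sg_def[symmetric] r0s_def[symmetric]
  s2_def[symmetric] bDs_def[symmetric] bDr_def[symmetric] S00_def[symmetric] R000_def[symmetric] DR00_def[symmetric]

lemma VF_su: "(x, y) \<in> Om \<Longrightarrow> dot (VF x y) (su x) = 2 * S0 x y / be x y"
  by (simp add: VF_def[abs_def] dot_table field_simps)

lemma tr_dT_square:
  assumes xy: "(x, y) \<in> Om"
  shows "(\<Sum>m j. dy j (Tk m) x y * dy m (Tk j) x y) =
    (dot (VF x y) (wT x y) / 2)^2 + (dot (VU x y) (zT x y))^2 + (Fk x y / 2)^2 * tS2 x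
    + real CARD('n) * (U x y)^2 + dot (VF x y) (zT x y) * dot (VU x y) (wT x y)
    - Fk x y / 2 * dot (VF x y) (Sm x (wT x y)) + Fk x y * dot (VU x y) (\<lambda>i. Fk x y * su x i / 2 + sg x y i)
    - U x y * dot (VF x y) (wT x y) - 2 * U x y * dot (VU x y) (zT x y)"
proof -
  have 1: "(\<lambda>i. \<Sum>j. sud x i j * (wT x y j / 2)) = (\<lambda>i. Sm x (wT x y) i / 2)"
    by (simp add: Sm_def sum_divide_distrib)
  have 2: "(\<lambda>i. \<Sum>j. sud x i j * zT x y j) = (\<lambda>i. - (Fk x y * su x i / 2 + sg x y i))"
  proof
    fix i
    have "(\<Sum>j. sud x i j * zT x y j) = Fk x y * Sm x (bu x) i / 2 - Sm x (($) y) i"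
      by (simp add: zT_def Sm_def right_diff_distrib sum_subtractf sum_distrib_left sum_divide_distrib mult_ac)
    then show "(\<Sum>j. sud x i j * zT x y j) = - (Fk x y * su x i / 2 + sg x y i)"
      by (simp add: Sm_dot[OF xy])
  qed
  show ?thesis
    unfolding mtr_square[where M = "\<lambda>m j. dy j (Tk m) x y", OF dy_T[OF xy]] 1 2 sud_skew[OF Om_S[OF xy]]
    by (simp add: mtr_def tS2_def) (simp add: algebra_simps)
qed

lemma vf_scalars:
  assumes xy: "(x, y) \<in> Om"
  shows "vf R0 x y = DR00 x y + Fk x y * rsg x y - Fk x y * U x y * rs x + 2 * U x y * R0 x y"
    "vf S0 x y = S00 x y + Fk x y * ssg x y + 2 * U x y * S0 x y"
    "vf R00 x y = R000 x y + 2 * Fk x y * r0sg x y - 2 * Fk x y * U x y * R0 x y + 4 * U x y * R00 x y"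
    "vf (\<lambda>x y. ib x) x y = - 2 * (ib x)^2 * (R0 x y + S0 x y)"
    "vf U x y = dot (HU x y) (($) y) + Fk x y * dot (VU x y) (sg x y) - Fk x y * U x y * dot (VU x y) (bu x)
      + 2 * U x y * dot (VU x y) (($) y)"
  by (simp_all add: vf_hv[OF xy] hv_scalars[OF xy] hv_U[OF xy] dot_T dot_table[OF xy] new_atoms algebra_simps diff_divide_distrib)

lemma vf_Q:
  assumes xy: "(x, y) \<in> Om"
  shows "vf Q x y = (vf R0 x y + vf S0 x y) * ib x - 2 * (ib x)^2 * (R0 x y + S0 x y)^2 - (real CARD('n) + 1) * vf U x y"
proof -
  have "vf Q x y = vf (\<lambda>x y. (R0 x y + S0 x y) * ib x - (real CARD('n) + 1) * U x y) x y"
    by (rule vf_cong[OF Q_formula xy])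
  also have "\<dots> = (R0 x y + S0 x y) * vf (\<lambda>x y. ib x) x y + (vf R0 x y + vf S0 x y) * ib x - (real CARD('n) + 1) * vf U x y"
    using xy by (simp add: vf_hv hv_diff hv_mult hv_add hv_const)
  finally show ?thesis unfolding vf_scalars(4)[OF xy] by (simp add: power2_eq_square algebra_simps)
qed

text \<open>All factors 1/\<beta> brought in by dF cancel. Hence each power of F has a coefficient
  that is polynomial in y, which is what permits Euler's theorem in the next step.\<close>

lemma kropina_ric:
  assumes xy: "(x, y) \<in> Om"
  shows "spray_ric G x y = Ric00 x y
    + (Fk x y)^2 * (- tS2 x / 4 - s2 x * ib x / 2)
    + Fk x y * (- dsg x y + ib x * bDs x y + (ib x)^2 * (b2 x * tr x - rs x) * S0 x y + (real CARD('n) - 1) * ib x * ssg x y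
      - ib x * r0s x y - ib x * rsg x y)
    + (ib x * bDr x y + (ib x)^2 * (b2 x * tr x - rs x) * R00 x y + (real CARD('n) - 2) * ib x * S00 x y - ib x * DR00 x y
      + 2 * real CARD('n) * ib x * r0sg x y + (ib x)^2 * (- (real CARD('n) - 2) * (S0 x y)^2 + (R0 x y)^2 + (6 - 4 * real CARD('n)) * R0 x y * S0 x y))
    + Ek x y * ((real CARD('n) - 1) * ib x * R000 x y + (real CARD('n) - 1) * (ib x)^2 * R00 x y * (2 * S0 x y - 4 * R0 x y))
    + (Ek x y)^2 * (3 * (real CARD('n) - 1) * (ib x)^2 * (R00 x y)^2)"
  unfolding spray_ric_G[OF xy] tr_dT_square[OF xy] vf_Q[OF xy] vf_scalars[OF xy] divT_formula[OF xy] Ric00_def[symmetric]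
  unfolding HU_dot VU_dot dot_linear wT_dot zT_dot Sm_dot[OF xy] VF_su[OF xy] VF_dot[OF xy] HF_dot[OF xy] dot_table[OF xy] new_atoms
  \<comment> \<open>With F = 1/E, b^2 = 1/\<open>ib\<close> and \<open>U\<close> eliminated, both
    sides are rational expressions in the remaining contractions and agree once denominators are
    cleared.\<close>
  unfolding Fk_Ek(2)[OF xy] eliminate(1)[OF xy] eliminate(3)[OF xy]
  using nz(1)[OF xy] Fk_Ek(1)[OF xy] eliminate(2)[OF xy]
  by (simp add: field_simps power2_eq_square)

section \<open>The second-order operator of the fundamental tensor\<close>

text \<open>The bilinear form belonging to \<open>lap\<close>: its double is the defect in the
  product rule \<open>lap_mult\<close>.\<close>

definition "gm f g x y = (\<Sum>i j. gi i j x y * (dy i f x y * dy j g x y))"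

definition "eu f x y = (\<Sum>i. y $ i * dy i f x y)"

definition "gq x y q = (\<Sum>i j. gi i j x y * q i j)"

definition quad :: "(real^'n \<Rightarrow> 'n \<Rightarrow> 'n \<Rightarrow> real) \<Rightarrow> real^'n \<Rightarrow> real^'n \<Rightarrow> real" where
  "quad q x y = (\<Sum>i j. q x i j * y $ i * y $ j)"

lemma lap_cong: "(\<And>x y. (x, y) \<in> Om \<Longrightarrow> f x y = g x y) \<Longrightarrow> (x, y) \<in> Om \<Longrightarrow> lap f x y = lap g x y"
proof -
  assume fg: "\<And>x y. (x, y) \<in> Om \<Longrightarrow> f x y = g x y" and xy: "(x, y) \<in> Om"
  have "dy i (dy j f) x y = dy i (dy j g) x y" for i j
    by (intro dy_cong[OF _ xy] dy_cong fg)
  then show ?thesis by (simp add: lap_def)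
qed

lemma gq_dyad_sym: "(x, y) \<in> Om \<Longrightarrow> gq x y (\<lambda>i j. q j i) = gq x y q"
  unfolding gq_def by (subst sum.swap) (simp add: gi_symmetric)

lemma gm_gq: "gm f g x y = gq x y (\<lambda>i j. dy i f x y * dy j g x y)"
  by (simp add: gm_def gq_def)

lemma gm_sym: "(x, y) \<in> Om \<Longrightarrow> gm f g x y = gm g f x y"
  unfolding gm_gq by (subst gq_dyad_sym[symmetric]) (simp_all add: mult.commute)

lemma lap_add:
  assumes "sm f" "sm g" and xy: "(x, y) \<in> Om"
  shows "lap (\<lambda>x y. f x y + g x y) x y = lap f x y + lap g x y"
proof -
  have "dy i (dy j (\<lambda>x y. f x y + g x y)) x y = dy i (\<lambda>x y. dy j f x y + dy j g x y) x y" for i j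
    by (rule dy_cong[OF _ xy]) (simp add: assms dy_add)
  then show ?thesis using assms by (simp add: lap_def dy_add distrib_left sum.distrib)
qed

lemma lap_mult:
  assumes "sm f" "sm g" and xy: "(x, y) \<in> Om"
  shows "lap (\<lambda>x y. f x y * g x y) x y = f x y * lap g x y + lap f x y * g x y + 2 * gm f g x y"
proof -
  have "dy i (dy j (\<lambda>x y. f x y * g x y)) x y = dy i (\<lambda>x y. f x y * dy j g x y + dy j f x y * g x y) x y" for i j
    by (rule dy_cong[OF _ xy]) (simp add: assms dy_mult)
  then have "dy i (dy j (\<lambda>x y. f x y * g x y)) x y = f x y * dy i (dy j g) x y + dy i f x y * dy j g x y
      + (dy j f x y * dy i g x y + dy i (dy j f) x y * g x y)" for i j
    using assms by (simp add: dy_add dy_mult)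
  then have "lap (\<lambda>x y. f x y * g x y) x y = f x y * lap g x y + lap f x y * g x y + gm f g x y + gm g f x y"
    by (simp add: lap_def gm_def distrib_left sum.distrib sum_distribs mult_ac)
  then show ?thesis using gm_sym[OF xy, of f g] by simp
qed

lemma gm_base: "gm (\<lambda>x y. c x) f x y = 0"
  by (simp add: gm_def)

lemma lap_base: "(x, y) \<in> Om \<Longrightarrow> lap (\<lambda>x y. c x) x y = 0"
proof -
  assume xy: "(x, y) \<in> Om"
  have "dy i (dy j (\<lambda>x y. c x)) x y = dy i (\<lambda>x y. 0) x y" for i j
    by (rule dy_cong[OF _ xy]) simp
  then show ?thesis by (simp add: lap_def dy_base[of _ "\<lambda>x. 0"])
qed

lemma lap_bmult: "smb c \<Longrightarrow> sm f \<Longrightarrow> (x, y) \<in> Om \<Longrightarrow> lap (\<lambda>x y. c x * f x y) x y = c x * lap f x y"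
  by (simp add: lap_mult gm_base lap_base)

lemma lap_cmult: "sm f \<Longrightarrow> (x, y) \<in> Om \<Longrightarrow> lap (\<lambda>x y. c * f x y) x y = c * lap f x y"
  using lap_bmult[of "\<lambda>_. c"] by simp

lemma lap_minus: "sm f \<Longrightarrow> (x, y) \<in> Om \<Longrightarrow> lap (\<lambda>x y. - f x y) x y = - lap f x y"
  using lap_cmult[of f x y "-1"] by simp

lemma lap_diff: "sm f \<Longrightarrow> sm g \<Longrightarrow> (x, y) \<in> Om \<Longrightarrow> lap (\<lambda>x y. f x y - g x y) x y = lap f x y - lap g x y"
  using lap_add[of f "\<lambda>x y. - g x y" x y] by (simp add: lap_minus)

lemma lap_sum: "(\<And>i. i \<in> I \<Longrightarrow> sm (f i)) \<Longrightarrow> (x, y) \<in> Om \<Longrightarrow>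
    lap (\<lambda>x y. \<Sum>i\<in>I. f i x y) x y = (\<Sum>i\<in>I. lap (f i) x y)"
  by (induction I rule: infinite_finite_induct) (auto simp: lap_base[of _ _ "\<lambda>_. 0"] lap_add)

lemma lap_coord: "(x, y) \<in> Om \<Longrightarrow> lap (\<lambda>x y. y $ i) x y = 0"
proof -
  assume xy: "(x, y) \<in> Om"
  have "dy i (dy j (\<lambda>x y. y $ k)) x y = dy i (\<lambda>x y. kron j k) x y" for i j k
    by (rule dy_cong[OF _ xy]) (simp add: dy_coord)
  then show ?thesis by (simp add: lap_def dy_base[of _ "\<lambda>x. kron a b" for a b])
qed

lemma dy_linear:
  "(\<And>i. smb (\<lambda>x. t x i)) \<Longrightarrow> (x, y) \<in> Om \<Longrightarrow> dy j (\<lambda>x y. \<Sum>i. t x i * y $ i) x y = t x j"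
  by (simp add: dy_sum dy_mult dy_coord)

lemma sm_quad: "(\<And>i j. smb (\<lambda>x. q x i j)) \<Longrightarrow> sm (quad q)"
  unfolding quad_def[abs_def] by simp

lemma dy_quad:
  assumes "\<And>i j. smb (\<lambda>x. q x i j)" "(x, y) \<in> Om"
  shows "dy k (quad q) x y = (\<Sum>i. (q x k i + q x i k) * y $ i)"
proof -
  have "dy k (quad q) x y = (\<Sum>i j. q x i j * y $ i * kron k j + q x i j * kron k i * y $ j)"
    unfolding quad_def[abs_def] using assms by (simp add: dy_sum dy_mult dy_coord)
  also have "\<dots> = (\<Sum>i. q x i k * y $ i) + (\<Sum>j i. kron k i * (q x i j * y $ j))"
    using sum.swap[of "\<lambda>i j. kron k i * (q x i j * y $ j)" UNIV UNIV]
    by (simp only: sum.distrib sum_kron mult.commute[of _ "kron k _"] mult.assoc)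
  finally show ?thesis by (simp add: distrib_right sum.distrib)
qed

lemma lap_quad:
  assumes q: "\<And>i j. smb (\<lambda>x. q x i j)" and xy: "(x, y) \<in> Om"
  shows "lap (quad q) x y = 2 * gq x y (q x)"
proof -
  have "dy i (dy j (quad q)) x y = q x j i + q x i j" for i j
  proof -
    have "dy i (dy j (quad q)) x y = dy i (\<lambda>x y. \<Sum>k. (q x j k + q x k j) * y $ k) x y"
      by (rule dy_cong[OF dy_quad[OF q] xy])
    then show ?thesis using q xy by (simp add: dy_linear[of "\<lambda>x k. q x j k + q x k j"])
  qed
  then have "lap (quad q) x y = gq x y (\<lambda>i j. q x j i) + gq x y (q x)"
    by (simp add: lap_def gq_def distrib_left sum.distrib)
  then show ?thesis using gq_dyad_sym[OF xy, of "q x"] by simp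
qed

section \<open>The Euler operator\<close>

lemma eu_dv: "(x, y) \<in> Om \<Longrightarrow> sm f \<Longrightarrow> eu f x y = dv (\<lambda>_. 0) (\<lambda>i. y $ i) f x y"
  by (simp add: eu_def dv_dx_dy)

lemma eu_mult: "sm f \<Longrightarrow> sm g \<Longrightarrow> (x, y) \<in> Om \<Longrightarrow> eu (\<lambda>x y. f x y * g x y) x y = f x y * eu g x y + eu f x y * g x y"
  by (simp add: eu_dv dv_mult)

lemma eu_add: "sm f \<Longrightarrow> sm g \<Longrightarrow> (x, y) \<in> Om \<Longrightarrow> eu (\<lambda>x y. f x y + g x y) x y = eu f x y + eu g x y"
  by (simp add: eu_dv dv_add)

lemma eu_diff: "sm f \<Longrightarrow> sm g \<Longrightarrow> (x, y) \<in> Om \<Longrightarrow> eu (\<lambda>x y. f x y - g x y) x y = eu f x y - eu g x y"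
  by (simp add: eu_dv dv_diff)

lemma eu_minus: "sm f \<Longrightarrow> (x, y) \<in> Om \<Longrightarrow> eu (\<lambda>x y. - f x y) x y = - eu f x y"
  by (simp add: eu_dv dv_minus)

lemma eu_sum: "(\<And>i. i \<in> I \<Longrightarrow> sm (f i)) \<Longrightarrow> (x, y) \<in> Om \<Longrightarrow>
    eu (\<lambda>x y. \<Sum>i\<in>I. f i x y) x y = (\<Sum>i\<in>I. eu (f i) x y)"
  by (simp add: eu_dv dv_sum)

lemma eu_base: "eu (\<lambda>x y. c x) x y = 0"
  by (simp add: eu_def)

lemma eu_quad:
  assumes q: "\<And>i j. smb (\<lambda>x. q x i j)" and xy: "(x, y) \<in> Om"
  shows "eu (quad q) x y = 2 * quad q x y"
proof -
  have "(\<Sum>i j. q x j i * y $ i * y $ j) = quad q x y"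
    unfolding quad_def by (subst sum.swap) (simp add: mult_ac)
  moreover have "eu (quad q) x y = quad q x y + (\<Sum>i j. q x j i * y $ i * y $ j)"
    by (simp add: eu_def dy_quad[OF q xy] quad_def sum_distrib_left distrib_left distrib_right sum.distrib mult_ac)
  ultimately show ?thesis by simp
qed

text \<open>By \<open>gi_VF\<close> the gradient of F in the fibre is y/F, so pairing with F only
  measures the degree of homogeneity.\<close>

lemma gm_F:
  assumes xy: "(x, y) \<in> Om"
  shows "gm Fk f x y = Ek x y * eu f x y"
proof -
  have "gm Fk f x y = (\<Sum>j. (\<Sum>i. gi j i x y * VF x y i) * dy j f x y)"
    unfolding gm_def dy_Fk[OF xy] sum_distrib_right by (subst sum.swap) (simp add: gi_symmetric[OF xy] mult_ac)
  from this[unfolded gi_VF[OF xy]] show ?thesis by (simp add: eu_def sum_distrib_left mult_ac)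
qed

lemma eu_F: "(x, y) \<in> Om \<Longrightarrow> eu Fk x y = Fk x y"
  using VF_dot(1)[of x y] by (simp add: eu_def dy_Fk dot_def mult.commute)

lemma dy_E: "(x, y) \<in> Om \<Longrightarrow> dy j Ek x y = - ((Ek x y)^2 * VF x y j)"
  by (simp add: dy_hv hv_E hv_F)

lemma eu_E: "(x, y) \<in> Om \<Longrightarrow> eu Ek x y = - Ek x y"
proof -
  assume xy: "(x, y) \<in> Om"
  have "eu Ek x y = - ((Ek x y)^2 * eu Fk x y)"
    by (simp add: eu_def dy_E[OF xy] dy_Fk[OF xy] sum_distrib_left sum_negf[symmetric] mult_ac)
  also have "\<dots> = - (Ek x y * (Fk x y * Ek x y))" by (simp add: eu_F[OF xy] power2_eq_square)
  finally show ?thesis by (simp add: nz(4)[OF xy])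
qed

lemma gm_E:
  assumes xy: "(x, y) \<in> Om"
  shows "gm Ek f x y = - ((Ek x y)^3 * eu f x y)"
proof -
  have "gm Ek f x y = - ((Ek x y)^2 * gm Fk f x y)"
    by (simp add: gm_def dy_E[OF xy] dy_Fk[OF xy] sum_distrib_left sum_negf mult_ac)
  then show ?thesis by (simp add: gm_F[OF xy] power2_eq_square power3_eq_cube)
qed

text \<open>\<Delta>(F^2) = 2 g^{ij} g_{ij} = 2n, while the product rule gives 2 F \<Delta>F + 2.
  Applying \<Delta> to F E = 1 yields \<open>lap_E\<close> in the same way.\<close>

lemma lap_F:
  assumes xy: "(x, y) \<in> Om"
  shows "lap Fk x y = (real CARD('n) - 1) * Ek x y"
proof -
  have "lap L x y = (\<Sum>i. 2 * (\<Sum>j. gi i j x y * (1/2 * dy i (dy j L) x y)))"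
    by (simp add: lap_def sum_distrib_left)
  also have "\<dots> = 2 * real CARD('n)"
    unfolding gi_inverse[OF xy] by (simp add: kron_def)
  finally have "2 * real CARD('n) = lap (\<lambda>x y. Fk x y * Fk x y) x y" by (simp add: L_def[abs_def])
  also have "\<dots> = 2 * (Fk x y * lap Fk x y) + 2 * (Fk x y * Ek x y)"
    using xy by (simp add: lap_mult gm_F eu_F mult.commute)
  finally have "Fk x y * lap Fk x y = real CARD('n) - 1" by (simp add: nz(4)[OF xy])
  then have "Ek x y * (Fk x y * lap Fk x y) = Ek x y * (real CARD('n) - 1)" by simp
  then have "(Fk x y * Ek x y) * lap Fk x y = (real CARD('n) - 1) * Ek x y" by (simp add: mult_ac)
  then show ?thesis by (simp add: nz(4)[OF xy])
qed

lemma lap_E: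
  assumes xy: "(x, y) \<in> Om"
  shows "lap Ek x y = (3 - real CARD('n)) * (Ek x y)^3"
proof -
  have "lap (\<lambda>x y. Fk x y * Ek x y) x y = lap (\<lambda>x y. 1) x y"
    by (rule lap_cong[OF _ xy]) (rule nz(4))
  then have "Fk x y * lap Ek x y + (real CARD('n) - 1) * Ek x y * Ek x y - 2 * (Ek x y * Ek x y) = 0"
    using xy by (simp add: lap_mult lap_base[of _ _ "\<lambda>_. 1"] gm_F eu_E lap_F)
  then have "Fk x y * lap Ek x y = (3 - real CARD('n)) * (Ek x y * Ek x y)"
    by (simp add: algebra_simps)
  then have "Ek x y * (Fk x y * lap Ek x y) = Ek x y * ((3 - real CARD('n)) * (Ek x y * Ek x y))"
    by (simp only:)
  then have "(Fk x y * Ek x y) * lap Ek x y = (3 - real CARD('n)) * (Ek x y)^3"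
    by (simp add: mult_ac power3_eq_cube)
  then show ?thesis by (simp add: nz(4)[OF xy])
qed

text \<open>The cross term of the product rule is an Euler derivative, so a factor F or 1/F is
  handled by the degree d alone. Repeated use gives the higher powers.\<close>

lemma lap_homogeneous:
  assumes f: "sm f" and e: "eu f x y = d * f x y" and xy: "(x, y) \<in> Om"
  shows "lap (\<lambda>x y. Fk x y * f x y) x y = (real CARD('n) - 1 + 2 * d) * Ek x y * f x y + Fk x y * lap f x y"
    and "lap (\<lambda>x y. Ek x y * f x y) x y = (3 - real CARD('n) - 2 * d) * (Ek x y)^3 * f x y + Ek x y * lap f x y"
  using f xy by (simp_all add: lap_mult gm_F gm_E lap_F lap_E e) (simp_all add: algebra_simps)

section \<open>The parts of a contraction with the inverse fundamental tensor\<close>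

definition "tra x q = (\<Sum>i j. ai x i j * q i j)"

definition bil :: "('n \<Rightarrow> 'n \<Rightarrow> real) \<Rightarrow> ('n \<Rightarrow> real) \<Rightarrow> ('n \<Rightarrow> real) \<Rightarrow> real" where
  "bil q u v = (\<Sum>i j. q i j * u i * v j)"

lemma gq_expand: "gq x y q = c1 x y * tra x q + c2 x y * bil q (bu x) (bu x)
    + c3 x y * (bil q (bu x) (($) y) + bil q (($) y) (bu x)) + c4 x y * bil q (($) y) (($) y)"
  by (simp add: gq_def gi_def tra_def bil_def distrib_left distrib_right sum.distrib sum_distrib_left mult_ac)

lemma bil_dot: "bil q u v = (\<Sum>j. v j * (\<Sum>i. q i j * u i))"
  unfolding bil_def sum_distrib_left by (subst sum.swap) (simp add: mult_ac)

lemma bil_dyad: "bil (\<lambda>i j. f i * g j) u v = dot f u * dot g v"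
  by (simp add: bil_def dot_def sum_distribs mult_ac) (subst sum.swap, simp add: mult_ac)

lemma tra_dyad: "tra x (\<lambda>i j. f i * g j) = dot f (raise_d a (\<lambda>_. g) x)"
  by (simp add: tra_def dot_def raise_d_def sum_distrib_left mult_ac)

lemma gq_dyad: "gq x y (\<lambda>i j. f i * g j) = c1 x y * dot f (raise_d a (\<lambda>_. g) x)
    + c2 x y * (dot f (bu x) * dot g (bu x))
    + c3 x y * (dot f (bu x) * dot g (($) y) + dot f (($) y) * dot g (bu x))
    + c4 x y * (dot f (($) y) * dot g (($) y))"
  by (simp add: gq_expand bil_dyad tra_dyad)

section \<open>Contractions of second order in b\<close>

lemma smb_cov_dd [intro, simp]: "(\<And>i j. smb (\<lambda>x. t x i j)) \<Longrightarrow> smb (\<lambda>x. cov_dd a t x i j k)"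
  unfolding cov_dd_def by (intro sm_diff sm_sum sm_mult smb_partial smb_Gam) auto

lemma smb_cov_ud [intro, simp]: "(\<And>i j. smb (\<lambda>x. t x i j)) \<Longrightarrow> smb (\<lambda>x. cov_ud a t x i j k)"
  unfolding cov_ud_def by (intro sm_add sm_diff sm_sum sm_mult smb_partial smb_Gam) auto

lemma smb_ricci [intro, simp]: "smb (\<lambda>x. Ric x i j)"
  unfolding riemann_ricci_def riemann_curv_def
  by (intro sm_add sm_diff sm_sum sm_mult smb_partial smb_Gam)

lemma smb_su [intro, simp]: "smb (\<lambda>x. su x i)" and smb_ru [intro, simp]: "smb (\<lambda>x. ru x i)"
  unfolding s_u_def r_u_def by (intro smb_raise_d smb_r_d smb_s_d)+

lemma sm_atoms [intro, simp]:
  "smb tS2" "smb s2" "sm dsg" "sm Ric00" "sm (\<lambda>x y. Dr0 x y k)" "sm (\<lambda>x y. Ds0 x y k)" "sm (\<lambda>x y. Dr00 x y k)"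
  "sm bDs" "sm bDr" "sm ssg" "sm rsg" "sm r0sg" "sm r0s" "sm S00" "sm R000" "sm DR00"
proof -
  show "smb tS2" unfolding tS2_def by (intro sm_sum sm_mult smb_s_ud)
  show "smb s2" unfolding s2_def dot_def by (intro sm_sum sm_mult smb_s_d smb_su)
  show "sm dsg" unfolding dsg_def[abs_def] by (intro sm_sum sm_mult smb_cov_ud smb_s_ud sm_coord)
  show "sm Ric00" unfolding Ric00_def[abs_def] by (intro sm_sum sm_mult smb_ricci sm_coord)
  show 1: "sm (\<lambda>x y. Dr0 x y k)" for k unfolding Dr0_def by (intro sm_sum sm_mult smb_cov_d smb_r_d sm_coord)
  show 2: "sm (\<lambda>x y. Ds0 x y k)" for k unfolding Ds0_def by (intro sm_sum sm_mult smb_cov_d smb_s_d sm_coord)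
  show 3: "sm (\<lambda>x y. Dr00 x y k)" for k unfolding Dr00_def by (intro sm_sum sm_mult smb_cov_dd smb_r_dd sm_coord)
  show "sm bDs" unfolding bDs_def[abs_def] dot_def by (intro sm_sum sm_mult 2 smb_b_u)
  show "sm bDr" unfolding bDr_def[abs_def] dot_def by (intro sm_sum sm_mult 3 smb_b_u)
  show "sm ssg" unfolding ssg_def[abs_def] dot_def by (intro sm_sum sm_mult smb_s_d sm_scalars)
  show "sm rsg" unfolding rsg_def[abs_def] dot_def by (intro sm_sum sm_mult smb_r_d sm_scalars)
  show "sm r0sg" unfolding r0sg_def[abs_def] dot_def by (intro sm_sum sm_mult sm_scalars)
  show "sm r0s" unfolding r0s_def[abs_def] dot_def by (intro sm_sum sm_mult sm_scalars smb_su)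
  show "sm S00" unfolding S00_def[abs_def] dot_def by (intro sm_sum sm_mult 2 sm_coord)
  show "sm R000" unfolding R000_def[abs_def] dot_def by (intro sm_sum sm_mult 3 sm_coord)
  show "sm DR00" unfolding DR00_def[abs_def] dot_def by (intro sm_sum sm_mult 1 sm_coord)
qed

text \<open>In index notation the scalars down to \<open>b_Dr0\<close> are r_m r^m, r^m s_m, r_{m0}
  r^m, r_{m0} r^m_0, the bb and twice-symmetrised b0 components of the Ricci tensor of \<alpha>, b^m
  r^k_{k|m}, s^m_{|m}, r^m_{|m}, b^m r_{0|m}, r^m_{m|0}, r^m_{0|m}, b^i b^k r_{i|k} and b^i
  r_{i|0}.\<close>

definition "r2 x = dot (rd x) (ru x)"
definition "rsd x = dot (ru x) (sd x)"
definition "r0r x y = dot (rd0 x y) (ru x)"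
definition "rr0 x y = dot (rd0 x y) (ru0 x y)"
definition "Rbb x = (\<Sum>k l. bu x k * bu x l * Ric x k l)"
definition "Rb0 x y = (\<Sum>k l. (bu x k * y $ l + bu x l * y $ k) * Ric x k l)"
definition "btr x = (\<Sum>m k. bu x m * Drud x k k m)"
definition "dsu x = (\<Sum>m. cov_u a su x m m)"
definition "dru x = (\<Sum>m. cov_u a ru x m m)"
definition "bDr0 x y = dot (Dr0 x y) (bu x)"
definition "tr0 x y = (\<Sum>m j. Drud x m m j * y $ j)"
definition "dr0 x y = (\<Sum>m j. Drud x m j m * y $ j)"
definition "bbDr x = bil (Drd x) (bu x) (bu x)"
definition "b_Dr0 x y = bil (Drd x) (bu x) (($) y)"

definition "tri x u v w = (\<Sum>i j k. Drdd x i j k * u i * v j * w k)"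

lemma Drdd_sym: "Drdd x i j k = Drdd x j i k"
proof -
  have "(\<lambda>z. rl z i j) = (\<lambda>z. rl z j i)" by (intro ext r_sym)
  moreover have "(\<Sum>l. Gam x l i k * rl x l j) = (\<Sum>l. Gam x l i k * rl x j l)" for i j
    by (intro sum.cong refl arg_cong2[where f="(*)"] r_sym)
  ultimately show ?thesis unfolding cov_dd_def by simp
qed

lemma tri_sym: "tri x u v w = tri x v u w"
  unfolding tri_def by (subst sum.swap) (simp add: Drdd_sym[of x _ _ k for k] mult_ac)

definition "Cb x v j = (\<Sum>k. Dbu x j k * v k)"

lemma r_ud_raise: "(\<Sum>k. rud x j k * v k) = raise_d a (\<lambda>_ i. \<Sum>k. rl x i k * v k) x j"
  unfolding raise_d_def r_ud_def raise_dd_def sum_distribs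
  by (subst sum.swap) (simp add: mult_ac)

lemma Cb_values:
  assumes xy: "(x, y) \<in> Om"
  shows "Cb x (($) y) = (\<lambda>j. ru0 x y j + sg x y j)"
    "Cb x (bu x) = (\<lambda>j. ru x j - su x j)"
proof -
  have C: "Cb x v j = raise_d a (\<lambda>_ i. \<Sum>k. rl x i k * v k) x j + Sm x v j" for v j
    unfolding Cb_def cov_bu[OF xy] r_ud_raise[symmetric] Sm_def by (simp add: distrib_right sum.distrib)
  show "Cb x (($) y) = (\<lambda>j. ru0 x y j + sg x y j)"
    by (intro ext) (simp add: C Sm_dot[OF xy] rd0_def[abs_def])
  show "Cb x (bu x) = (\<lambda>j. ru x j - su x j)"
    by (intro ext) (simp add: C Sm_dot[OF xy] r_u_def raise_d_def rd_alt)
qed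

text \<open>The Leibniz rule for r_i = r_{ij} b^j, solved for b^j r_{ij|k}. The operator produces
  such contractions, whereas the final formula is expressed through derivatives of r_i.\<close>

lemma tri_b:
  assumes xy: "(x, y) \<in> Om"
  shows "tri x u (bu x) w = bil (Drd x) u w - dot (\<lambda>j. \<Sum>i. rl x j i * u i) (Cb x w)"
proof -
  have D: "Drd x i k = (\<Sum>j. Dbu x j k * rl x i j) + (\<Sum>j. bu x j * Drdd x i j k)" for i k
    using cov_d_contract[of "bu" "rl" x y i k] xy by (simp add: r_d_def[abs_def])
  have 1: "(\<Sum>i k. (\<Sum>j. Dbu x j k * rl x i j) * u i * w k)
      = dot (\<lambda>j. \<Sum>i. rl x j i * u i) (Cb x w)"
  proof -
    have "(\<Sum>i k. (\<Sum>j. Dbu x j k * rl x i j) * u i * w k)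
        = (\<Sum>i k j. Dbu x j k * rl x j i * u i * w k)"
      by (simp add: sum_distrib_right r_sym[of x])
    also have "\<dots> = (\<Sum>i j k. Dbu x j k * rl x j i * u i * w k)"
      by (rule sum.cong[OF refl], rule sum.swap)
    also have "\<dots> = (\<Sum>j i k. Dbu x j k * rl x j i * u i * w k)"
      by (rule sum.swap)
    also have "\<dots> = (\<Sum>j k i. Dbu x j k * rl x j i * u i * w k)"
      by (rule sum.cong[OF refl], rule sum.swap)
    finally show ?thesis by (simp add: dot_def Cb_def sum_distribs mult_ac)
  qed
  have 2: "(\<Sum>i k. (\<Sum>j. bu x j * Drdd x i j k) * u i * w k) = tri x u (bu x) w"
    unfolding tri_def sum_distrib_right by (rule sum.cong[OF refl], subst sum.swap) (simp add: mult_ac)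
  have "bil (Drd x) u w = dot (\<lambda>j. \<Sum>i. rl x j i * u i) (Cb x w) + tri x u (bu x) w"
    unfolding bil_def D distrib_right sum.distrib 1 2 ..
  then show ?thesis by simp
qed

lemma raise_dot_at: "x \<in> S \<Longrightarrow> dot f (raise_d a (\<lambda>_. g) x) = dot (raise_d a (\<lambda>_. f) x) g"
  using raise_dot[of x "\<lambda>_. f" "\<lambda>_. g"] by simp

lemma raised:
  "raise_d a (\<lambda>_. rd x) x = ru x" "raise_d a (\<lambda>_. sd x) x = su x"
  by (auto simp: raise_d_def r_u_def s_u_def)

lemma more_dots:
  assumes xy: "(x, y) \<in> Om"
  shows "dot (rd x) (ru0 x y) = r0r x y"
    "dot (sd x) (ru0 x y) = r0s x y"
    "dot (rd x) (su x) = rsd x" "dot (sd x) (ru x) = rsd x"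
    "dot (ru0 x y) (sd x) = r0s x y"
    "dot (ru0 x y) (rd x) = r0r x y"
proof -
  note R = raise_dot_at[OF Om_S[OF xy]]
  show 1: "dot (rd x) (ru0 x y) = r0r x y"
    by (simp add: R[of "rd x"] raised r0r_def dot_commute)
  show 2: "dot (sd x) (ru0 x y) = r0s x y"
    by (simp add: R[of "sd x"] raised r0s_def dot_commute)
  show "dot (ru0 x y) (sd x) = r0s x y"
    "dot (ru0 x y) (rd x) = r0r x y"
    using 1 2 by (simp_all add: dot_commute)
  show "dot (rd x) (su x) = rsd x"
    using R[of "rd x" "sd x"] by (simp add: raised rsd_def)
  show "dot (sd x) (ru x) = rsd x"
    by (simp add: rsd_def dot_commute)
qed

lemma rr_values: "(\<lambda>j. \<Sum>i. rl x j i * y $ i) = rd0 x y" "(\<lambda>j. \<Sum>i. rl x j i * bu x i) = rd x"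
  by (auto simp: rd0_def rd_alt)

lemma bil_Drd: "bil (Drd x) (($) y) v = dot (Dr0 x y) v" "bil (Dsd x) (($) y) v = dot (Ds0 x y) v"
  by (simp_all add: bil_dot dot_def Dr0_def Ds0_def sum_distribs mult_ac)

lemma tri_values:
  assumes xy: "(x, y) \<in> Om"
  shows "tri x (($) y) (bu x) (($) y) = DR00 x y - rr0 x y - r0sg x y"
    "tri x (bu x) (($) y) (($) y) = DR00 x y - rr0 x y - r0sg x y"
    "tri x (($) y) (bu x) (bu x) = bDr0 x y - r0r x y + r0s x y"
    "tri x (bu x) (($) y) (bu x) = bDr0 x y - r0r x y + r0s x y"
    "tri x (bu x) (bu x) (($) y) = b_Dr0 x y - r0r x y - rsg x y"
    "tri x (bu x) (bu x) (bu x) = bbDr x - r2 x + rsd x"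
    "tri x (($) y) (($) y) (bu x) = bDr x y" "tri x (($) y) (($) y) (($) y) = R000 x y"
proof -
  show 1: "tri x (($) y) (bu x) (($) y) = DR00 x y - rr0 x y - r0sg x y"
    unfolding tri_b[OF xy] rr_values Cb_values[OF xy] bil_Drd by (simp add: DR00_def rr0_def r0sg_def)
  show 2: "tri x (($) y) (bu x) (bu x) = bDr0 x y - r0r x y + r0s x y"
    unfolding tri_b[OF xy] rr_values Cb_values[OF xy] bil_Drd by (simp add: bDr0_def r0r_def r0s_def)
  show "tri x (bu x) (($) y) (($) y) = DR00 x y - rr0 x y - r0sg x y"
    "tri x (bu x) (($) y) (bu x) = bDr0 x y - r0r x y + r0s x y"
    by (subst tri_sym, fact)+
  show "tri x (bu x) (bu x) (($) y) = b_Dr0 x y - r0r x y - rsg x y"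
    unfolding tri_b[OF xy] rr_values Cb_values[OF xy] by (simp add: more_dots[OF xy] b_Dr0_def rsg_def)
  show "tri x (bu x) (bu x) (bu x) = bbDr x - r2 x + rsd x"
    unfolding tri_b[OF xy] rr_values Cb_values[OF xy] by (simp add: more_dots[OF xy] bbDr_def r2_def)
  have T: "tri x (($) y) (($) y) v = dot (Dr00 x y) v" for v
  proof -
    have "tri x (($) y) (($) y) v = (\<Sum>i k j. Drdd x i j k * y $ i * y $ j * v k)"
      unfolding tri_def by (rule sum.cong[OF refl], rule sum.swap)
    also have "\<dots> = (\<Sum>k i j. Drdd x i j k * y $ i * y $ j * v k)"
      by (rule sum.swap)
    finally show ?thesis by (simp add: dot_def Dr00_def sum_distrib_right)
  qed
  show "tri x (($) y) (($) y) (bu x) = bDr x y" "tri x (($) y) (($) y) (($) y) = R000 x y"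
    by (simp_all add: T bDr_def R000_def)
qed

text \<open>The identity b^i s_i = 0 is differentiated, which moves the derivative from s onto
  b.\<close>

lemma bil_Dsd:
  assumes xy: "(x, y) \<in> Om"
  shows "bil (Dsd x) (bu x) v = - dot (Cb x v) (sd x)"
proof -
  have 0: "(\<Sum>i. Dbu x i k * sd x i) + (\<Sum>i. bu x i * Dsd x i k) = 0" for k
  proof -
    have "(\<Sum>i. bu z i * sd z i) = 0" for z
      using skew_form_self[of "bu z" z] by (simp add: sd_alt sum_negf)
    then show ?thesis
      using partial_pairing[of "bu" "sd" x y k] xy by (simp add: pd_const)
  qed
  have 1: "(\<Sum>i. bu x i * Dsd x i k) = - (\<Sum>i. Dbu x i k * sd x i)" for k
    using 0[of k] by linarith
  have "bil (Dsd x) (bu x) v = (\<Sum>k. v k * (\<Sum>i. bu x i * Dsd x i k))"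
    by (simp add: bil_dot mult.commute)
  also have "\<dots> = - (\<Sum>k. v k * (\<Sum>i. Dbu x i k * sd x i))"
    unfolding 1 by (simp add: sum_negf)
  also have "(\<Sum>k. v k * (\<Sum>i. Dbu x i k * sd x i)) = dot (Cb x v) (sd x)"
    unfolding dot_def Cb_def sum_distribs by (subst sum.swap) (simp add: mult_ac)
  finally show ?thesis .
qed

text \<open>r is symmetric and s is skew, so the trace equals its own negative.\<close>

lemma trace_r_s:
  assumes x: "x \<in> S"
  shows "(\<Sum>k m. rud x k m * sud x m k) = 0"
proof -
  define f where "f i j m q = ai x i j * rl x j m * ai x m q * sl x q i" for i j m q
  \<comment> \<open>Reversing the order of all four indices transposes r and s
    simultaneously.\<close>
  have sum4: "(\<Sum>i j. \<Sum>m q. g i j m q)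
      = (\<Sum>i j. \<Sum>m q. g q m j i)" for g :: "'n \<Rightarrow> 'n \<Rightarrow> 'n \<Rightarrow> 'n \<Rightarrow> real"
  proof -
    have "(\<Sum>i j. \<Sum>m q. g q m j i)
        = (\<Sum>i j. \<Sum>q m. g q m j i)"
      by (intro sum.cong refl sum.swap)
    also have "\<dots> = (\<Sum>i q. \<Sum>j m. g q m j i)"
      by (intro sum.cong refl sum.swap)
    also have "\<dots> = (\<Sum>q i. \<Sum>j m. g q m j i)" by (rule sum.swap)
    also have "\<dots> = (\<Sum>q i. \<Sum>m j. g q m j i)"
      by (intro sum.cong refl sum.swap)
    also have "\<dots> = (\<Sum>q m. \<Sum>i j. g q m j i)"
      by (intro sum.cong refl sum.swap)
    also have "\<dots> = (\<Sum>q m. \<Sum>j i. g q m j i)"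
      by (intro sum.cong refl sum.swap)
    finally show ?thesis by simp
  qed
  have X: "(\<Sum>k m. rud x k m * sud x m k) = (\<Sum>i j. \<Sum>m q. f i j m q)"
  proof -
    have "(\<Sum>k m. rud x k m * sud x m k) = (\<Sum>i m. \<Sum>j q. f i j m q)"
      by (simp add: r_ud_def s_ud_def raise_dd_def sum_product f_def mult_ac)
    also have "\<dots> = (\<Sum>i j. \<Sum>m q. f i j m q)"
      by (intro sum.cong refl sum.swap)
    finally show ?thesis .
  qed
  have g: "f q m j i = - f i j m q" for i j m q
    unfolding f_def using s_skew[of x i q] r_sym[of x m j] ai_sym[OF x] by (simp add: mult_ac)
  have "(\<Sum>i j. \<Sum>m q. f i j m q)
      = (\<Sum>i j. \<Sum>m q. f q m j i)"
    by (rule sum4)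
  also have "\<dots> = (\<Sum>i j. \<Sum>m q. - f i j m q)"
    by (intro sum.cong refl g)
  also have "\<dots> = - (\<Sum>i j. \<Sum>m q. f i j m q)"
    by (simp only: sum_negf)
  finally have "(\<Sum>i j. \<Sum>m q. f i j m q)
      = - (\<Sum>i j. \<Sum>m q. f i j m q)" .
  then show ?thesis unfolding X by linarith
qed

section \<open>The operator on contractions\<close>

lemma gq_rl:
  assumes xy: "(x, y) \<in> Om"
  shows "gq x y (rl x) = c1 x y * tr x + c2 x y * rs x + 2 * c3 x y * R0 x y + c4 x y * R00 x y"
proof -
  have "tra x (rl x) = tr x"
    by (simp add: tra_def tr_def r_ud_def raise_dd_def r_sym[of x])
  moreover have "bil (rl x) (bu x) v = dot (rd x) v" for v
    by (simp add: bil_dot dot_def r_d_def sum_distribs r_sym[of x] mult_ac)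
  moreover have "bil (rl x) (($) y) v = dot (rd0 x y) v" for v
    by (simp add: bil_dot dot_def rd0_def sum_distribs r_sym[of x] mult_ac)
  ultimately show ?thesis by (simp add: gq_expand dot_table[OF xy] algebra_simps)
qed

lemma gq_Ric: "gq x y (Ric x) = c1 x y * riemann_scalar a x + c2 x y * Rbb x + c3 x y * Rb0 x y + c4 x y * Ric00 x y"
proof -
  have 1: "bil (Ric x) (bu x) (($) y) + bil (Ric x) (($) y) (bu x) = Rb0 x y"
    by (simp add: bil_def Rb0_def distrib_left distrib_right sum.distrib mult_ac)
  have 2: "bil (Ric x) (bu x) (bu x) = Rbb x" "tra x (Ric x) = riemann_scalar a x"
    "bil (Ric x) (($) y) (($) y) = Ric00 x y"
    by (simp_all add: bil_def Rbb_def tra_def riemann_scalar_def Ric00_def mult_ac)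
  show ?thesis unfolding gq_expand 1 2 ..
qed

lemma bil_tri: "bil (\<lambda>i j. \<Sum>k. Drdd x i j k * v k) u w = tri x u w v"
  "bil (\<lambda>i k. \<Sum>j. Drdd x i j k * v j) u w = tri x u v w"
proof -
  show "bil (\<lambda>i j. \<Sum>k. Drdd x i j k * v k) u w = tri x u w v"
    by (simp add: bil_def tri_def sum_distribs mult_ac)
  show "bil (\<lambda>i k. \<Sum>j. Drdd x i j k * v j) u w = tri x u v w"
    unfolding bil_def tri_def sum_distrib_right
    by (rule sum.cong[OF refl], subst sum.swap) (simp add: mult_ac)
qed

lemma tra_tri:
  assumes xy: "(x, y) \<in> Om"
  shows "tra x (\<lambda>i j. \<Sum>k. Drdd x i j k * v k) = (\<Sum>m k. Drud x m m k * v k)"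
    "tra x (\<lambda>i k. \<Sum>j. Drdd x i j k * v j) = (\<Sum>m j. Drud x m j m * v j)"
proof -
  have D: "Drud x i j k = (\<Sum>l. ai x i l * Drdd x l j k)" for i j k
    unfolding r_ud_def by (rule cov_ud_raise[OF smb_r_dd xy])
  have "tra x (\<lambda>i j. \<Sum>k. Drdd x i j k * v k) = (\<Sum>i j. ai x i j * (\<Sum>k. Drdd x j i k * v k))"
    unfolding tra_def by (subst sum.swap) (simp add: ai_sym[OF Om_S[OF xy]])
  also have "\<dots> = (\<Sum>m k. Drud x m m k * v k)"
    unfolding D sum_distribs
    by (rule sum.cong[OF refl], subst sum.swap) (simp add: mult_ac)
  finally show "tra x (\<lambda>i j. \<Sum>k. Drdd x i j k * v k) = (\<Sum>m k. Drud x m m k * v k)" .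
  have "tra x (\<lambda>i k. \<Sum>j. Drdd x i j k * v j) = (\<Sum>i k. ai x i k * (\<Sum>j. Drdd x k j i * v j))"
    unfolding tra_def by (subst sum.swap) (simp add: ai_sym[OF Om_S[OF xy]])
  also have "\<dots> = (\<Sum>m j. Drud x m j m * v j)"
    unfolding D sum_distribs
    by (rule sum.cong[OF refl], subst sum.swap) (simp add: mult_ac)
  finally show "tra x (\<lambda>i k. \<Sum>j. Drdd x i j k * v j) = (\<Sum>m j. Drud x m j m * v j)" .
qed

lemma gq_tri:
  assumes xy: "(x, y) \<in> Om"
  shows "gq x y (\<lambda>i j. \<Sum>k. Drdd x i j k * bu x k) = c1 x y * btr x + c2 x y * (bbDr x - r2 x + rsd x)
      + 2 * c3 x y * (bDr0 x y - r0r x y + r0s x y) + c4 x y * bDr x y"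
    "gq x y (\<lambda>i j. \<Sum>k. Drdd x i j k * y $ k) = c1 x y * tr0 x y + c2 x y * (b_Dr0 x y - r0r x y - rsg x y)
      + 2 * c3 x y * (DR00 x y - rr0 x y - r0sg x y) + c4 x y * R000 x y"
    "gq x y (\<lambda>i k. \<Sum>j. Drdd x i j k * y $ j) = c1 x y * dr0 x y + c2 x y * (bDr0 x y - r0r x y + r0s x y)
      + c3 x y * (DR00 x y - rr0 x y - r0sg x y + bDr x y) + c4 x y * R000 x y"
proof -
  have 1: "(\<Sum>m k. Drud x m m k * bu x k) = btr x"
    unfolding btr_def by (subst sum.swap) (simp add: mult.commute)
  show "gq x y (\<lambda>i j. \<Sum>k. Drdd x i j k * bu x k) = c1 x y * btr x + c2 x y * (bbDr x - r2 x + rsd x)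
      + 2 * c3 x y * (bDr0 x y - r0r x y + r0s x y) + c4 x y * bDr x y"
    unfolding gq_expand bil_tri tra_tri[OF xy] tri_values[OF xy] 1 by (simp add: algebra_simps)
  show "gq x y (\<lambda>i j. \<Sum>k. Drdd x i j k * y $ k) = c1 x y * tr0 x y + c2 x y * (b_Dr0 x y - r0r x y - rsg x y)
      + 2 * c3 x y * (DR00 x y - rr0 x y - r0sg x y) + c4 x y * R000 x y"
    unfolding gq_expand bil_tri tra_tri[OF xy] tri_values[OF xy] tr0_def by (simp add: algebra_simps)
  show "gq x y (\<lambda>i k. \<Sum>j. Drdd x i j k * y $ j) = c1 x y * dr0 x y + c2 x y * (bDr0 x y - r0r x y + r0s x y)
      + c3 x y * (DR00 x y - rr0 x y - r0sg x y + bDr x y) + c4 x y * R000 x y"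
    unfolding gq_expand bil_tri tra_tri[OF xy] tri_values[OF xy] dr0_def by (simp add: algebra_simps)
qed

lemma gq_Drd:
  assumes xy: "(x, y) \<in> Om"
  shows "gq x y (Drd x) = c1 x y * dru x + c2 x y * bbDr x + c3 x y * (b_Dr0 x y + bDr0 x y) + c4 x y * DR00 x y"
proof -
  have "tra x (Drd x) = dru x"
    unfolding tra_def dru_def r_u_def cov_u_raise[OF smb_r_d xy]
    by (subst sum.swap) (simp add: ai_sym[OF Om_S[OF xy]])
  then show ?thesis by (simp add: gq_expand bbDr_def b_Dr0_def bil_Drd bDr0_def DR00_def)
qed

lemma gq_Dsd:
  assumes xy: "(x, y) \<in> Om"
  shows "gq x y (Dsd x) = c1 x y * dsu x + c2 x y * (s2 x - rsd x) + c3 x y * (bDs x y - r0s x y - ssg x y) + c4 x y * S00 x y"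
proof -
  have "tra x (Dsd x) = dsu x"
    unfolding tra_def dsu_def s_u_def cov_u_raise[OF smb_s_d xy]
    by (subst sum.swap) (simp add: ai_sym[OF Om_S[OF xy]])
  moreover have "bil (Dsd x) (bu x) (bu x) = s2 x - rsd x"
    by (simp add: bil_Dsd[OF xy] Cb_values[OF xy] rsd_def s2_def dot_commute[of "su x"])
  moreover have "bil (Dsd x) (bu x) (($) y) = - r0s x y - ssg x y"
    by (simp add: bil_Dsd[OF xy] Cb_values[OF xy] more_dots[OF xy] ssg_def dot_commute[of "sg x y"])
  ultimately show ?thesis by (simp add: gq_expand bil_Drd bDs_def S00_def)
qed

lemma gq_rs:
  assumes xy: "(x, y) \<in> Om"
  shows "gq x y (\<lambda>i j. \<Sum>m. rl x m i * sud x m j) = - c2 x y * rsd x + c3 x y * (rsg x y - r0s x y) + c4 x y * r0sg x y"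
proof -
  have b: "bil (\<lambda>i j. \<Sum>m. rl x m i * sud x m j) u v = dot (\<lambda>m. \<Sum>i. rl x m i * u i) (Sm x v)" for u v
  proof -
    have "bil (\<lambda>i j. \<Sum>m. rl x m i * sud x m j) u v = (\<Sum>i j m. rl x m i * u i * (sud x m j * v j))"
      by (simp add: bil_def sum_distribs mult_ac)
    also have "\<dots> = (\<Sum>i m j. rl x m i * u i * (sud x m j * v j))"
      by (intro sum.cong refl sum.swap)
    also have "\<dots> = (\<Sum>m i j. rl x m i * u i * (sud x m j * v j))"
      by (rule sum.swap)
    finally show ?thesis by (simp add: dot_def Sm_def sum_product)
  qed
  have t: "tra x (\<lambda>i j. \<Sum>m. rl x m i * sud x m j) = 0"
  proof -
    have "tra x (\<lambda>i j. \<Sum>m. rl x m i * sud x m j) = (\<Sum>j i m. ai x j i * rl x i m * sud x m j)"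
      unfolding tra_def sum_distrib_left
      by (subst sum.swap) (simp add: ai_sym[OF Om_S[OF xy]] r_sym[of x] mult_ac)
    also have "\<dots> = (\<Sum>j m i. ai x j i * rl x i m * sud x m j)"
      by (intro sum.cong refl sum.swap)
    also have "\<dots> = (\<Sum>k m. rud x k m * sud x m k)"
      by (simp add: r_ud_def raise_dd_def sum_distrib_right)
    finally show ?thesis by (simp add: trace_r_s[OF Om_S[OF xy]])
  qed
  show ?thesis
    unfolding gq_expand b t rr_values Sm_dot[OF xy]
    by (simp add: more_dots[OF xy] rsg_def r0sg_def r0s_def algebra_simps)
qed

section \<open>Linear, quadratic and cubic forms in y\<close>

lemma dy_forms:
  assumes xy: "(x, y) \<in> Om"
  shows "dy i S0 x y = sd x i" "dy i R0 x y = rd x i" "dy i R00 x y = 2 * rd0 x y i"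
  using xy by (simp_all add: dy_hv hv_scalars)

lemma gq_scale: "gq x y (\<lambda>i j. c * q i j) = c * gq x y q"
  by (simp add: gq_def sum_distrib_left mult_ac)

lemma gm_forms:
  assumes xy: "(x, y) \<in> Om"
  shows "gm S0 S0 x y = c1 x y * s2 x + c4 x y * (S0 x y)^2"
    "gm R0 R0 x y = c1 x y * r2 x + c2 x y * (rs x)^2 + 2 * c3 x y * rs x * R0 x y + c4 x y * (R0 x y)^2"
    "gm R0 S0 x y = c1 x y * rsd x + c3 x y * rs x * S0 x y + c4 x y * R0 x y * S0 x y"
    "gm R00 S0 x y = 2 * (c1 x y * r0s x y + c3 x y * R0 x y * S0 x y + c4 x y * R00 x y * S0 x y)"
    "gm R00 R0 x y = 2 * (c1 x y * r0r x y + c2 x y * R0 x y * rs x + c3 x y * ((R0 x y)^2 + R00 x y * rs x) + c4 x y * R00 x y * R0 x y)"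
    "gm R00 R00 x y = 4 * (c1 x y * rr0 x y + c2 x y * (R0 x y)^2 + 2 * c3 x y * R0 x y * R00 x y + c4 x y * (R00 x y)^2)"
proof -
  have c: "(\<lambda>i j. 2 * f i * g j) = (\<lambda>i j. 2 * (f i * g j))" "(\<lambda>i j. 2 * f i * (2 * g j)) = (\<lambda>i j. 4 * (f i * g j))"
    for f g :: "'n \<Rightarrow> real" by (simp_all add: fun_eq_iff)
  show "gm S0 S0 x y = c1 x y * s2 x + c4 x y * (S0 x y)^2"
    "gm R0 R0 x y = c1 x y * r2 x + c2 x y * (rs x)^2 + 2 * c3 x y * rs x * R0 x y + c4 x y * (R0 x y)^2"
    "gm R0 S0 x y = c1 x y * rsd x + c3 x y * rs x * S0 x y + c4 x y * R0 x y * S0 x y"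
    "gm R00 S0 x y = 2 * (c1 x y * r0s x y + c3 x y * R0 x y * S0 x y + c4 x y * R00 x y * S0 x y)"
    "gm R00 R0 x y = 2 * (c1 x y * r0r x y + c2 x y * R0 x y * rs x + c3 x y * ((R0 x y)^2 + R00 x y * rs x) + c4 x y * R00 x y * R0 x y)"
    "gm R00 R00 x y = 4 * (c1 x y * rr0 x y + c2 x y * (R0 x y)^2 + 2 * c3 x y * R0 x y * R00 x y + c4 x y * (R00 x y)^2)"
    unfolding gm_gq dy_forms[OF xy] c(2) unfolding c(1) gq_scale gq_dyad raised
    by (simp_all add: dot_table[OF xy] more_dots[OF xy] s2_def[symmetric] r2_def[symmetric]
        r0s_def[symmetric] r0r_def[symmetric] rr0_def[symmetric] power2_eq_square)
qed

lemma lap_linear_forms: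
  assumes xy: "(x, y) \<in> Om"
  shows "lap S0 x y = 0" "lap R0 x y = 0" "lap dsg x y = 0" "lap bDs x y = 0" "lap ssg x y = 0" "lap rsg x y = 0"
    "lap r0s x y = 0"
    "eu S0 x y = S0 x y" "eu R0 x y = R0 x y" "eu dsg x y = dsg x y" "eu bDs x y = bDs x y" "eu ssg x y = ssg x y"
    "eu rsg x y = rsg x y" "eu r0s x y = r0s x y"
proof -
  have e: "eu (\<lambda>x y. y $ i) x y = y $ i" for i by (simp add: eu_def dy_coord[OF] mult.commute)
  note defs = S0_def[abs_def] R0_def[abs_def] dsg_def[abs_def] bDs_def[abs_def] ssg_def[abs_def] rsg_def[abs_def]
    r0s_def[abs_def] dot_def Ds0_def sg_def rd0_def
  show "lap S0 x y = 0" "lap R0 x y = 0" "lap dsg x y = 0" "lap bDs x y = 0" "lap ssg x y = 0" "lap rsg x y = 0"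
    "lap r0s x y = 0"
    unfolding defs using xy by (simp_all add: lap_sum lap_mult lap_base lap_coord gm_base gm_sym[of x y _ "\<lambda>x y. c x" for c])
  show "eu S0 x y = S0 x y" "eu R0 x y = R0 x y" "eu dsg x y = dsg x y" "eu bDs x y = bDs x y" "eu ssg x y = ssg x y"
    "eu rsg x y = rsg x y" "eu r0s x y = r0s x y"
    unfolding defs using xy by (simp_all add: eu_sum eu_mult eu_base e)
qed

lemma quad_forms:
  assumes xy: "(x, y) \<in> Om"
  shows "lap Ric00 x y = 2 * gq x y (Ric x)" "lap R00 x y = 2 * gq x y (rl x)"
    "lap bDr x y = 2 * gq x y (\<lambda>i j. \<Sum>k. Drdd x i j k * bu x k)"
    "lap S00 x y = 2 * gq x y (Dsd x)" "lap DR00 x y = 2 * gq x y (Drd x)"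
    "lap r0sg x y = 2 * gq x y (\<lambda>i j. \<Sum>m. rl x m i * sud x m j)"
    "eu R00 x y = 2 * R00 x y"
proof -
  have f: "Ric00 = quad (Ric)" "R00 = quad rl"
    "bDr = quad (\<lambda>x i j. \<Sum>k. Drdd x i j k * bu x k)"
    "S00 = quad Dsd" "DR00 = quad Drd"
    "r0sg = quad (\<lambda>x i j. \<Sum>m. rl x m i * sud x m j)"
  proof -
    show "Ric00 = quad (Ric)" "R00 = quad rl"
      by (simp_all add: fun_eq_iff Ric00_def R00_def quad_def)
    show "bDr = quad (\<lambda>x i j. \<Sum>k. Drdd x i j k * bu x k)"
    proof (intro ext)
      fix x y :: "real^'n"
      have "bDr x y = (\<Sum>k i j. Drdd x i j k * y $ i * y $ j * bu x k)"
        by (simp add: bDr_def dot_def Dr00_def sum_distrib_right)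
      also have "\<dots> = (\<Sum>i k j. Drdd x i j k * y $ i * y $ j * bu x k)"
        by (rule sum.swap)
      also have "\<dots> = (\<Sum>i j k. Drdd x i j k * y $ i * y $ j * bu x k)"
        by (intro sum.cong refl sum.swap)
      finally show "bDr x y = quad (\<lambda>x i j. \<Sum>k. Drdd x i j k * bu x k) x y"
        by (simp add: quad_def sum_distrib_right sum_distrib_left mult_ac)
    qed
    have sw: "(\<Sum>k. (\<Sum>i. D i k * y $ i) * y $ k) = (\<Sum>i j. D i j * y $ i * y $ j)"
      for D :: "'n \<Rightarrow> 'n \<Rightarrow> real" and y
      unfolding sum_distrib_right by (rule sum.swap)
    show "S00 = quad Dsd" "DR00 = quad Drd"
      by (simp_all add: fun_eq_iff S00_def DR00_def dot_def Ds0_def Dr0_def quad_def sw)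
    show "r0sg = quad (\<lambda>x i j. \<Sum>m. rl x m i * sud x m j)"
    proof (intro ext)
      fix x y :: "real^'n"
      have "r0sg x y = (\<Sum>m i j. rl x m i * sud x m j * y $ i * y $ j)"
        by (simp add: r0sg_def dot_def rd0_def sg_def sum_product mult_ac)
      also have "\<dots> = (\<Sum>i m j. rl x m i * sud x m j * y $ i * y $ j)"
        by (rule sum.swap)
      also have "\<dots> = (\<Sum>i j m. rl x m i * sud x m j * y $ i * y $ j)"
        by (intro sum.cong refl sum.swap)
      finally show "r0sg x y = quad (\<lambda>x i j. \<Sum>m. rl x m i * sud x m j) x y"
        by (simp add: quad_def sum_distrib_right)
    qed
  qed
  show "lap Ric00 x y = 2 * gq x y (Ric x)" "lap R00 x y = 2 * gq x y (rl x)"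
    "lap bDr x y = 2 * gq x y (\<lambda>i j. \<Sum>k. Drdd x i j k * bu x k)"
    "lap S00 x y = 2 * gq x y (Dsd x)" "lap DR00 x y = 2 * gq x y (Drd x)"
    "lap r0sg x y = 2 * gq x y (\<lambda>i j. \<Sum>m. rl x m i * sud x m j)"
    unfolding f by (rule lap_quad[OF _ xy]; simp)+
  show "eu R00 x y = 2 * R00 x y"
    unfolding f by (rule eu_quad[OF _ xy]) simp
qed

text \<open>r_{ij|k} is symmetric in i and j only. Of the six ways to place two fibre derivatives,
  two hit the pair i, j and four hit k together with i or j; hence the factors 2 and 4.\<close>

lemma cubic_form:
  assumes xy: "(x, y) \<in> Om"
  shows "lap R000 x y = 2 * gq x y (\<lambda>i j. \<Sum>k. Drdd x i j k * y $ k) + 4 * gq x y (\<lambda>i k. \<Sum>j. Drdd x i j k * y $ j)"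
    and "eu R000 x y = 3 * R000 x y"
proof -
  define q where "q k = (\<lambda>x i j. Drdd x i j k)" for k
  have smq: "smb (\<lambda>x. q k x i j)" for k i j by (simp add: q_def)
  have R: "R000 = (\<lambda>x y. \<Sum>k. quad (q k) x y * y $ k)"
    by (simp add: fun_eq_iff R000_def dot_def Dr00_def quad_def q_def)
  have e: "eu (\<lambda>x y. y $ i) x y = y $ i" for i by (simp add: eu_def dy_coord mult.commute)
  show "eu R000 x y = 3 * R000 x y"
    unfolding R using xy sm_quad[OF smq]
    by (simp add: eu_sum eu_mult eu_quad[OF smq xy] e sum_distrib_left) (simp add: mult_ac)
  have 1: "(\<Sum>k. gm (quad (q k)) (\<lambda>x y. y $ k) x y) = 2 * gq x y (\<lambda>i k. \<Sum>j. Drdd x i j k * y $ j)"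
  proof -
    have "gm (quad (q k)) (\<lambda>x y. y $ k) x y = (\<Sum>i. gi i k x y * (2 * (\<Sum>j. Drdd x i j k * y $ j)))" for k
    proof -
      have "dy i (quad (q k)) x y = 2 * (\<Sum>j. Drdd x i j k * y $ j)" for i
        unfolding dy_quad[OF smq xy] unfolding q_def by (simp add: Drdd_sym[of x _ i] sum_distrib_left mult.assoc)
      then show ?thesis by (simp add: gm_def dy_coord mult.assoc[symmetric])
    qed
    then have "(\<Sum>k. gm (quad (q k)) (\<lambda>x y. y $ k) x y)
        = (\<Sum>k i. gi i k x y * (2 * (\<Sum>j. Drdd x i j k * y $ j)))"
      by simp
    also have "\<dots> = (\<Sum>i k. gi i k x y * (2 * (\<Sum>j. Drdd x i j k * y $ j)))"
      by (rule sum.swap)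
    finally show ?thesis unfolding gq_def by (simp add: sum_distrib_left mult_ac)
  qed
  have 2: "(\<Sum>k. gq x y (q k x) * y $ k) = gq x y (\<lambda>i j. \<Sum>k. Drdd x i j k * y $ k)"
  proof -
    have "(\<Sum>k. gq x y (q k x) * y $ k) = (\<Sum>k i j. gi i j x y * Drdd x i j k * y $ k)"
      by (simp add: gq_def q_def sum_distrib_right)
    also have "\<dots> = (\<Sum>i k j. gi i j x y * Drdd x i j k * y $ k)" by (rule sum.swap)
    also have "\<dots> = (\<Sum>i j k. gi i j x y * Drdd x i j k * y $ k)"
      by (intro sum.cong refl sum.swap)
    finally show ?thesis by (simp add: gq_def sum_distrib_left mult.assoc)
  qed
  have "lap R000 x y = (\<Sum>k. 2 * (gq x y (q k x) * y $ k) + 2 * gm (quad (q k)) (\<lambda>x y. y $ k) x y)"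
    unfolding R using xy sm_quad[OF smq]
    by (simp add: lap_sum lap_mult lap_quad[OF smq xy] lap_coord mult.assoc)
  also have "\<dots> = 2 * (\<Sum>k. gq x y (q k x) * y $ k) + 2 * (\<Sum>k. gm (quad (q k)) (\<lambda>x y. y $ k) x y)"
    by (simp add: sum.distrib sum_distrib_left)
  finally show "lap R000 x y = 2 * gq x y (\<lambda>i j. \<Sum>k. Drdd x i j k * y $ k) + 4 * gq x y (\<lambda>i k. \<Sum>j. Drdd x i j k * y $ j)"
    unfolding 1 2 by simp
qed

section \<open>The scalar curvature of a Kropina metric\<close>

text \<open>\<open>lap_homogeneous\<close> is applied to each summand of \<open>kropina_ric\<close>.
  For F^2, F, 1/F and 1/F^2 with coefficients of degree 0, 1, 3 and 4 it contributes the factors 2n,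
  n + 1, -(n + 3) and -2(n + 4).\<close>

lemma lap_spray_ric:
  assumes xy: "(x, y) \<in> Om" and n: "n = real CARD('n)"
  defines "A2 \<equiv> - tS2 x / 4 - s2 x * ib x / 2"
    and "A1 \<equiv> - dsg x y + ib x * bDs x y + (ib x)^2 * (b2 x * tr x - rs x) * S0 x y + (n - 1) * ib x * ssg x y
      - ib x * r0s x y - ib x * rsg x y"
    and "A0 \<equiv> ib x * lap bDr x y + (ib x)^2 * (b2 x * tr x - rs x) * lap R00 x y + (n - 2) * ib x * lap S00 x y
      - ib x * lap DR00 x y + 2 * n * ib x * lap r0sg x y
      + (ib x)^2 * (- 2 * (n - 2) * gm S0 S0 x y + 2 * gm R0 R0 x y + 2 * (6 - 4 * n) * gm R0 S0 x y)"
    and "B1 \<equiv> (n - 1) * ib x * R000 x y + (n - 1) * (ib x)^2 * R00 x y * (2 * S0 x y - 4 * R0 x y)"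
    and "C1 \<equiv> (n - 1) * ib x * lap R000 x y + (n - 1) * (ib x)^2
      * (2 * (S0 x y * lap R00 x y + 2 * gm R00 S0 x y) - 4 * (R0 x y * lap R00 x y + 2 * gm R00 R0 x y))"
    and "B2 \<equiv> 3 * (n - 1) * (ib x)^2 * (R00 x y)^2"
    and "C2 \<equiv> 3 * (n - 1) * (ib x)^2 * (2 * (R00 x y * lap R00 x y) + 2 * gm R00 R00 x y)"
  shows "lap (spray_ric G) x y = lap Ric00 x y + 2 * n * A2 + (n + 1) * Ek x y * A1 + A0
    - (n + 3) * (Ek x y)^3 * B1 + Ek x y * C1 - 2 * (n + 4) * (Ek x y)^4 * B2 + (Ek x y)^2 * C2"
proof -
  \<comment> \<open>The coefficients are rewritten as products with base functions in front, the
    form in which the product rules of \<open>lap\<close> and \<open>eu\<close> apply.\<close>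
  define P2 where "P2 = (\<lambda>(x::real^'n) (y::real^'n). - (tS2 x / 4) - s2 x * ib x / 2)"
  define P1 where "P1 = (\<lambda>x y. - dsg x y + ib x * bDs x y + ((ib x)^2 * (b2 x * tr x - rs x)) * S0 x y
      + ((n - 1) * ib x) * ssg x y - ib x * r0s x y - ib x * rsg x y)"
  define P0 where "P0 = (\<lambda>x y. ib x * bDr x y + ((ib x)^2 * (b2 x * tr x - rs x)) * R00 x y + ((n - 2) * ib x) * S00 x y
      - ib x * DR00 x y + (2 * n * ib x) * r0sg x y
      + (((ib x)^2 * (2 - n)) * (S0 x y * S0 x y) + (ib x)^2 * (R0 x y * R0 x y) + ((ib x)^2 * (6 - 4 * n)) * (R0 x y * S0 x y)))"
  define M1 where "M1 = (\<lambda>x y. ((n - 1) * ib x) * R000 x y + (2 * ((n - 1) * (ib x)^2)) * (R00 x y * S0 x y)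
      - (4 * ((n - 1) * (ib x)^2)) * (R00 x y * R0 x y))"
  define M2 where "M2 = (\<lambda>x y. (3 * (n - 1) * (ib x)^2) * (R00 x y * R00 x y))"
  have sm: "sm P2" "sm P1" "sm P0" "sm M1" "sm M2" "sm Ric00"
    unfolding P2_def P1_def P0_def M1_def M2_def by simp_all
  have ric: "spray_ric G x y = Ric00 x y + Fk x y * (Fk x y * P2 x y) + Fk x y * P1 x y + P0 x y
      + Ek x y * M1 x y + Ek x y * (Ek x y * M2 x y)" if "(x, y) \<in> Om" for x y
    unfolding kropina_ric[OF that] n[symmetric] P2_def P1_def P0_def M1_def M2_def
    by (simp add: algebra_simps power2_eq_square)
  have eu: "eu P2 x y = 0 * P2 x y" "eu P1 x y = 1 * P1 x y" "eu M1 x y = 3 * M1 x y" "eu M2 x y = 4 * M2 x y"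
  proof -
    show "eu P2 x y = 0 * P2 x y" unfolding P2_def by (simp add: eu_base)
    show "eu P1 x y = 1 * P1 x y"
      unfolding P1_def using xy by (simp add: eu_add eu_diff eu_minus eu_mult eu_base lap_linear_forms)
    show "eu M1 x y = 3 * M1 x y"
      unfolding M1_def using xy
      by (simp add: eu_add eu_diff eu_mult eu_base lap_linear_forms quad_forms cubic_form)
    show "eu M2 x y = 4 * M2 x y"
      unfolding M2_def using xy by (simp add: eu_mult eu_base quad_forms)
  qed
  have lp: "lap P2 x y = 0" "lap P1 x y = 0" "lap P0 x y = A0" "lap M1 x y = C1" "lap M2 x y = C2"
  proof -
    show "lap P2 x y = 0" unfolding P2_def using xy by (rule lap_base)
    show "lap P1 x y = 0"
      unfolding P1_def using xy by (simp add: lap_add lap_diff lap_minus lap_mult lap_base gm_base lap_linear_forms)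
    show "lap P0 x y = A0"
      unfolding P0_def A0_def using xy
      by (simp add: lap_add lap_diff lap_mult lap_base gm_base lap_linear_forms) (simp add: algebra_simps)
    show "lap M1 x y = C1"
      unfolding M1_def C1_def using xy
      by (simp add: lap_add lap_diff lap_mult lap_base gm_base lap_linear_forms) (simp add: algebra_simps)
    show "lap M2 x y = C2"
      unfolding M2_def C2_def using xy by (simp add: lap_mult lap_base gm_base)
  qed
  \<comment> \<open>For the squares the rule is used twice; the inner product has its degree shifted
    by one, from 0 to 1 for F and from 4 to 3 for 1/F.\<close>
  have eFP: "eu (\<lambda>x y. Fk x y * P2 x y) x y = 1 * (Fk x y * P2 x y)"
    using xy sm by (simp add: eu_mult eu eu_F)
  have eEM: "eu (\<lambda>x y. Ek x y * M2 x y) x y = 3 * (Ek x y * M2 x y)"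
    using xy sm by (simp add: eu_mult eu eu_E)
  have v: "P2 x y = A2" "P1 x y = A1" "M1 x y = B1" "M2 x y = B2"
    by (simp_all add: P2_def A2_def P1_def A1_def M1_def B1_def M2_def B2_def algebra_simps power2_eq_square)
  have "lap (spray_ric G) x y = lap (\<lambda>x y. Ric00 x y + Fk x y * (Fk x y * P2 x y) + Fk x y * P1 x y + P0 x y
      + Ek x y * M1 x y + Ek x y * (Ek x y * M2 x y)) x y"
    by (rule lap_cong[OF ric xy])
  also have "\<dots> = lap Ric00 x y + lap (\<lambda>x y. Fk x y * (Fk x y * P2 x y)) x y + lap (\<lambda>x y. Fk x y * P1 x y) x y + lap P0 x y
      + lap (\<lambda>x y. Ek x y * M1 x y) x y + lap (\<lambda>x y. Ek x y * (Ek x y * M2 x y)) x y"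
    using xy sm by (simp add: lap_add)
  also have "lap (\<lambda>x y. Fk x y * (Fk x y * P2 x y)) x y = 2 * n * A2"
  proof -
    have "lap (\<lambda>x y. Fk x y * (Fk x y * P2 x y)) x y = 2 * n * (Fk x y * Ek x y) * P2 x y"
      using lap_homogeneous(1)[OF _ eFP xy] lap_homogeneous(1)[OF sm(1) eu(1) xy] sm
      by (simp add: lp n) (simp add: algebra_simps)
    then show ?thesis by (simp add: nz(4)[OF xy] v)
  qed
  also have "lap (\<lambda>x y. Fk x y * P1 x y) x y = (n + 1) * Ek x y * A1"
    using lap_homogeneous(1)[OF sm(2) eu(2) xy] by (simp add: lp n v add.commute)
  also have "lap (\<lambda>x y. Ek x y * M1 x y) x y = - (n + 3) * (Ek x y)^3 * B1 + Ek x y * C1"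
    using lap_homogeneous(2)[OF sm(4) eu(3) xy] by (simp add: lp n v algebra_simps)
  also have "lap (\<lambda>x y. Ek x y * (Ek x y * M2 x y)) x y = - 2 * (n + 4) * (Ek x y)^4 * B2 + (Ek x y)^2 * C2"
    using lap_homogeneous(2)[OF _ eEM xy] lap_homogeneous(2)[OF sm(5) eu(4) xy] sm
    by (simp add: lp n v power2_eq_square power3_eq_cube power4_eq_xxxx) (simp add: algebra_simps)
  finally show ?thesis by (simp add: lp algebra_simps)
qed

text \<open>Every part of \<Pi> is linear in y except r_{00}/F inside \<open>U\<close>, so this term
  alone survives; -(n + 1) is its coefficient in \<open>Q_formula\<close>.\<close>

lemma lap_spray_div:
  assumes xy: "(x, y) \<in> Om" and n: "n = real CARD('n)"
  shows "lap (spray_div G) x y = - (n + 1) * (ib x * (Ek x y * Ek x y * ((1 - n) * (Ek x y * R00 x y) + be x y * tr x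
    - be x y * (ib x * rs x) + 4 * (be x y * (ib x * (Ek x y * R0 x y))) - 4 * (be x y * (ib x * (Ek x y * (Ek x y * R00 x y)))))))"
proof -
  have lU: "lap U x y = ib x * (- (n + 1) * (Ek x y)^3 * R00 x y + Ek x y * lap R00 x y)"
  proof -
    have e: "eu R00 x y = 2 * R00 x y" by (rule quad_forms[OF xy])
    have "lap U x y = ib x * lap (\<lambda>x y. Ek x y * R00 x y) x y"
    proof -
      have "U = (\<lambda>x y. ib x * (S0 x y + Ek x y * R00 x y))" by (simp add: fun_eq_iff U_def mult.commute)
      then show ?thesis using xy by (simp add: lap_bmult lap_add lap_linear_forms)
    qed
    then show ?thesis using lap_homogeneous(2)[OF _ e xy] by (simp add: n algebra_simps)
  qed
  have "lap (spray_div G) x y = lap (\<lambda>x y. (\<Sum>m. N x y m m) + ((ib x * R0 x y + ib x * S0 x y) - (n + 1) * U x y)) x y"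
    by (rule lap_cong[OF _ xy]) (simp add: spray_div_G Q_formula n algebra_simps)
  also have "\<dots> = lap (\<lambda>x y. \<Sum>m. N x y m m) x y - (n + 1) * lap U x y"
    using xy by (simp add: lap_add lap_diff lap_bmult lap_cmult lap_linear_forms)
  also have "lap (\<lambda>x y. \<Sum>m. N x y m m) x y = 0"
    unfolding N_def using xy by (simp add: lap_sum lap_bmult lap_coord)
  finally show ?thesis
    unfolding lU quad_forms[OF xy] gq_rl[OF xy] c1_def c2_def c3_def c4_def
    by (simp add: algebra_simps power2_eq_square power3_eq_cube)
qed

lemma vf_more:
  assumes xy: "(x, y) \<in> Om"
  shows "vf (\<lambda>x y. tr x) x y = tr0 x y" "vf (\<lambda>x y. rs x) x y = r0r x y + rsg x y + b_Dr0 x y" "vf Ek x y = 0"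
proof -
  have 1: "pd k tr x = (\<Sum>m. Drud x m m k)" for k
    using partial_trace[of "rud" x y k] xy by (simp add: tr_def[abs_def])
  show "vf (\<lambda>x y. tr x) x y = tr0 x y"
    using xy by (simp add: vf_hv hv_base 1) (simp add: tr0_def sum_distrib_right, rule sum.swap)
  have 2: "pd k rs x = (\<Sum>i. Dbu x i k * rd x i) + (\<Sum>i. bu x i * Drd x i k)" for k
    using partial_pairing[of "bu" "rd" x y k] xy by (simp add: rs_def[abs_def])
  have 3: "(\<Sum>k. (\<Sum>i. Dbu x i k * rd x i) * y $ k) = dot (Cb x (($) y)) (rd x)"
    unfolding dot_def Cb_def sum_distrib_right by (subst sum.swap) (simp add: mult_ac)
  have 4: "(\<Sum>k. (\<Sum>i. bu x i * Drd x i k) * y $ k) = b_Dr0 x y"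
    unfolding b_Dr0_def bil_dot by (simp add: mult.commute)
  have "vf (\<lambda>x y. rs x) x y = dot (Cb x (($) y)) (rd x) + b_Dr0 x y"
    using xy by (simp add: vf_hv hv_base 2 distrib_right sum.distrib 3 4)
  then show "vf (\<lambda>x y. rs x) x y = r0r x y + rsg x y + b_Dr0 x y"
    by (simp add: Cb_values[OF xy] more_dots[OF xy] rsg_def dot_commute[of "sg x y"])
  show "vf Ek x y = 0"
    using vf_Fk[OF xy] by (simp add: vf_hv[OF xy] hv_E[OF xy])
qed

lemma vf_diff: "sm f \<Longrightarrow> sm g \<Longrightarrow> (x, y) \<in> Om \<Longrightarrow> vf (\<lambda>x y. f x y - g x y) x y = vf f x y - vf g x y"
  by (simp add: vf_hv hv_diff)

text \<open>\<open>E\<close> behaves as a constant, so only \<beta>, 1/b^2 and the contractions are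
  differentiated. \<open>db\<close> and \<open>di\<close> name the first two derivatives, and
  \<open>W\<close> is the inner bracket of \<open>lap_spray_div\<close>.\<close>

lemma vf_lap_spray_div:
  assumes xy: "(x, y) \<in> Om" and n: "n = real CARD('n)"
  defines "W \<equiv> (1 - n) * (Ek x y * R00 x y) + be x y * tr x
    - be x y * (ib x * rs x) + 4 * (be x y * (ib x * (Ek x y * R0 x y))) - 4 * (be x y * (ib x * (Ek x y * (Ek x y * R00 x y))))"
    and "db \<equiv> 2 * U x y * be x y" and "di \<equiv> vf (\<lambda>x y. ib x) x y"
  shows "vf (lap (spray_div G)) x y = - (n + 1) * (Ek x y)^2 * (di * W + ib x * (
      (1 - n) * (Ek x y * vf R00 x y) + db * tr x + be x y * tr0 x y
      - db * (ib x * rs x) - be x y * (di * rs x) - be x y * (ib x * (r0r x y + rsg x y + b_Dr0 x y))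
      + 4 * Ek x y * (db * ib x * R0 x y + be x y * di * R0 x y + be x y * ib x * vf R0 x y)
      - 4 * (Ek x y)^2 * (db * ib x * R00 x y + be x y * di * R00 x y + be x y * ib x * vf R00 x y)))"
proof -
  have "vf (lap (spray_div G)) x y = vf (\<lambda>x y. - (n + 1) * (ib x * (Ek x y * Ek x y * ((1 - n) * (Ek x y * R00 x y) + be x y * tr x
    - be x y * (ib x * rs x) + 4 * (be x y * (ib x * (Ek x y * R0 x y))) - 4 * (be x y * (ib x * (Ek x y * (Ek x y * R00 x y)))))))) x y"
    by (rule vf_cong[OF _ xy]) (rule lap_spray_div[OF _ n])
  also have "\<dots> = - (n + 1) * (Ek x y)^2 * (di * W + ib x * (
      (1 - n) * (Ek x y * vf R00 x y) + db * tr x + be x y * tr0 x y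
      - db * (ib x * rs x) - be x y * (di * rs x) - be x y * (ib x * (r0r x y + rsg x y + b_Dr0 x y))
      + 4 * Ek x y * (db * ib x * R0 x y + be x y * di * R0 x y + be x y * ib x * vf R0 x y)
      - 4 * (Ek x y)^2 * (db * ib x * R00 x y + be x y * di * R00 x y + be x y * ib x * vf R00 x y)))"
    using xy unfolding W_def
    by (simp add: vf_mult vf_add vf_diff vf_const vf_more vf_be db_def[symmetric] di_def[symmetric])
      (simp add: algebra_simps power2_eq_square)
  finally show ?thesis .
qed

end

text \<open>Division by \<open>F\<close> and \<open>b\<^sup>2\<close> is avoided throughout: \<open>E\<close> and \<open>ib\<close> stand for \<open>1/F\<close> and \<open>1/b\<^sup>2\<close>, and the hypotheses
  \<open>e\<close> name the products \<open>b\<^sup>2 tr\<close>, \<open>F r\<close>, \<dots> with which the identity becomes one of polynomials.\<close>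

lemma scalar_identity:
  fixes n E ib be tq Rq g h k m :: real
  assumes e: "tr = ib * tq" "Rsc = ib * Rq" "rs = E * k" "R0 = E * m" "rsg = E * g" "r0sg = E * h"
    and U: "U = (S0 + R00 * E) * ib"
    and c: "c1 = be * E / 2" "c2 = - (be * E * ib / 2)" "c3 = be * ib * E^2" "c4 = E^2 - 2 * be * ib * E^3"
    and l: "lRic = 2 * (c1 * Rsc + c2 * Rbb + c3 * Rb0 + c4 * Ric00)"
      "lR00 = 2 * (c1 * tr + c2 * rs + 2 * c3 * R0 + c4 * R00)"
      "lbDr = 2 * (c1 * btr + c2 * (bbDr - r2 + rsd) + 2 * c3 * (bDr0 - r0r + r0s) + c4 * bDr)"
      "lR000 = 2 * (c1 * tr0 + c2 * (q1 - r0r - rsg) + 2 * c3 * (DR00 - rr0 - r0sg) + c4 * R000)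
        + 4 * (c1 * dr0 + c2 * (bDr0 - r0r + r0s) + c3 * (DR00 - rr0 - r0sg + bDr) + c4 * R000)"
      "lDR = 2 * (c1 * dru + c2 * bbDr + c3 * (q1 + bDr0) + c4 * DR00)"
      "lS = 2 * (c1 * dsu + c2 * (s2 - rsd) + c3 * (bDs - r0s - ssg) + c4 * S00)"
      "lrs = 2 * (- c2 * rsd + c3 * (rsg - r0s) + c4 * r0sg)"
    and gm: "gSS = c1 * s2 + c4 * S0^2" "gRR = c1 * r2 + c2 * rs^2 + 2 * c3 * rs * R0 + c4 * R0^2"
      "gRS = c1 * rsd + c3 * rs * S0 + c4 * R0 * S0"
      "g2S = 2 * (c1 * r0s + c3 * R0 * S0 + c4 * R00 * S0)"
      "g2R = 2 * (c1 * r0r + c2 * R0 * rs + c3 * (R0^2 + R00 * rs) + c4 * R00 * R0)"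
      "g22 = 4 * (c1 * rr0 + c2 * R0^2 + 2 * c3 * R0 * R00 + c4 * R00^2)"
    and v: "vR0 = DR00 + g - U * k + 2 * U * R0" "vR00 = R000 + 2 * h - 2 * U * m + 4 * U * R00"
      "db = 2 * U * be" "di = - 2 * ib^2 * (R0 + S0)"
      "W = (1 - n) * (E * R00) + be * tr - be * (ib * rs) + 4 * (be * (ib * (E * R0))) - 4 * (be * (ib * (E * (E * R00))))"
  shows "lRic + 2 * n * (- tS2 / 4 - s2 * ib / 2)
    + (n + 1) * E * (- dsg + ib * bDs + ib^2 * (tq - rs) * S0 + (n - 1) * ib * ssg - ib * r0s - ib * rsg)
    + (ib * lbDr + ib^2 * (tq - rs) * lR00 + (n - 2) * ib * lS - ib * lDR + 2 * n * ib * lrs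
      + ib^2 * (- 2 * (n - 2) * gSS + 2 * gRR + 2 * (6 - 4 * n) * gRS))
    - (n + 3) * E^3 * ((n - 1) * ib * R000 + (n - 1) * ib^2 * R00 * (2 * S0 - 4 * R0))
    + E * ((n - 1) * ib * lR000 + (n - 1) * ib^2 * (2 * (S0 * lR00 + 2 * g2S) - 4 * (R0 * lR00 + 2 * g2R)))
    - 2 * (n + 4) * E^4 * (3 * (n - 1) * ib^2 * R00^2)
    + E^2 * (3 * (n - 1) * ib^2 * (2 * (R00 * lR00) + 2 * g22))
    + - (n + 1) * E^2 * (di * W + ib * ((1 - n) * (E * vR00) + db * tr + be * tr0
      - db * (ib * rs) - be * (di * rs) - be * (ib * (r0r + rsg + q1))
      + 4 * E * (db * ib * R0 + be * di * R0 + be * ib * vR0)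
      - 4 * E^2 * (db * ib * R00 + be * di * R00 + be * ib * vR00))) =
    2 * (- (24 * (n - 2) * be * ib^3 * E^5) * R00^2
    + E^4 * (- ((n - 1) * (n - 8) * ib^2) * R00^2 + (40 * (n - 2) * be * ib^3) * R00 * R0
      - (8 * (n - 2) * be * ib^3) * R00 * S0 - (4 * (n - 2) * be * ib^2) * R000)
    + E^3 * ((2 * (n - 1) * ib) * R000 + (4 * (n - 1) * ib^2) * R00 * (S0 - 2 * R0)
      + (2 * (n - 2) * be * ib^2) * DR00 - (2 * (n - 2) * be * ib^2) * S00 + (2 * (n - 2) * be * ib^2) * bDr
      + (2 * (n - 1) * be * ib^2) * rr0 - (4 * (n - 2) * be * ib^2) * r0sg
      - (14 * (n - 2) * be * ib^3) * R0^2 + (2 * (n - 2) * be * ib^3) * S0^2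
      + (2 * (n - 3) * (tq - rs) * be * ib^3) * R00
      + (12 * (n - 2) * be * ib^3) * R0 * S0 - (2 * (3 * n - 5) * be * ib^3) * R00 * rs - (2 * be * ib) * Ric00)
    + E^2 * (- ((n^2 + 4 * n - 7) * ib^2) * S0 * R0 + ((n^2 + 2 * n - 1) * ib) * r0sg
      - ((n - 5) * (tq - rs) * be * ib^3) * R0 + (3 * (n - 1) * be * ib^3) * rs * R0
      + ((n - 1) * (tq - rs) * ib^3) * be * S0 - ((2 * n - 3) * be * ib^2) * r0s
      - ((3 * n - 7) * be * ib^3) * rs * S0 - ((n - 2) * ib^2) * S0^2 + R0^2 * ib^2
      - (be * ib) * tr0 + ((n - 1) * ib) * be * dr0 - ((2 * n - 1) * be * ib^2) * r0r
      + ((n - 2) * be * ib^2) * bDs - ((n - 2) * be * ib^2) * ssg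
      + ((n - 2) * ib) * S00 + ((tq - rs) * ib^2) * R00 - ((n - 2) * be * ib^2) * bDr0
      + bDr * ib - DR00 * ib + ((n - 2) * be * ib^2) * rsg + Ric00 + (be * ib) * Rb0)
    + E * (((n^2 - 1) * (ib / 2)) * ssg + ((n + 1) * (tq - rs) * (ib^2 / 2)) * S0 + (n + 1) * bDs * (ib / 2)
      - ((n + 1) * (ib / 2)) * rsg - ((n + 1) * (ib / 2)) * r0s - ((n + 1) / 2) * dsg
      - ((n - 2) * be * ib^2) * s2 + be * r2 * ib^2 - ((n - 3) * be * (ib^2 / 2)) * rsd
      + ((n - 2) * be * (ib / 2)) * dsu + (tr * tr * (ib / 2)) * be - rs * tr * be * ib^2
      + (be * (ib / 2)) * btr - (be * (ib / 2)) * dru + (be * (ib / 2)) * (Rq - Rbb))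
    - (n * (ib / 2)) * s2 - (n / 4) * tS2)"
  unfolding v gm l unfolding c U unfolding e by algebra

context kropina_chart
begin

context
  fixes x y :: "real^'n"
  assumes xy: "(x, y) \<in> Om"
begin

lemma quotients:
  "1 / Fk x y = Ek x y" "1 / Fk x y ^ k = (Ek x y) ^ k"
  "t / ((b2 x)^3 * (Fk x y)^5) = t * (ib x)^3 * (Ek x y)^5"
  "t / b2 x = t * ib x" "t / (b2 x)^2 = t * (ib x)^2" "t / (b2 x)^3 = t * (ib x)^3"
  "t / (2 * b2 x) = t * (ib x / 2)" "t / (2 * (b2 x)^2) = t * ((ib x)^2 / 2)"
  using Fk_Ek[OF xy] by (simp_all add: eliminate(1)[OF xy] power_divide)

text \<open>These supply the hypotheses \<open>e\<close> of \<open>scalar_identity\<close>, where a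
  quantity is \<open>E\<close> or \<open>ib\<close> times its product with F or b^2.\<close>

lemma F_cancel: "t = Ek x y * (Fk x y * t)" and b2_cancel: "t = ib x * (b2 x * t)"
proof -
  have "Ek x y * Fk x y = 1" "ib x * b2 x = 1"
    using nz(4,5)[OF xy] by (simp_all only: mult.commute)
  then show "t = Ek x y * (Fk x y * t)" "t = ib x * (b2 x * t)"
    by (simp_all only: mult.assoc[symmetric] mult_1_left)
qed

lemma vf_R0_R00: "vf R0 x y = DR00 x y + Fk x y * rsg x y - U x y * (Fk x y * rs x) + 2 * U x y * R0 x y"
  "vf R00 x y = R000 x y + 2 * (Fk x y * r0sg x y) - 2 * U x y * (Fk x y * R0 x y) + 4 * U x y * R00 x y"
  by (simp_all add: vf_scalars[OF xy])

lemma twice_scalar: "2 * finsler_scalar (kropina a b) x y = lap (spray_ric G) x y + vf (lap (spray_div G)) x y"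
  unfolding finsler_scalar_G[OF xy] by simp

text \<open>\<open>scalar_identity\<close> with its premises discharged in order: cancellations,
  \<open>U\<close>, coefficients of g^{ij}, second-order terms, gradient pairings, spray
  derivatives. The outcome is the formula for twice the scalar curvature.\<close>

lemmas kropina_scalar = trans[OF twice_scalar[unfolded lap_spray_ric[OF xy refl] vf_lap_spray_div[OF xy refl]]
  scalar_identity[OF b2_cancel b2_cancel F_cancel F_cancel F_cancel F_cancel eliminate(3)[OF xy]
    c1_def c2_def c3_def c4_def
    quad_forms(1)[OF xy, unfolded gq_Ric] quad_forms(2)[OF xy, unfolded gq_rl[OF xy]]
    quad_forms(3)[OF xy, unfolded gq_tri[OF xy]] cubic_form(1)[OF xy, unfolded gq_tri[OF xy]]
    quad_forms(5)[OF xy, unfolded gq_Drd[OF xy]] quad_forms(4)[OF xy, unfolded gq_Dsd[OF xy]]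
    quad_forms(6)[OF xy, unfolded gq_rs[OF xy]] gm_forms[OF xy] vf_R0_R00 refl vf_scalars(4)[OF xy] refl]]

end

section \<open>The contractions as they occur in the theorem\<close>

lemma contraction_defs:
  "(\<Sum>j. rl x k j * y $ j) = rd0 x y k"
  "(\<Sum>j. sud x k j * y $ j) = sg x y k"
  "(\<Sum>j. Drd x j k * y $ j) = Dr0 x y k"
  "(\<Sum>j. Dsd x j k * y $ j) = Ds0 x y k"
  "(\<Sum>i j. Drdd x i j k * y $ i * y $ j) = Dr00 x y k"
  "(\<Sum>i. bu x i * bd x i) = b2 x"
  "(\<Sum>i. bu x i * rd x i) = rs x"
  "(\<Sum>i j. rl x i j * y $ i * y $ j) = R00 x y"
  "(\<Sum>i. rd x i * y $ i) = R0 x y"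
  "(\<Sum>i. sd x i * y $ i) = S0 x y"
  "(\<Sum>m. rud x m m) = tr x"
  "(\<Sum>i j. Ric x i j * y $ i * y $ j) = Ric00 x y"
  "(\<Sum>m j. Drud x m m j * y $ j) = tr0 x y"
  "(\<Sum>m j. Drud x m j m * y $ j) = dr0 x y"
  "(\<Sum>m j. Dsud x m j m * y $ j) = dsg x y"
  "(\<Sum>k l. (bu x k * y $ l + bu x l * y $ k) * Ric x k l) = Rb0 x y"
  "(\<Sum>k l. bu x k * bu x l * Ric x k l) = Rbb x"
  "(\<Sum>m. cov_u a su x m m) = dsu x"
  "(\<Sum>m. cov_u a ru x m m) = dru x"
  "(\<Sum>m k. bu x m * Drud x k k m) = btr x"
  "(\<Sum>t m. sud x t m * sud x m t) = tS2 x"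
  by (simp_all add: rd0_def sg_def Dr0_def Ds0_def Dr00_def b2_def rs_def R00_def R0_def S0_def tr_def Ric00_def tr0_def
      dr0_def dsg_def Rb0_def Rbb_def dsu_def dru_def btr_def tS2_def)

lemma contraction_dots:
  "(\<Sum>m. bu x m * Dr00 x y m) = bDr x y"
  "(\<Sum>k. ru0 x y k * rd0 x y k) = rr0 x y"
  "(\<Sum>k. rd0 x y k * sg x y k) = r0sg x y"
  "(\<Sum>m. rd0 x y m * su x m) = r0s x y"
  "(\<Sum>m. rd0 x y m * ru x m) = r0r x y"
  "(\<Sum>m. bu x m * Ds0 x y m) = bDs x y"
  "(\<Sum>m. Ds0 x y m * bu x m) = bDs x y"
  "(\<Sum>m. sd x m * sg x y m) = ssg x y"
  "(\<Sum>m. rd x m * sg x y m) = rsg x y"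
  "(\<Sum>m. bu x m * Dr0 x y m) = bDr0 x y"
  "(\<Sum>m. sd x m * su x m) = s2 x"
  "(\<Sum>m. ru x m * rd x m) = r2 x"
  "(\<Sum>k. ru x k * sd x k) = rsd x"
  by (simp_all add: bDr_def rr0_def r0sg_def r0s_def r0r_def bDs_def ssg_def rsg_def bDr0_def s2_def r2_def rsd_def dot_def mult.commute)

lemma contraction_rules:
  assumes xy: "(x, y) \<in> Om"
  shows "(\<Sum>j. rud x k j * y $ j) = ru0 x y k"
    "(\<Sum>i j k. Drdd x i j k * y $ i * y $ j * y $ k) = R000 x y"
    "(\<Sum>i j. Drd x i j * y $ i * y $ j) = DR00 x y"
    "(\<Sum>i j. Dsd x i j * y $ i * y $ j) = S00 x y"
    "(\<Sum>m. ru0 x y m * sd x m) = r0s x y"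
    "(\<Sum>k m. rud x k m * sud x m k) = 0"
proof -
  have R000: "R000 x y = tri x (($) y) (($) y) (($) y)" by (simp add: tri_values[OF xy])
  have sw: "(\<Sum>i j. D i j * y $ i * y $ j) = (\<Sum>k. (\<Sum>i. D i k * y $ i) * y $ k)"
    for D :: "'n \<Rightarrow> 'n \<Rightarrow> real"
    unfolding sum_distrib_right by (rule sum.swap)
  have r0s: "dot (ru0 x y) (sd x) = r0s x y" by (rule more_dots[OF xy])
  show "(\<Sum>j. rud x k j * y $ j) = ru0 x y k"
    by (simp add: r_ud_raise rd0_def[abs_def])
  show "(\<Sum>i j k. Drdd x i j k * y $ i * y $ j * y $ k) = R000 x y"
    by (simp add: R000 tri_def)
  show "(\<Sum>i j. Drd x i j * y $ i * y $ j) = DR00 x y"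
    unfolding sw by (simp add: DR00_def dot_def Dr0_def)
  show "(\<Sum>i j. Dsd x i j * y $ i * y $ j) = S00 x y"
    unfolding sw by (simp add: S00_def dot_def Ds0_def)
  show "(\<Sum>m. ru0 x y m * sd x m) = r0s x y"
    using r0s by (simp add: dot_def)
  show "(\<Sum>k m. rud x k m * sud x m k) = 0"
    by (rule trace_r_s[OF Om_S[OF xy]])
qed

end

theorem proposition3p2:
  fixes M :: "'m topology"
    and A :: "('m, 'n::finite) chart set"
    and metric :: "('m, 'n) chart \<Rightarrow> real^'n \<Rightarrow> real^'n^'n"
    and form :: "('m, 'n) chart \<Rightarrow> real^'n \<Rightarrow> real^'n"
    and U :: "'m set" and \<phi> :: "'m \<Rightarrow> real^'n" and p :: 'm and y :: "real^'n"
  assumes "smooth_manifold M A"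
    and "riemannian_metric A metric"
    and "one_form A form" and "nowhere_vanishing A form"
    and "(U, \<phi>) \<in> A" and "p \<in> U"
    and "beta_form (form (U, \<phi>)) (\<phi> p) y > 0"
  shows "let n = real CARD('n);
    x = \<phi> p;
    a = metric (U, \<phi>);
    b = form (U, \<phi>);
    F = kropina a b x y;
    \<beta> = beta_form b x y;
    bu = b_u a b x;
    b2 = (\<Sum>i\<in>UNIV. bu i * b_d b x i);
    b4 = b2^2;
    b6 = b2^3;
    rdd = r_dd a b x;
    rud = r_ud a b x;
    sud = s_ud a b x;
    rd = r_d a b x;
    sd = s_d a b x;
    ru = r_u a b x;
    su = s_u a b x;
    r = (\<Sum>i\<in>UNIV. bu i * rd i);
    Drdd = cov_dd a (r_dd a b) x;
    Drud = cov_ud a (r_ud a b) x;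
    Dsud = cov_ud a (s_ud a b) x;
    Drd = cov_d a (r_d a b) x;
    Dsd = cov_d a (s_d a b) x;
    Dru = cov_u a (r_u a b) x;
    Dsu = cov_u a (s_u a b) x;
    rd0 = \<lambda>k. (\<Sum>j\<in>UNIV. rdd k j * y $ j);
    ru0 = \<lambda>k. (\<Sum>j\<in>UNIV. rud k j * y $ j);
    su0 = \<lambda>k. (\<Sum>j\<in>UNIV. sud k j * y $ j);
    r00 = (\<Sum>i\<in>UNIV. \<Sum>j\<in>UNIV. rdd i j * y $ i * y $ j);
    r0 = (\<Sum>i\<in>UNIV. rd i * y $ i);
    s0 = (\<Sum>i\<in>UNIV. sd i * y $ i);
    r00_0 = (\<Sum>i\<in>UNIV. \<Sum>j\<in>UNIV. \<Sum>k\<in>UNIV. Drdd i j k * y $ i * y $ j * y $ k);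
    r00_m = \<lambda>m. (\<Sum>i\<in>UNIV. \<Sum>j\<in>UNIV. Drdd i j m * y $ i * y $ j);
    r0_0 = (\<Sum>i\<in>UNIV. \<Sum>j\<in>UNIV. Drd i j * y $ i * y $ j);
    s0_0 = (\<Sum>i\<in>UNIV. \<Sum>j\<in>UNIV. Dsd i j * y $ i * y $ j);
    r0_m = \<lambda>m. (\<Sum>j\<in>UNIV. Drd j m * y $ j);
    s0_m = \<lambda>m. (\<Sum>j\<in>UNIV. Dsd j m * y $ j);
    tr = (\<Sum>m\<in>UNIV. rud m m);
    Ric = riemann_ricci a x;
    Ric00 = (\<Sum>i\<in>UNIV. \<Sum>j\<in>UNIV. Ric i j * y $ i * y $ j);
    Rsc = riemann_scalar a x
  in finsler_scalar (kropina a b) x y =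
      - (24 * (n - 2) * \<beta> / (b6 * F^5)) * r00^2
      + (1 / F^4) * (- ((n - 1) * (n - 8) / b4) * r00^2 + (40 * (n - 2) * \<beta> / b6) * r00 * r0
        - (8 * (n - 2) * \<beta> / b6) * r00 * s0 - (4 * (n - 2) * \<beta> / b4) * r00_0)
      + (1 / F^3) * ((2 * (n - 1) / b2) * r00_0 + (4 * (n - 1) / b4) * r00 * (s0 - 2 * r0)
        + (2 * (n - 2) * \<beta> / b4) * r0_0 - (2 * (n - 2) * \<beta> / b4) * s0_0
        + (2 * (n - 2) * \<beta> / b4) * (\<Sum>m\<in>UNIV. bu m * r00_m m)
        + (2 * (n - 1) * \<beta> / b4) * (\<Sum>k\<in>UNIV. ru0 k * rd0 k)
        - (4 * (n - 2) * \<beta> / b4) * (\<Sum>k\<in>UNIV. rd0 k * su0 k)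
        - (14 * (n - 2) * \<beta> / b6) * r0^2 + (2 * (n - 2) * \<beta> / b6) * s0^2
        + (2 * (n - 3) * (b2 * tr - r) * \<beta> / b6) * r00
        + (12 * (n - 2) * \<beta> / b6) * r0 * s0 - (2 * (3 * n - 5) * \<beta> / b6) * r00 * r
        - (2 * \<beta> / b2) * Ric00)
      + (1 / F^2) * (- ((n^2 + 4 * n - 7) / b4) * s0 * r0
        + ((n^2 + 2 * n - 1) / b2) * (\<Sum>m\<in>UNIV. rd0 m * su0 m)
        - ((n - 5) * (b2 * tr - r) * \<beta> / b6) * r0 + (3 * (n - 1) * \<beta> / b6) * r * r0
        + ((n - 1) * (b2 * tr - r) / b6) * \<beta> * s0
        - ((2 * n - 3) * \<beta> / b4) * (\<Sum>m\<in>UNIV. ru0 m * sd m)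
        - ((3 * n - 7) * \<beta> / b6) * r * s0 - ((n - 2) / b4) * s0^2 + r0^2 / b4
        - (\<beta> / b2) * (\<Sum>m\<in>UNIV. \<Sum>j\<in>UNIV. Drud m m j * y $ j)
        + ((n - 1) / b2) * \<beta> * (\<Sum>m\<in>UNIV. \<Sum>j\<in>UNIV. Drud m j m * y $ j)
        - ((2 * n - 1) * \<beta> / b4) * (\<Sum>m\<in>UNIV. rd0 m * ru m)
        + ((n - 2) * \<beta> / b4) * (\<Sum>m\<in>UNIV. bu m * s0_m m)
        - ((n - 2) * \<beta> / b4) * (\<Sum>m\<in>UNIV. sd m * su0 m)
        + ((n - 2) / b2) * s0_0 + ((b2 * tr - r) / b4) * r00
        - ((n - 2) * \<beta> / b4) * (\<Sum>m\<in>UNIV. bu m * r0_m m)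
        + (\<Sum>m\<in>UNIV. bu m * r00_m m) / b2 - r0_0 / b2
        + ((n - 2) * \<beta> / b4) * (\<Sum>m\<in>UNIV. rd m * su0 m)
        + Ric00
        + (\<beta> / b2) * (\<Sum>k\<in>UNIV. \<Sum>l\<in>UNIV. (bu k * y $ l + bu l * y $ k) * Ric k l))
      + (1 / F) * (((n^2 - 1) / (2 * b2)) * (\<Sum>m\<in>UNIV. sd m * su0 m)
        + ((n + 1) * (b2 * tr - r) / (2 * b4)) * s0
        + (n + 1) * (\<Sum>m\<in>UNIV. s0_m m * bu m) / (2 * b2)
        - ((n + 1) / (2 * b2)) * (\<Sum>m\<in>UNIV. rd m * su0 m)
        - ((n + 1) / (2 * b2)) * (\<Sum>m\<in>UNIV. rd0 m * su m)
        - ((n + 1) / 2) * (\<Sum>m\<in>UNIV. \<Sum>j\<in>UNIV. Dsud m j m * y $ j)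
        - ((n - 2) * \<beta> / b4) * (\<Sum>m\<in>UNIV. sd m * su m)
        + \<beta> * (\<Sum>m\<in>UNIV. ru m * rd m) / b4
        - ((n - 3) * \<beta> / (2 * b4)) * (\<Sum>k\<in>UNIV. ru k * sd k)
        + ((n - 2) * \<beta> / (2 * b2)) * (\<Sum>m\<in>UNIV. Dsu m m)
        + (tr * tr / (2 * b2)) * \<beta> - r * tr * \<beta> / b4
        + (\<beta> / (2 * b2)) * (\<Sum>m\<in>UNIV. \<Sum>k\<in>UNIV. bu m * Drud k k m)
        - (\<beta> / (2 * b2)) * (\<Sum>m\<in>UNIV. Dru m m)
        + ((n - 1) * \<beta> / (2 * b2)) * (\<Sum>k\<in>UNIV. \<Sum>m\<in>UNIV. rud k m * sud m k)
        + (\<beta> / (2 * b2)) * (b2 * Rsc - (\<Sum>k\<in>UNIV. \<Sum>l\<in>UNIV. bu k * bu l * Ric k l)))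
      - (n / (2 * b2)) * (\<Sum>m\<in>UNIV. sd m * su m) - (n / 4) * (\<Sum>t\<in>UNIV. \<Sum>m\<in>UNIV. sud t m * sud m t)"
proof -
  let ?S = "\<phi> ` U" and ?a = "metric (U, \<phi>)" and ?b = "form (U, \<phi>)"
  have S: "open ?S"
    using assms(1,5) by (auto simp: smooth_manifold_def)
  have a: "smooth_on (\<lambda>x. ?a x $ i $ j) ?S"
    "x \<in> ?S \<Longrightarrow> transpose (?a x) = ?a x" "x \<in> ?S \<Longrightarrow> v \<noteq> 0 \<Longrightarrow> v \<bullet> (?a x *v v) > 0" for i j x v
    using assms(2,5) unfolding riemannian_metric_def by fastforce+
  have b: "smooth_on (\<lambda>x. ?b x $ i) ?S" "x \<in> ?S \<Longrightarrow> ?b x \<noteq> 0" for i x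
    using assms(3,4,5) unfolding one_form_def nowhere_vanishing_def by fastforce+
  have sym: "x \<in> ?S \<Longrightarrow> ?a x $ i $ j = ?a x $ j $ i" for x i j
    using arg_cong[OF a(2), of x "\<lambda>M. M $ i $ j"] by (simp add: transpose_def)
  \<comment> \<open>The statement concerns one chart at a time, so all the preceding theory applies
    on the coordinate range of \<open>U\<close>.\<close>
  interpret kropina_chart ?S ?a ?b
    by unfold_locales (fact S a(1) sym a(3) b)+
  have xy: "(\<phi> p, y) \<in> Om"
    using assms(6,7) by (simp add: Om_def)
  show ?thesis
    \<comment> \<open>Folding every sum into its name and every quotient into \<open>Ek\<close> and
      \<open>ib\<close> makes the goal polynomial; what then remains is the factor 2 and
      rearrangement.\<close>
    by (simp only: Let_def contraction_defs contraction_dots contraction_rules[OF xy] kropina_F[OF xy] quotients[OF xy])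
      (use kropina_scalar[OF xy] in algebra)
qed

end
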